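(* Let $X$ be a ball quasi-Banach function space on $\mathbb{R}^n$ and $r,p\in(1,\infty)$. Assume that $X^{1/p}$ is a ball Banach function space and that $M_n$ is bounded on $(X^{1/p})'$. Then there exists a positive constant $C$ such that, for any sequence $\{f_i\}_{i\in\mathbb{Z}}$ of measurable functions on $\mathbb{R}^n$, $$\left\|\left\{\sum_{i\in\mathbb{Z}}[M_n(f_i)]^r\right\}^{1/r}\right\|_X\le C\left\|\left(\sum_{i\in\mathbb{Z}}|f_i|^r\right)^{1/r}\right\|_X .$$
   Context: $\mathscr{M}(\mathbb{R}^n)$ is the set of all measurable functions on $\mathbb{R}^n$. A quasi-normed linear space $X\subset\mathscr{M}(\mathbb{R}^n)$, whose quasi-norm $\|\cdot\|_X$ makes sense for all measurable functions, is a ball quasi-Banach function space if: (i) $\|f\|_X=0$ implies $f=0$ a.e.; (ii) $|g|\le|f|$ a.e. implies $\|g\|_X\le\|f\|_X$; (iii) $0\le f_m\uparrow f$ a.e. as $m\to\infty$ implies $\|f_m\|_X\uparrow\|f\|_X$; (iv) $\mathbf{1}_B\in X$ for every ball $B\subset\mathbb{R}^n$. It is a ball Banach function space if moreover (v) $\|f+g\|_X\le\|f\|_X+\|g\|_X$ for all $f,g\in X$, and (vi) for every ball $B$ there is a constant $C_{(B)}\in(0,\infty)$ with $\int_B|f(x)|\,dx\le C_{(B)}\|f\|_X$ for all $f\in X$. For $s\in(0,\infty)$, the $s$-convexification of $X$ is $X^s:=\{f\in\mathscr{M}(\mathbb{R}^n):|f|^s\in X\}$ with $\|f\|_{X^s}:=\||f|^s\|_X^{1/s}$.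 For a ball Banach function space $Y$, its associate space is $Y':=\{f\in\mathscr{M}(\mathbb{R}^n):\|f\|_{Y'}<\infty\}$ with $\|f\|_{Y'}:=\sup\{\|fg\|_{L^1(\mathbb{R}^n)}:g\in Y,\ \|g\|_Y=1\}$. $M_n$ is the maximal operator in the $n$-th variable: for $f\in\mathscr{M}(\mathbb{R}^n)$ and $x=(x_1,\ldots,x_n)\in\mathbb{R}^n$, $M_n(f)(x):=\sup_{B\ni x_n}\frac{1}{|B|}\int_B|f(x_1,\ldots,x_{n-1},y_n)|\,dy_n$, where the supremum is over all balls (bounded open intervals) $B\subset\mathbb{R}$ containing $x_n$. *)

theory Defs
  imports "HOL-Analysis.Analysis"
begin

text \<open>
  Measurable functions on \<open>\<real>\<^sup>n\<close> are Lebesgue measurable functions with values in the extended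
  reals, since maximal functions and infinite sums may take the value \<open>\<infinity>\<close>.  A function space is
  given by its functional \<open>N\<close>, defined for all measurable functions and with values in
  \<open>[0, \<infinity>]\<close>; the space itself consists of the measurable \<open>f\<close> with \<open>N f < \<infinity>\<close>.  For a ball
  quasi-Banach function space such an \<open>f\<close> is automatically finite almost everywhere, so the
  convention for \<open>\<infinity> - \<infinity>\<close> in \<^typ>\<open>ereal\<close> plays no role in sums of its members.
\<close>

type_synonym 'n fun_norm = "(real ^ 'n \<Rightarrow> ereal) \<Rightarrow> ennreal"

definition space_of :: "('n::finite) fun_norm \<Rightarrow> (real ^ 'n \<Rightarrow> ereal) set" where
  "space_of N = {f \<in> borel_measurable lebesgue. N f < \<infinity>}"

definition quasi_normed_space :: "('n::finite) fun_norm \<Rightarrow> bool" where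
  "quasi_normed_space N \<longleftrightarrow>
     (\<forall>f\<in>space_of N. \<forall>c::real. N (\<lambda>x. ereal c * f x) = ennreal \<bar>c\<bar> * N f) \<and>
     (\<exists>K::real. K \<ge> 1 \<and>
        (\<forall>f\<in>space_of N. \<forall>g\<in>space_of N. N (\<lambda>x. f x + g x) \<le> ennreal K * (N f + N g)))"

definition ball_quasi_banach_function_space :: "('n::finite) fun_norm \<Rightarrow> bool" where
  "ball_quasi_banach_function_space N \<longleftrightarrow>
     quasi_normed_space N \<and>
     (\<forall>f\<in>borel_measurable lebesgue. N f = 0 \<longrightarrow> (AE x in lebesgue. f x = 0)) \<and>
     (\<forall>f\<in>borel_measurable lebesgue. \<forall>g\<in>borel_measurable lebesgue.
        (AE x in lebesgue. \<bar>g x\<bar> \<le> \<bar>f x\<bar>) \<longrightarrow> N g \<le> N f) \<and>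
     (\<forall>F. \<forall>f\<in>borel_measurable lebesgue.
        (\<forall>m::nat. F m \<in> borel_measurable lebesgue) \<longrightarrow>
        (AE x in lebesgue. (\<forall>m. 0 \<le> F m x) \<and> incseq (\<lambda>m. F m x) \<and> (\<lambda>m. F m x) \<longlonglongrightarrow> f x) \<longrightarrow>
        incseq (\<lambda>m. N (F m)) \<and> (\<lambda>m. N (F m)) \<longlonglongrightarrow> N f) \<and>
     (\<forall>c \<rho>. 0 < \<rho> \<longrightarrow> indicator (ball c \<rho>) \<in> space_of N)"

definition ball_banach_function_space :: "('n::finite) fun_norm \<Rightarrow> bool" where
  "ball_banach_function_space N \<longleftrightarrow>
     ball_quasi_banach_function_space N \<and>
     (\<forall>f\<in>space_of N. \<forall>g\<in>space_of N. N (\<lambda>x. f x + g x) \<le> N f + N g) \<and>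
     (\<forall>c \<rho>. 0 < \<rho> \<longrightarrow>
        (\<exists>C::real. C > 0 \<and>
           (\<forall>f\<in>space_of N.
              (\<integral>\<^sup>+x\<in>ball c \<rho>. e2ennreal \<bar>f x\<bar> \<partial>lebesgue) \<le> ennreal C * N f)))"

text \<open>Powers with a positive real exponent \<open>s\<close> on \<open>[0, \<infinity>]\<close>, with \<open>\<infinity>\<^sup>s = \<infinity>\<close>.\<close>

definition enn_powr :: "ennreal \<Rightarrow> real \<Rightarrow> ennreal" where
  "enn_powr u s = (if u = \<infinity> then \<infinity> else ennreal (enn2real u powr s))"

definition abs_powr :: "ereal \<Rightarrow> real \<Rightarrow> ennreal" where
  "abs_powr u s = enn_powr (e2ennreal \<bar>u\<bar>) s"

definition convexification :: "('n::finite) fun_norm \<Rightarrow> real \<Rightarrow> 'n fun_norm" where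
  "convexification N s = (\<lambda>f. enn_powr (N (\<lambda>x. enn2ereal (abs_powr (f x) s))) (1 / s))"

definition associate_norm :: "('n::finite) fun_norm \<Rightarrow> 'n fun_norm" where
  "associate_norm N =
     (\<lambda>f. SUP g \<in> {g \<in> space_of N. N g = 1}. \<integral>\<^sup>+x. e2ennreal \<bar>f x * g x\<bar> \<partial>lebesgue)"

definition bounded_on ::
    "((real ^ 'n \<Rightarrow> ereal) \<Rightarrow> (real ^ 'n \<Rightarrow> ereal)) \<Rightarrow> ('n::finite) fun_norm \<Rightarrow> bool" where
  "bounded_on T N \<longleftrightarrow>
     (\<exists>C::real. C > 0 \<and> (\<forall>f\<in>space_of N. T f \<in> space_of N \<and> N (T f) \<le> ennreal C * N f))"

text \<open>
  Coordinates are indexed by a finite linear order; the \<open>n\<close>-th variable is the one with the largest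
  index.  For Lebesgue measurable \<open>f\<close>, almost every slice \<open>f (x\<^sub>1, \<dots>, x\<^sub>n\<^sub>-\<^sub>1, \<cdot>)\<close> is measurable; on the
  null set of remaining points the nonnegative integral below is a lower integral.
\<close>

definition subst_last :: "real ^ ('n::{finite,linorder}) \<Rightarrow> real \<Rightarrow> real ^ ('n::{finite,linorder})" where
  "subst_last x y = (\<chi> i. if i = Max UNIV then y else x $ i)"

definition maximal_last ::
    "(real ^ ('n::{finite,linorder}) \<Rightarrow> ereal) \<Rightarrow> (real ^ ('n::{finite,linorder}) \<Rightarrow> ereal)" where
  "maximal_last f x = enn2ereal
     (SUP (a, b) \<in> {(a, b). x $ Max UNIV \<in> {a<..<b}}.
        (\<integral>\<^sup>+y\<in>{a<..<b}. e2ennreal \<bar>f (subst_last x y)\<bar> \<partial>lebesgue) / emeasure lebesgue {a<..<b})"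

definition lr_sum :: "real \<Rightarrow> (int \<Rightarrow> real ^ 'n \<Rightarrow> ereal) \<Rightarrow> (real ^ ('n::finite) \<Rightarrow> ereal)" where
  "lr_sum r F x = enn2ereal (enn_powr (\<Sum>\<^sub>\<infinity>i. abs_powr (F i x) r) (1 / r))"

end

theory Submission
  imports Defs
begin

text \<open>
  Put \<open>Y = X^(1/p)\<close> and write \<open>M\<close> for the maximal operator in the last variable.  Raised to the
  power \<open>p\<close>, the assertion becomes a bound in the Banach function space \<open>Y\<close>: the norm of
  \<open>P = (\<Sum> (M f\<^sub>i)\<^sup>r)^(p/r)\<close> is at most a constant times the norm of \<open>Q = (\<Sum> \<bar>f\<^sub>i\<bar>\<^sup>r)^(p/r)\<close>.

  By the Lorentz--Luxemburg theorem (\<open>Lorentz_Luxemburg\<close>) the norm of \<open>P\<close> is the supremum of \<open>\<integral> P g\<close>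
  over \<open>g\<close> in the unit ball of \<open>Y'\<close>.  Since \<open>M\<close> is bounded on \<open>Y'\<close>, the iteration of Rubio de Francia
  enlarges \<open>g\<close> to a weight \<open>w\<close> in \<open>Y'\<close> of norm at most \<open>2\<close> that satisfies the \<open>A\<^sub>1\<close> condition \<open>M w \<le> K w\<close>
  (\<open>A1_majorant_associate\<close>).  So it is enough to know \<open>\<integral> P w \<le> C \<integral> Q w\<close> for such weights, with \<open>C\<close>
  depending only on \<open>K, r, p\<close>; the Hoelder inequality then bounds \<open>\<integral> Q w\<close> by the norm of \<open>Q\<close>.  Integrating
  first in the last variable reduces this weighted inequality to one on the line.

  On the line an \<open>A\<^sub>1\<close> weight disappears into the measure: with \<open>\<mu> = w dx\<close> one has \<open>M f \<le> K M\<^sub>\<mu> f\<close>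
  pointwise, where \<open>M\<^sub>\<mu>\<close> averages with respect to \<open>\<mu>\<close>.  The uncentred operator \<open>M\<^sub>\<mu>\<close> is as good as the usual
  one for every locally finite \<open>\<mu>\<close>, doubling or not, because a finite family of intervals can be thinned out
  to one with the same union and overlap at most two.  This gives
  \<open>\<integral> (M\<^sub>\<mu> f)\<^sup>r \<phi> d\<mu> \<le> C \<integral> f\<^sup>r M\<^sub>\<mu> \<phi> d\<mu>\<close> (\<open>Fefferman_Stein_weighted\<close>), from which the vector-valued
  bound on \<open>L\<^sup>p(\<mu>)\<close> follows, with a constant independent of \<open>\<mu>\<close>:

  \<^item> for \<open>p = r\<close> by summation with \<open>\<phi> = 1\<close>;

  \<^item> for \<open>p > r\<close> by choosing \<open>\<phi> = F^(p-r)\<close> with \<open>F = (\<Sum> (M\<^sub>\<mu> f\<^sub>i)\<^sup>r)^(1/r)\<close>, and absorbing \<open>\<integral> F\<^sup>p d\<mu>\<close> from the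
    right-hand side;

  \<^item> for \<open>p < r\<close> by changing the measure once more, to \<open>v d\<mu>\<close> with \<open>v = H^((r-p)/(r-1))\<close> for an \<open>A\<^sub>1\<close> majorant \<open>H\<close>
    of \<open>(\<Sum> \<bar>f\<^sub>i\<bar>\<^sup>r)^(1/r)\<close>, and applying the case \<open>p = r\<close> to \<open>f\<^sub>i / v\<close>.
\<close>

section \<open>Real powers on the extended half-line\<close>

lemma enn_powr_zero [simp]: "enn_powr 0 s = 0"
  by (simp add: enn_powr_def)

lemma enn_powr_top [simp]: "enn_powr top s = top"
  by (simp add: enn_powr_def)

lemma enn_powr_ennreal_nonneg: "0 \<le> x \<Longrightarrow> enn_powr (ennreal x) s = ennreal (x powr s)"
  by (simp add: enn_powr_def)

lemma enn_powr_one_left [simp]: "enn_powr 1 s = 1"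
  by (simp add: enn_powr_def)

lemma enn_powr_one [simp]: "enn_powr u 1 = u"
  by (cases u) (auto simp: enn_powr_ennreal_nonneg)

lemma enn_powr_mono: "0 \<le> s \<Longrightarrow> u \<le> v \<Longrightarrow> enn_powr u s \<le> enn_powr v s"
  by (cases u; cases v)
     (auto simp: enn_powr_ennreal_nonneg intro!: ennreal_leI powr_mono2 simp: top_unique)

lemma enn_powr_mult: "0 < s \<Longrightarrow> enn_powr (u * v) s = enn_powr u s * enn_powr v s"
  by (cases u; cases v)
     (auto simp: enn_powr_ennreal_nonneg ennreal_mult[symmetric] powr_mult ennreal_top_mult
        ennreal_mult_top enn_powr_def)

lemma enn_powr_powr: "0 < t \<Longrightarrow> enn_powr (enn_powr u s) t = enn_powr u (s * t)"
  by (cases u) (auto simp: enn_powr_ennreal_nonneg powr_powr)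

lemma enn_powr_add: "enn_powr u (s + t) = enn_powr u s * enn_powr u t"
  by (cases u) (auto simp: enn_powr_ennreal_nonneg powr_add ennreal_mult[symmetric] ennreal_top_mult)

lemma enn_powr_eq_0_iff [simp]: "enn_powr u s = 0 \<longleftrightarrow> u = 0"
  by (cases u) (auto simp: enn_powr_ennreal_nonneg)

lemma enn_powr_eq_top_iff [simp]: "enn_powr u s = top \<longleftrightarrow> u = top"
  by (cases u) (auto simp: enn_powr_ennreal_nonneg)

lemma enn_powr_le_iff:
  assumes "0 < s"
  shows "enn_powr u s \<le> v \<longleftrightarrow> u \<le> enn_powr v (1 / s)"
proof
  assume "enn_powr u s \<le> v"
  then have "enn_powr (enn_powr u s) (1 / s) \<le> enn_powr v (1 / s)"
    using assms by (intro enn_powr_mono) auto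
  then show "u \<le> enn_powr v (1 / s)" using assms by (simp add: enn_powr_powr)
next
  assume "u \<le> enn_powr v (1 / s)"
  then have "enn_powr u s \<le> enn_powr (enn_powr v (1 / s)) s"
    using assms by (intro enn_powr_mono) auto
  then show "enn_powr u s \<le> v" using assms by (simp add: enn_powr_powr)
qed

text \<open>
  A power with positive exponent is an order isomorphism of \<open>[0, \<infinity>]\<close>, its inverse being the reciprocal
  power; so it commutes with suprema.
\<close>

lemma enn_powr_SUP:
  assumes "0 < s" "I \<noteq> {}"
  shows "enn_powr (SUP i\<in>I. u i) s = (SUP i\<in>I. enn_powr (u i) s)"
proof (rule antisym)
  show "enn_powr (SUP i\<in>I. u i) s \<le> (SUP i\<in>I. enn_powr (u i) s)"
    unfolding enn_powr_le_iff[OF assms(1)]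
  proof (intro SUP_least)
    fix i assume "i \<in> I"
    then show "u i \<le> enn_powr (SUP i\<in>I. enn_powr (u i) s) (1 / s)"
      unfolding enn_powr_le_iff[OF assms(1), symmetric] by (rule SUP_upper)
  qed
  show "(SUP i\<in>I. enn_powr (u i) s) \<le> enn_powr (SUP i\<in>I. u i) s"
    using assms by (intro SUP_least enn_powr_mono SUP_upper) auto
qed

lemma enn_powr_measurable [measurable (raw)]:
  assumes [measurable]: "f \<in> borel_measurable M"
  shows "(\<lambda>x. enn_powr (f x) s) \<in> borel_measurable M"
proof -
  have [measurable]: "Measurable.pred M (\<lambda>x. f x = \<infinity>)"
    using measurable_sets_Collect[OF assms, of "\<lambda>u. u = \<infinity>"] by (simp add: pred_def)
  show ?thesis unfolding enn_powr_def by measurable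
qed

text \<open>
  Young's inequality without the optimal constants: according to whether \<open>b \<le> a^(s-1)\<close> or not, one of the two
  terms alone dominates \<open>a b\<close>.
\<close>

lemma enn_powr_Young:
  assumes "1 < s"
  shows "a * b \<le> enn_powr a s + enn_powr b (s / (s - 1))"
proof (cases "b \<le> enn_powr a (s - 1)")
  case True
  have "a * b \<le> enn_powr a 1 * enn_powr a (s - 1)"
    using True by (simp add: mult_left_mono)
  also have "\<dots> = enn_powr a s"
    unfolding enn_powr_add[symmetric] by simp
  finally show ?thesis by (simp add: add_increasing2)
next
  case False
  have "a \<le> enn_powr b (1 / (s - 1))"
    using False assms enn_powr_le_iff[of "s - 1" a b] by auto
  then have "a * b \<le> enn_powr b (1 / (s - 1)) * enn_powr b 1"
    by (simp add: mult_right_mono)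
  also have "\<dots> = enn_powr b (s / (s - 1))"
    unfolding enn_powr_add[symmetric] using assms by (simp add: field_simps)
  finally show ?thesis by (simp add: add_increasing)
qed

text \<open>
  Bounded truncations with small support; they make integrals finite before something is subtracted, and
  are removed by monotone convergence.
\<close>

lemma truncations:
  fixes u :: ennreal
  assumes "incseq A"
  shows incseq_truncations: "incseq (\<lambda>m. min u (of_nat m) * indicator (A m) x)"
    and SUP_truncations: "x \<in> (\<Union>m. A m) \<Longrightarrow> (SUP m. min u (of_nat m) * indicator (A m) x) = u"
proof -
  let ?F = "\<lambda>m. min u (of_nat m) * indicator (A m) x"
  show "incseq ?F"
    using incseqD[OF assms, of m "Suc m" for m]
    by (intro incseq_SucI mult_mono min.mono) (auto simp: indicator_def)
  assume "x \<in> (\<Union>m. A m)"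
  then obtain m0 where m0: "x \<in> A m0" by blast
  show "(SUP m. ?F m) = u"
  proof (rule antisym)
    show "(SUP m. ?F m) \<le> u" by (rule SUP_least) (simp add: indicator_def)
    show "u \<le> (SUP m. ?F m)"
    proof (rule ccontr)
      assume "\<not> u \<le> (SUP m. ?F m)"
      then have less: "(SUP m. ?F m) < u" by simp
      then have "(SUP m. ?F m) < top" by (simp add: order_less_le_trans)
      then obtain m1 where m1: "(SUP m. ?F m) < of_nat m1" using ennreal_Ex_less_of_nat by auto
      define m where "m = max m0 m1"
      have "x \<in> A m" using m0 incseqD[OF assms, of m0 m] by (auto simp: m_def)
      moreover have "(SUP m. ?F m) < of_nat m"
        using m1 by (rule order_less_le_trans) (simp add: m_def)
      ultimately have "(SUP m. ?F m) < ?F m" using less by simp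
      moreover have "?F m \<le> (SUP m. ?F m)" by (intro SUP_upper) simp
      ultimately show False by simp
    qed
  qed
qed

lemma nn_integral_layer_real:
  assumes s: "0 < s" and c: "0 \<le> c"
  shows "(\<integral>\<^sup>+l. ennreal (s * l powr (s - 1)) * indicator {0<..<c} l \<partial>lborel) = ennreal (c powr s)"
proof -
  have "((\<lambda>x. s * x powr (s - 1)) has_integral s * (c powr (s - 1 + 1) / (s - 1 + 1))) {0..c}"
    by (intro has_integral_mult_right has_integral_powr_from_0) (use s c in auto)
  then have "((\<lambda>x. s * x powr (s - 1)) has_integral (c powr s)) {0..c}"
    using s by simp
  then have "((\<lambda>x. s * x powr (s - 1)) has_integral (c powr s)) {0<..<c}"
    by (simp add: has_integral_Icc_iff_Ioo)
  from nn_integral_has_integral_lebesgue[OF _ this]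
  have "(\<integral>\<^sup>+l. ennreal (indicator {0<..<c} l * (s * l powr (s - 1))) \<partial>lborel) = ennreal (c powr s)"
    using s by (auto simp: mult_nonneg_nonneg)
  then show ?thesis
    by (simp add: ennreal_mult' ennreal_indicator mult.commute)
qed

lemma enn_powr_layer_cake:
  assumes s: "0 < s"
  shows "enn_powr u s = (\<integral>\<^sup>+l. ennreal (s * l powr (s - 1)) * indicator {l. 0 < l \<and> ennreal l < u} l \<partial>lborel)"
proof (cases u)
  case (real c)
  have "{l. 0 < l \<and> ennreal l < u} = {0<..<c}"
    using real by (auto simp: ennreal_less_iff)
  then show ?thesis
    using nn_integral_layer_real[OF s] real by (simp add: enn_powr_ennreal_nonneg)
next
  case top
  have "ennreal (real n powr s) \<le> (\<integral>\<^sup>+l. ennreal (s * l powr (s - 1)) * indicator {l. 0 < l \<and> ennreal l < u} l \<partial>lborel)" for n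
    unfolding nn_integral_layer_real[OF s, of "real n", simplified, symmetric]
    by (intro nn_integral_mono mult_left_mono) (auto simp: indicator_def top)
  then have "(SUP n. ennreal (real n powr s)) \<le> (\<integral>\<^sup>+l. ennreal (s * l powr (s - 1)) * indicator {l. 0 < l \<and> ennreal l < u} l \<partial>lborel)"
    by (rule SUP_least)
  moreover have "(SUP n. ennreal (real n powr s)) = enn_powr (SUP n. ennreal (real n)) s"
    by (subst enn_powr_SUP) (auto simp: s enn_powr_ennreal_nonneg)
  moreover have "(SUP n. ennreal (real n)) = top"
    using ennreal_SUP_of_nat_eq_top by (simp add: ennreal_of_nat_eq_real_of_nat)
  ultimately show ?thesis by (simp add: top top_unique)
qed

section \<open>The uncentred maximal function of a measure on the line\<close>

text \<open>
  The quotient is read with the conventions of \<open>ennreal\<close>.  On an interval of measure zero the integral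
  vanishes too, and the average is \<open>0\<close>; on an interval of infinite measure it is also \<open>0\<close>.
\<close>

definition maximal_fun :: "real measure \<Rightarrow> (real \<Rightarrow> ennreal) \<Rightarrow> real \<Rightarrow> ennreal" where
  "maximal_fun \<mu> f x = (SUP (a, b) \<in> {(a, b). x \<in> {a<..<b}}.
     (\<integral>\<^sup>+y\<in>{a<..<b}. f y \<partial>\<mu>) / emeasure \<mu> {a<..<b})"

lemma maximal_fun_upper:
  "x \<in> {a<..<b} \<Longrightarrow> (\<integral>\<^sup>+y\<in>{a<..<b}. f y \<partial>\<mu>) / emeasure \<mu> {a<..<b} \<le> maximal_fun \<mu> f x"
  unfolding maximal_fun_def by (rule SUP_upper2[of "(a, b)"]) auto

lemma maximal_fun_least:
  assumes "\<And>a b. x \<in> {a<..<b} \<Longrightarrow> (\<integral>\<^sup>+y\<in>{a<..<b}. f y \<partial>\<mu>) / emeasure \<mu> {a<..<b} \<le> c"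
  shows "maximal_fun \<mu> f x \<le> c"
  unfolding maximal_fun_def by (rule SUP_least) (use assms in auto)

lemma maximal_fun_less_iff:
  "c < maximal_fun \<mu> f x \<longleftrightarrow>
     (\<exists>a b. x \<in> {a<..<b} \<and> c < (\<integral>\<^sup>+y\<in>{a<..<b}. f y \<partial>\<mu>) / emeasure \<mu> {a<..<b})"
  unfolding maximal_fun_def less_SUP_iff by auto

text \<open>
  Superlevel sets are open, being unions of the intervals with large averages.
\<close>

lemma maximal_fun_measurable [measurable]: "maximal_fun \<mu> f \<in> borel_measurable borel"
proof (rule borel_measurableI_greater)
  fix c
  have "open {x. c < maximal_fun \<mu> f x}"
  proof (subst open_subopen, safe)
    fix x assume "c < maximal_fun \<mu> f x"
    then obtain a b where x: "x \<in> {a<..<b}"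
      and c: "c < (\<integral>\<^sup>+y\<in>{a<..<b}. f y \<partial>\<mu>) / emeasure \<mu> {a<..<b}"
      unfolding maximal_fun_less_iff by blast
    have "{a<..<b} \<subseteq> {x. c < maximal_fun \<mu> f x}"
      using order_less_le_trans[OF c maximal_fun_upper] by (intro subsetI) simp
    then show "\<exists>T. open T \<and> x \<in> T \<and> T \<subseteq> {x. c < maximal_fun \<mu> f x}"
      using x by (intro exI[of _ "{a<..<b}"] conjI open_greaterThanLessThan)
  qed
  then show "{x \<in> space borel. c < maximal_fun \<mu> f x} \<in> sets borel" by simp
qed

lemma maximal_fun_mono_AE:
  assumes "AE y in \<mu>. f y \<le> g y"
  shows "maximal_fun \<mu> f x \<le> maximal_fun \<mu> g x"
proof (rule maximal_fun_least)
  fix a b assume x: "x \<in> {a<..<b}"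
  have "(\<integral>\<^sup>+y\<in>{a<..<b}. f y \<partial>\<mu>) \<le> (\<integral>\<^sup>+y\<in>{a<..<b}. g y \<partial>\<mu>)"
    using assms by (intro nn_integral_mono_AE) (auto elim!: eventually_mono intro: mult_right_mono)
  then show "(\<integral>\<^sup>+y\<in>{a<..<b}. f y \<partial>\<mu>) / emeasure \<mu> {a<..<b} \<le> maximal_fun \<mu> g x"
    by (intro order_trans[OF divide_right_mono_ennreal maximal_fun_upper[OF x]])
qed

lemma maximal_fun_cong_AE:
  assumes "AE y in \<mu>. f y = g y"
  shows "maximal_fun \<mu> f x = maximal_fun \<mu> g x"
  by (intro antisym maximal_fun_mono_AE) (use assms in auto)

lemma maximal_fun_suminf_le:
  assumes "sets \<mu> = sets borel" and g: "\<And>k. g k \<in> borel_measurable borel"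
  shows "maximal_fun \<mu> (\<lambda>y. \<Sum>k. c k * g k y) x \<le> (\<Sum>k. c k * maximal_fun \<mu> (g k) x)"
proof (rule maximal_fun_least)
  fix a b assume x: "x \<in> {a<..<b}"
  note [measurable_cong] = assms(1) and [measurable] = g
  have "(\<integral>\<^sup>+y\<in>{a<..<b}. (\<Sum>k. c k * g k y) \<partial>\<mu>) = (\<integral>\<^sup>+y. (\<Sum>k. c k * (g k y * indicator {a<..<b} y)) \<partial>\<mu>)"
    by (subst ennreal_suminf_multc[symmetric]) (simp only: mult.assoc)
  also have "\<dots> = (\<Sum>k. \<integral>\<^sup>+y. c k * (g k y * indicator {a<..<b} y) \<partial>\<mu>)"
    by (rule nn_integral_suminf) measurable
  also have "\<dots> = (\<Sum>k. c k * (\<integral>\<^sup>+y\<in>{a<..<b}. g k y \<partial>\<mu>))"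
    by (intro suminf_cong nn_integral_cmult) measurable
  finally have "(\<integral>\<^sup>+y\<in>{a<..<b}. (\<Sum>k. c k * g k y) \<partial>\<mu>) / emeasure \<mu> {a<..<b} =
      (\<Sum>k. c k * (\<integral>\<^sup>+y\<in>{a<..<b}. g k y \<partial>\<mu>) / emeasure \<mu> {a<..<b})"
    by simp
  also have "\<dots> = (\<Sum>k. c k * ((\<integral>\<^sup>+y\<in>{a<..<b}. g k y \<partial>\<mu>) / emeasure \<mu> {a<..<b}))"
    by (simp only: ennreal_times_divide)
  also have "\<dots> \<le> (\<Sum>k. c k * maximal_fun \<mu> (g k) x)"
    by (intro suminf_le mult_left_mono maximal_fun_upper[OF x]) auto
  finally show "(\<integral>\<^sup>+y\<in>{a<..<b}. (\<Sum>k. c k * g k y) \<partial>\<mu>) / emeasure \<mu> {a<..<b} \<le> \<dots>" .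
qed

text \<open>
  The covering lemma replacing the Vitali lemma: in a subfamily of least cardinality with the same union no
  point lies in three intervals, since the one reaching furthest left and the one reaching furthest right
  would cover the third.
\<close>

lemma finite_interval_subcover:
  fixes J :: "(real \<times> real) set"
  assumes "finite J"
  obtains K where "K \<subseteq> J" "(\<Union>(a, b)\<in>K. {a<..<b}) = (\<Union>(a, b)\<in>J. {a<..<b})"
    "\<And>x. card {(a, b)\<in>K. x \<in> {a<..<b}} \<le> 2"
proof -
  let ?U = "\<lambda>K. \<Union>(a, b)\<in>K. {a<..<b::real}"
  define P where "P K \<longleftrightarrow> K \<subseteq> J \<and> ?U K = ?U J" for K
  have "P J" by (simp add: P_def)
  then obtain K where K: "P K" and min: "\<And>K'. P K' \<Longrightarrow> card K \<le> card K'"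
    using ex_has_least_nat[of P J card] by blast
  have fin: "finite K" using K assms finite_subset by (auto simp: P_def)
  have "card {(a, b)\<in>K. x \<in> {a<..<b}} \<le> 2" for x
  proof (rule ccontr)
    define S where "S = {(a, b)\<in>K. x \<in> {a<..<b}}"
    assume "\<not> card {(a, b)\<in>K. x \<in> {a<..<b}} \<le> 2"
    then have S: "card S > 2" by (simp add: S_def)
    have finS: "finite S" using fin by (auto simp: S_def intro: finite_subset)
    have ne: "S \<noteq> {}" using S by auto
    obtain p where p: "p \<in> S" "\<And>s. s \<in> S \<Longrightarrow> fst p \<le> fst s"
      using arg_min_if_finite[OF finS ne, of fst] by (meson linorder_not_less)
    obtain q where q: "q \<in> S" "\<And>s. s \<in> S \<Longrightarrow> snd s \<le> snd q"
    proof -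
      have "Max (snd ` S) \<in> snd ` S" using finS ne by (intro Max_in) auto
      then obtain q where "q \<in> S" "Max (snd ` S) = snd q" by blast
      moreover have "snd s \<le> Max (snd ` S)" if "s \<in> S" for s using finS that by (intro Max_ge) auto
      ultimately show thesis by (intro that[of q]) auto
    qed
    have "card {p, q} \<le> 2" by (simp add: card_insert_le_m1)
    then have "\<not> S \<subseteq> {p, q}" using S card_mono[of "{p, q}" S] by auto
    then obtain s where s: "s \<in> S" "s \<noteq> p" "s \<noteq> q" by auto
    have "{fst s<..<snd s} \<subseteq> {fst p<..<snd p} \<union> {fst q<..<snd q}"
      using p(1) q(1) p(2)[OF s(1)] q(2)[OF s(1)] by (auto simp: S_def)
    moreover have "p \<in> K - {s}" "q \<in> K - {s}" "s \<in> K"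
      using p(1) q(1) s by (auto simp: S_def)
    ultimately have "?U (K - {s}) = ?U K"
      unfolding case_prod_unfold by blast
    then have "P (K - {s})" using K by (auto simp: P_def)
    from min[OF this] \<open>s \<in> K\<close> fin show False
      by (metis card_Diff1_less linorder_not_less)
  qed
  with K show thesis by (intro that[of K]) (auto simp: P_def)
qed

locale locally_finite_line =
  fixes \<mu> :: "real measure"
  assumes sets_eq [measurable_cong]: "sets \<mu> = sets borel"
    and finite_interval: "emeasure \<mu> {a<..<b} < \<infinity>"
begin

lemma space_eq [simp]: "space \<mu> = UNIV"
  using sets_eq_imp_space_eq[OF sets_eq] by simp

sublocale sigma_finite_measure \<mu>
proof
  have "(\<Union>n::nat. {- real n<..<real n}) = UNIV"
  proof (intro set_eqI iffI UNIV_I)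
    fix x :: real
    obtain n :: nat where "\<bar>x\<bar> < real n" using reals_Archimedean2 by blast
    then show "x \<in> (\<Union>n::nat. {- real n<..<real n})" by (intro UN_I[of n]) auto
  qed
  then show "\<exists>A. countable A \<and> A \<subseteq> sets \<mu> \<and> \<Union>A = space \<mu> \<and> (\<forall>a\<in>A. emeasure \<mu> a \<noteq> \<infinity>)"
    using finite_interval
    by (intro exI[of _ "range (\<lambda>n::nat. {- real n<..<real n})"]) (auto simp: sets_eq less_top[symmetric])
qed

lemma interval_average:
  assumes f: "f \<in> borel_measurable borel"
  shows "emeasure \<mu> {a<..<b} * ((\<integral>\<^sup>+y\<in>{a<..<b}. f y \<partial>\<mu>) / emeasure \<mu> {a<..<b}) =
     (\<integral>\<^sup>+y\<in>{a<..<b}. f y \<partial>\<mu>)"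
proof (cases "emeasure \<mu> {a<..<b} = 0")
  case True
  then have "{a<..<b} \<in> null_sets \<mu>" by (auto simp: sets_eq null_sets_def)
  then have "(\<integral>\<^sup>+y\<in>{a<..<b}. f y \<partial>\<mu>) = 0" by (rule nn_integral_null_set)
  with True show ?thesis by simp
next
  case False
  then show ?thesis using finite_interval[of a b] ennreal_mult_divide_eq[OF False]
    unfolding ennreal_times_divide by (metis mult.commute infinity_ennreal_def less_irrefl)
qed

text \<open>
  On each interval \<open>I\<close> of the family, \<open>c \<mu>(I) < \<integral>\<^sub>I f d\<mu>\<close>.  Multiplication by the average of \<open>\<phi>\<close>
  over \<open>I\<close>, which is at most \<open>M\<^sub>\<mu> \<phi>\<close> everywhere on \<open>I\<close>, turns this into \<open>c \<integral>\<^sub>I \<phi> d\<mu> \<le> \<integral>\<^sub>I f M\<^sub>\<mu> \<phi> d\<mu>\<close>,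
  and the bounded overlap allows summation.
\<close>

lemma weak_type_finite:
  assumes [measurable]: "f \<in> borel_measurable borel" "\<phi> \<in> borel_measurable borel"
    and J: "finite J" "\<And>a b. (a, b) \<in> J \<Longrightarrow> c < (\<integral>\<^sup>+y\<in>{a<..<b}. f y \<partial>\<mu>) / emeasure \<mu> {a<..<b}"
  shows "c * (\<integral>\<^sup>+x. \<phi> x * indicator (\<Union>(a, b)\<in>J. {a<..<b}) x \<partial>\<mu>) \<le> 2 * (\<integral>\<^sup>+x. f x * maximal_fun \<mu> \<phi> x \<partial>\<mu>)"
proof -
  obtain K where K: "K \<subseteq> J" "(\<Union>(a, b)\<in>K. {a<..<b}) = (\<Union>(a, b)\<in>J. {a<..<b})"
    "\<And>x. card {(a, b)\<in>K. x \<in> {a<..<b}} \<le> 2"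
    by (rule finite_interval_subcover[OF J(1)]) (rule that)
  have finK: "finite K" using K(1) J(1) finite_subset by blast
  have one: "c * (\<integral>\<^sup>+x\<in>{a<..<b}. \<phi> x \<partial>\<mu>) \<le> (\<integral>\<^sup>+x\<in>{a<..<b}. f x * maximal_fun \<mu> \<phi> x \<partial>\<mu>)"
    if "(a, b) \<in> J" for a b
  proof -
    let ?m = "emeasure \<mu> {a<..<b}" and ?A = "(\<integral>\<^sup>+x\<in>{a<..<b}. \<phi> x \<partial>\<mu>) / emeasure \<mu> {a<..<b}"
    have "c * (\<integral>\<^sup>+x\<in>{a<..<b}. \<phi> x \<partial>\<mu>) = c * (?m * ?A)"
      by (simp only: interval_average[OF assms(2)])
    also have "\<dots> = (?m * c) * ?A"
      by (simp only: mult.assoc mult.left_commute[of c])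
    also have "\<dots> \<le> (?m * ((\<integral>\<^sup>+y\<in>{a<..<b}. f y \<partial>\<mu>) / ?m)) * ?A"
      by (intro mult_right_mono mult_left_mono less_imp_le[OF J(2)[OF that]]) simp_all
    also have "\<dots> = (\<integral>\<^sup>+y\<in>{a<..<b}. f y \<partial>\<mu>) * ?A"
      by (simp only: interval_average[OF assms(1)])
    also have "\<dots> = (\<integral>\<^sup>+y\<in>{a<..<b}. f y * ?A \<partial>\<mu>)"
      by (subst nn_integral_multc[symmetric]) (measurable, simp only: mult.assoc mult.commute[of ?A])
    also have "\<dots> \<le> (\<integral>\<^sup>+x\<in>{a<..<b}. f x * maximal_fun \<mu> \<phi> x \<partial>\<mu>)"
    proof (rule nn_integral_mono)
      fix x show "f x * ?A * indicator {a<..<b} x \<le> f x * maximal_fun \<mu> \<phi> x * indicator {a<..<b} x"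
        using maximal_fun_upper[of x a b \<mu> \<phi>]
        by (cases "x \<in> {a<..<b}") (simp_all add: mult_left_mono)
    qed
    finally show ?thesis .
  qed
  have "(\<integral>\<^sup>+x. \<phi> x * indicator (\<Union>(a, b)\<in>J. {a<..<b}) x \<partial>\<mu>)
      \<le> (\<integral>\<^sup>+x. (\<Sum>(a, b)\<in>K. \<phi> x * indicator {a<..<b} x) \<partial>\<mu>)"
  proof (rule nn_integral_mono)
    fix x
    show "\<phi> x * indicator (\<Union>(a, b)\<in>J. {a<..<b}) x \<le> (\<Sum>(a, b)\<in>K. \<phi> x * indicator {a<..<b} x)"
    proof (cases "x \<in> (\<Union>(a, b)\<in>J. {a<..<b})")
      case True
      then obtain p where p: "p \<in> K" "x \<in> {fst p<..<snd p}"
        unfolding K(2)[symmetric] by auto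
      have "\<phi> x \<le> (\<Sum>p\<in>K. \<phi> x * indicator {fst p<..<snd p} x)"
        using member_le_sum[of p K "\<lambda>p. \<phi> x * indicator {fst p<..<snd p} x"] p finK by auto
      then show ?thesis using True by (simp add: case_prod_unfold)
    qed simp
  qed
  also have "\<dots> = (\<Sum>(a, b)\<in>K. \<integral>\<^sup>+x\<in>{a<..<b}. \<phi> x \<partial>\<mu>)"
    unfolding case_prod_unfold by (rule nn_integral_sum) simp
  finally have "c * (\<integral>\<^sup>+x. \<phi> x * indicator (\<Union>(a, b)\<in>J. {a<..<b}) x \<partial>\<mu>)
      \<le> c * (\<Sum>(a, b)\<in>K. \<integral>\<^sup>+x\<in>{a<..<b}. \<phi> x \<partial>\<mu>)"
    by (rule mult_left_mono) simp
  also have "\<dots> \<le> (\<Sum>(a, b)\<in>K. \<integral>\<^sup>+x\<in>{a<..<b}. f x * maximal_fun \<mu> \<phi> x \<partial>\<mu>)"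
    unfolding sum_distrib_left using one K(1) by (intro sum_mono) auto
  also have "\<dots> = (\<integral>\<^sup>+x. (\<Sum>(a, b)\<in>K. f x * maximal_fun \<mu> \<phi> x * indicator {a<..<b} x) \<partial>\<mu>)"
    unfolding case_prod_unfold by (rule nn_integral_sum[symmetric]) simp
  also have "\<dots> \<le> (\<integral>\<^sup>+x. 2 * (f x * maximal_fun \<mu> \<phi> x) \<partial>\<mu>)"
  proof (rule nn_integral_mono)
    fix x
    have "(\<Sum>(a, b)\<in>K. indicator {a<..<b} x :: ennreal) = of_nat (card {(a, b)\<in>K. x \<in> {a<..<b}})"
      using finK by (simp add: case_prod_unfold indicator_def sum.If_cases Int_def)
    also have "\<dots> \<le> of_nat 2" using K(3)[of x] by (intro of_nat_mono)
    finally have "(\<Sum>(a, b)\<in>K. indicator {a<..<b} x :: ennreal) \<le> 2" by simp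
    from mult_left_mono[OF this, of "f x * maximal_fun \<mu> \<phi> x"]
    show "(\<Sum>(a, b)\<in>K. f x * maximal_fun \<mu> \<phi> x * indicator {a<..<b} x) \<le> 2 * (f x * maximal_fun \<mu> \<phi> x)"
      by (simp add: sum_distrib_left case_prod_unfold mult.commute)
  qed
  also have "\<dots> = 2 * (\<integral>\<^sup>+x. f x * maximal_fun \<mu> \<phi> x \<partial>\<mu>)"
    by (rule nn_integral_cmult) simp
  finally show ?thesis .
qed

text \<open>
  The superlevel set is a countable union of intervals by the Lindeloef property, hence an increasing union
  of finite ones.
\<close>

lemma weak_type:
  assumes [measurable]: "f \<in> borel_measurable borel" "\<phi> \<in> borel_measurable borel"
  shows "c * (\<integral>\<^sup>+x. \<phi> x * indicator {x. c < maximal_fun \<mu> f x} x \<partial>\<mu>) \<le> 2 * (\<integral>\<^sup>+x. f x * maximal_fun \<mu> \<phi> x \<partial>\<mu>)"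
proof -
  define Ioo :: "real \<times> real \<Rightarrow> real set" where "Ioo p = {fst p<..<snd p}" for p
  define P where "P = {p. c < (\<integral>\<^sup>+y\<in>Ioo p. f y \<partial>\<mu>) / emeasure \<mu> (Ioo p)}"
  have "x \<in> \<Union> (Ioo ` P)" if "c < maximal_fun \<mu> f x" for x
  proof -
    from that obtain a b where "x \<in> {a<..<b}" "c < (\<integral>\<^sup>+y\<in>{a<..<b}. f y \<partial>\<mu>) / emeasure \<mu> {a<..<b}"
      unfolding maximal_fun_less_iff by blast
    then show ?thesis by (intro UN_I[of "(a, b)"]) (simp_all add: P_def Ioo_def)
  qed
  moreover have "c < maximal_fun \<mu> f x" if "p \<in> P" "x \<in> Ioo p" for x p
    using order_less_le_trans[OF _ maximal_fun_upper[of x "fst p" "snd p" \<mu> f]] that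
    by (simp add: P_def Ioo_def)
  ultimately have E: "{x. c < maximal_fun \<mu> f x} = \<Union> (Ioo ` P)"
    by (intro set_eqI iffI) (auto simp only: mem_Collect_eq UN_iff)
  have op: "\<And>S. S \<in> Ioo ` P \<Longrightarrow> open S"
    by (auto simp: Ioo_def)
  obtain F where F: "F \<subseteq> Ioo ` P" "countable F" "\<Union>F = \<Union> (Ioo ` P)"
    by (rule Lindelof[of "Ioo ` P"]) (rule op, assumption, rule that)
  then have "\<exists>Q. countable Q \<and> Q \<subseteq> P \<and> F = Ioo ` Q"
    by (intro iffD1[OF countable_subset_image] conjI)
  then obtain Q where Q: "countable Q" "Q \<subseteq> P" "F = Ioo ` Q"
    by blast
  have EQ: "{x. c < maximal_fun \<mu> f x} = \<Union> (Ioo ` Q)"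
    unfolding E F(3)[symmetric] Q(3) ..
  show ?thesis
  proof (cases "Q = {}")
    case True
    with EQ show ?thesis by simp
  next
    case False
    define e where "e = from_nat_into Q"
    have e: "range e = Q" using Q(1) False by (simp add: e_def range_from_nat_into)
    have eP: "e k \<in> P" for k using Q(2) e by blast
    define A where "A N = (\<Union>k\<le>N. Ioo (e k))" for N
    have A_eq: "A N = (\<Union>(a, b)\<in>e ` {..N}. {a<..<b})" for N
      by (simp add: A_def Ioo_def case_prod_unfold)
    have "incseq A"
      unfolding A_def incseq_def by (intro allI impI UN_mono) auto
    have A_meas: "A N \<in> sets borel" for N
      unfolding A_def Ioo_def by (intro sets.finite_UN) auto
    have "(\<Union>N. A N) = (\<Union>k. Ioo (e k))"
      unfolding A_def by blast
    also have "\<dots> = {x. c < maximal_fun \<mu> f x}"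
      unfolding EQ e[symmetric] by simp
    finally have "(\<Union>N. A N) = {x. c < maximal_fun \<mu> f x}" .
    then have "(SUP N. emeasure (density \<mu> \<phi>) (A N)) = emeasure (density \<mu> \<phi>) {x. c < maximal_fun \<mu> f x}"
      using SUP_emeasure_incseq[of A "density \<mu> \<phi>"] A_meas \<open>incseq A\<close> by (auto simp: sets_eq)
    moreover have "emeasure (density \<mu> \<phi>) (A N) = (\<integral>\<^sup>+x. \<phi> x * indicator (A N) x \<partial>\<mu>)" for N
      by (rule emeasure_density) (auto simp: A_meas sets_eq)
    moreover have "emeasure (density \<mu> \<phi>) {x. c < maximal_fun \<mu> f x} = (\<integral>\<^sup>+x. \<phi> x * indicator {x. c < maximal_fun \<mu> f x} x \<partial>\<mu>)"
      by (rule emeasure_density) auto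
    ultimately have "c * (\<integral>\<^sup>+x. \<phi> x * indicator {x. c < maximal_fun \<mu> f x} x \<partial>\<mu>) =
        (SUP N. c * (\<integral>\<^sup>+x. \<phi> x * indicator (A N) x \<partial>\<mu>))"
      by (subst SUP_mult_left_ennreal[symmetric]) simp
    also have "\<dots> \<le> 2 * (\<integral>\<^sup>+x. f x * maximal_fun \<mu> \<phi> x \<partial>\<mu>)"
    proof (intro SUP_least)
      fix N
      have large: "c < (\<integral>\<^sup>+y\<in>{a<..<b}. f y \<partial>\<mu>) / emeasure \<mu> {a<..<b}" if "(a, b) \<in> e ` {..N}" for a b
      proof -
        from that obtain k where "(a, b) = e k" by blast
        with eP[of k] have "(a, b) \<in> P" by simp
        then show ?thesis by (simp add: P_def Ioo_def)
      qed
      show "c * (\<integral>\<^sup>+x. \<phi> x * indicator (A N) x \<partial>\<mu>) \<le> 2 * (\<integral>\<^sup>+x. f x * maximal_fun \<mu> \<phi> x \<partial>\<mu>)"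
        unfolding A_eq by (rule weak_type_finite[OF assms _ large]) simp
    qed
    finally show ?thesis .
  qed
qed

end

section \<open>The weighted Fefferman--Stein inequality\<close>

context locally_finite_line
begin

lemma maximal_fun_bounded_part:
  assumes [measurable]: "f \<in> borel_measurable borel"
  shows "maximal_fun \<mu> f x \<le> maximal_fun \<mu> (\<lambda>y. f y * indicator {y. c < f y} y) x + c"
proof (rule maximal_fun_least)
  fix a b assume x: "x \<in> {a<..<b}"
  let ?g = "\<lambda>y. f y * indicator {y. c < f y} y"
  have "(\<integral>\<^sup>+y\<in>{a<..<b}. f y \<partial>\<mu>) \<le> (\<integral>\<^sup>+y. ?g y * indicator {a<..<b} y + c * indicator {a<..<b} y \<partial>\<mu>)"
    by (intro nn_integral_mono) (auto simp: indicator_def)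
  also have "\<dots> = (\<integral>\<^sup>+y\<in>{a<..<b}. ?g y \<partial>\<mu>) + c * emeasure \<mu> {a<..<b}"
    by (subst nn_integral_add) (auto simp: nn_integral_cmult_indicator sets_eq)
  finally have "(\<integral>\<^sup>+y\<in>{a<..<b}. f y \<partial>\<mu>) / emeasure \<mu> {a<..<b} \<le>
      (\<integral>\<^sup>+y\<in>{a<..<b}. ?g y \<partial>\<mu>) / emeasure \<mu> {a<..<b} + c * emeasure \<mu> {a<..<b} / emeasure \<mu> {a<..<b}"
    unfolding add_divide_distrib_ennreal[symmetric] by (rule divide_right_mono_ennreal)
  also have "\<dots> \<le> maximal_fun \<mu> ?g x + c"
  proof (rule add_mono[OF maximal_fun_upper[OF x]])
    show "c * emeasure \<mu> {a<..<b} / emeasure \<mu> {a<..<b} \<le> c"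
      using finite_interval[of a b]
      by (cases "emeasure \<mu> {a<..<b} = 0") (auto simp: mult_divide_eq_ennreal)
  qed
  finally show "(\<integral>\<^sup>+y\<in>{a<..<b}. f y \<partial>\<mu>) / emeasure \<mu> {a<..<b} \<le> \<dots>" .
qed

text \<open>
  The Marcinkiewicz argument between the weak type bound and the trivial bound on \<open>L\<^sup>\<infinity>\<close>: at height
  \<open>l\<close> only the part of \<open>f\<close> above \<open>l / 2\<close> matters, and the weak type estimate of that part is integrated
  against \<open>r l^(r-1) dl\<close>.
\<close>

theorem Fefferman_Stein_weighted:
  assumes r: "1 < r" and [measurable]: "f \<in> borel_measurable borel" "\<phi> \<in> borel_measurable borel"
  shows "(\<integral>\<^sup>+x. enn_powr (maximal_fun \<mu> f x) r * \<phi> x \<partial>\<mu>)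
     \<le> ennreal (4 * r / (r - 1) * 2 powr (r - 1)) * (\<integral>\<^sup>+x. enn_powr (f x) r * maximal_fun \<mu> \<phi> x \<partial>\<mu>)"
proof -
  interpret pair_sigma_finite \<mu> lborel
    by (intro pair_sigma_finite.intro sigma_finite_measure_axioms lborel.sigma_finite_measure_axioms)
  let ?S = "\<lambda>u. {l::real. 0 < l \<and> ennreal l < u}"
  let ?I = "\<lambda>l. \<integral>\<^sup>+x. indicator (?S (maximal_fun \<mu> f x)) l * \<phi> x \<partial>\<mu>"
  let ?J = "\<lambda>l. \<integral>\<^sup>+x. indicator (?S (2 * f x)) l * (f x * maximal_fun \<mu> \<phi> x) \<partial>\<mu>"
  have level: "ennreal (r * l powr (r - 1)) * ?I l
      \<le> ennreal (4 * r / (r - 1)) * (ennreal ((r - 1) * l powr (r - 1 - 1)) *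
          ?J l)" for l
  proof (cases "0 < l")
    case False
    then show ?thesis by (simp add: indicator_def)
  next
    case l: True
    let ?g = "\<lambda>y. f y * indicator {y. ennreal (l / 2) < f y} y"
    have half: "ennreal l = ennreal (l / 2) + ennreal (l / 2)"
      using l by (simp flip: ennreal_plus)
    \<comment> \<open>Splitting at half the height: the bounded part contributes at most \<open>l / 2\<close>.\<close>
    have sub: "ennreal (l / 2) < maximal_fun \<mu> ?g x" if "ennreal l < maximal_fun \<mu> f x" for x
    proof (rule ccontr)
      assume "\<not> ennreal (l / 2) < maximal_fun \<mu> ?g x"
      then have "maximal_fun \<mu> ?g x + ennreal (l / 2) \<le> ennreal l"
        unfolding half by (intro add_right_mono) simp
      with that maximal_fun_bounded_part[of f x "ennreal (l / 2)"] show False by simp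
    qed
    have two: "2 * f x > ennreal l" if "ennreal (l / 2) < f x" for x
    proof -
      have "ennreal l = 2 * ennreal (l / 2)" using half by (simp add: mult_2)
      also have "\<dots> < 2 * f x" using that by (intro ennreal_mult_strict_left_mono) auto
      finally show ?thesis .
    qed
    have "ennreal (l / 2) * ?I l
        \<le> ennreal (l / 2) * (\<integral>\<^sup>+x. \<phi> x * indicator {x. ennreal (l / 2) < maximal_fun \<mu> ?g x} x \<partial>\<mu>)"
    proof (intro mult_left_mono nn_integral_mono)
      fix x show "indicator (?S (maximal_fun \<mu> f x)) l * \<phi> x \<le> \<phi> x * indicator {x. ennreal (l / 2) < maximal_fun \<mu> ?g x} x"
        using sub[of x] l by (cases "ennreal l < maximal_fun \<mu> f x") simp_all
    qed simp
    also have "\<dots> \<le> 2 * (\<integral>\<^sup>+x. ?g x * maximal_fun \<mu> \<phi> x \<partial>\<mu>)"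
      by (rule weak_type) auto
    also have "\<dots> \<le> 2 * ?J l"
    proof (intro mult_left_mono nn_integral_mono)
      fix x show "?g x * maximal_fun \<mu> \<phi> x \<le> indicator (?S (2 * f x)) l * (f x * maximal_fun \<mu> \<phi> x)"
        using two[of x] l by (cases "ennreal (l / 2) < f x") simp_all
    qed simp
    finally have w: "ennreal (l / 2) * ?I l
        \<le> 2 * ?J l" .
    have eq: "r * l powr (r - 1) = (2 * r * l powr (r - 1 - 1)) * (l / 2)"
      using l by (simp add: powr_diff power2_eq_square)
    have eq': "ennreal (r * l powr (r - 1)) = ennreal (2 * r * l powr (r - 1 - 1)) * ennreal (l / 2)"
      unfolding eq by (rule ennreal_mult) (use l r in simp_all)
    have "ennreal (r * l powr (r - 1)) * ?I l
        \<le> ennreal (2 * r * l powr (r - 1 - 1)) * (2 * ?J l)"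
      unfolding eq' mult.assoc[of "ennreal (2 * r * l powr (r - 1 - 1))"] by (rule mult_left_mono[OF w]) simp
    also have "\<dots> = (ennreal (2 * r * l powr (r - 1 - 1)) * ennreal 2) * ?J l"
      by (simp add: mult.assoc)
    also have "ennreal (2 * r * l powr (r - 1 - 1)) * ennreal 2 = ennreal (4 * r / (r - 1)) * ennreal ((r - 1) * l powr (r - 1 - 1))"
      using r by (subst ennreal_mult[symmetric], simp, simp, subst ennreal_mult[symmetric], simp, simp, simp)
    finally show ?thesis by (simp add: mult.assoc)
  qed
  have "(\<integral>\<^sup>+x. enn_powr (maximal_fun \<mu> f x) r * \<phi> x \<partial>\<mu>)
      = (\<integral>\<^sup>+x. (\<integral>\<^sup>+l. ennreal (r * l powr (r - 1)) * (indicator (?S (maximal_fun \<mu> f x)) l * \<phi> x) \<partial>lborel) \<partial>\<mu>)"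
    using r by (subst enn_powr_layer_cake) (auto simp: nn_integral_multc[symmetric] mult.assoc)
  also have "\<dots> = (\<integral>\<^sup>+l. (\<integral>\<^sup>+x. ennreal (r * l powr (r - 1)) * (indicator (?S (maximal_fun \<mu> f x)) l * \<phi> x) \<partial>\<mu>) \<partial>lborel)"
    by (rule Fubini'[symmetric]) measurable
  also have "\<dots> = (\<integral>\<^sup>+l. ennreal (r * l powr (r - 1)) * ?I l \<partial>lborel)"
    by (intro nn_integral_cong nn_integral_cmult) measurable
  also have "\<dots> \<le> (\<integral>\<^sup>+l. ennreal (4 * r / (r - 1)) * (ennreal ((r - 1) * l powr (r - 1 - 1)) *
          ?J l) \<partial>lborel)"
    by (intro nn_integral_mono level)
  also have "\<dots> = ennreal (4 * r / (r - 1)) * (\<integral>\<^sup>+l. (\<integral>\<^sup>+x. ennreal ((r - 1) * l powr (r - 1 - 1)) *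
          (indicator (?S (2 * f x)) l * (f x * maximal_fun \<mu> \<phi> x)) \<partial>\<mu>) \<partial>lborel)"
    by (subst nn_integral_cmult) (measurable, subst nn_integral_cmult, measurable)
  also have "(\<integral>\<^sup>+l. (\<integral>\<^sup>+x. ennreal ((r - 1) * l powr (r - 1 - 1)) *
          (indicator (?S (2 * f x)) l * (f x * maximal_fun \<mu> \<phi> x)) \<partial>\<mu>) \<partial>lborel)
      = (\<integral>\<^sup>+x. (\<integral>\<^sup>+l. ennreal ((r - 1) * l powr (r - 1 - 1)) *
          (indicator (?S (2 * f x)) l * (f x * maximal_fun \<mu> \<phi> x)) \<partial>lborel) \<partial>\<mu>)"
    by (rule Fubini') measurable
  also have "\<dots> = (\<integral>\<^sup>+x. enn_powr (2 * f x) (r - 1) * (f x * maximal_fun \<mu> \<phi> x) \<partial>\<mu>)"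
    using r by (subst enn_powr_layer_cake) (auto simp: nn_integral_multc[symmetric] mult.assoc)
  also have "\<dots> = (\<integral>\<^sup>+x. ennreal (2 powr (r - 1)) * (enn_powr (f x) r * maximal_fun \<mu> \<phi> x) \<partial>\<mu>)"
  proof (rule nn_integral_cong)
    fix x
    have "enn_powr (f x) (r - 1) * f x = enn_powr (f x) r"
      using enn_powr_add[of "f x" "r - 1" 1] by simp
    moreover have "enn_powr 2 (r - 1) = ennreal (2 powr (r - 1))"
      using enn_powr_ennreal_nonneg[of 2 "r - 1"] by simp
    ultimately show "enn_powr (2 * f x) (r - 1) * (f x * maximal_fun \<mu> \<phi> x) =
        ennreal (2 powr (r - 1)) * (enn_powr (f x) r * maximal_fun \<mu> \<phi> x)"
      using r by (simp add: enn_powr_mult mult.assoc[symmetric])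
         (simp add: mult.assoc)
  qed
  also have "\<dots> = ennreal (2 powr (r - 1)) * (\<integral>\<^sup>+x. enn_powr (f x) r * maximal_fun \<mu> \<phi> x \<partial>\<mu>)"
    by (rule nn_integral_cmult) measurable
  also have "ennreal (4 * r / (r - 1)) * (ennreal (2 powr (r - 1)) * (\<integral>\<^sup>+x. enn_powr (f x) r * maximal_fun \<mu> \<phi> x \<partial>\<mu>))
      = ennreal (4 * r / (r - 1) * 2 powr (r - 1)) * (\<integral>\<^sup>+x. enn_powr (f x) r * maximal_fun \<mu> \<phi> x \<partial>\<mu>)"
    using r by (subst ennreal_mult) (simp_all add: mult.assoc)
  finally show ?thesis .
qed

end

section \<open>Vector-valued inequalities with exponent at least r\<close>

lemma enn_powr_cmult:
  "0 < s \<Longrightarrow> 0 \<le> K \<Longrightarrow> enn_powr (ennreal K * u) s = ennreal (K powr s) * enn_powr u s"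
  by (simp add: enn_powr_mult enn_powr_ennreal_nonneg)

lemma enn_powr_cmult':
  "0 < s \<Longrightarrow> 0 \<le> K \<Longrightarrow> enn_powr (u * ennreal K) s = enn_powr u s * ennreal (K powr s)"
  by (simp add: enn_powr_mult enn_powr_ennreal_nonneg)

definition FS_const :: "real \<Rightarrow> real" where
  "FS_const r = 4 * r / (r - 1) * 2 powr (r - 1)"

lemma FS_const_pos: "1 < r \<Longrightarrow> 0 < FS_const r"
  by (simp add: FS_const_def)

context locally_finite_line
begin

lemma maximal_fun_one_le: "maximal_fun \<mu> (\<lambda>_. 1) x \<le> 1"
proof (rule maximal_fun_least)
  fix a b
  have "(\<integral>\<^sup>+y\<in>{a<..<b}. 1 \<partial>\<mu>) = emeasure \<mu> {a<..<b}"
    by (simp add: sets_eq)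
  then show "(\<integral>\<^sup>+y\<in>{a<..<b}. 1 \<partial>\<mu>) / emeasure \<mu> {a<..<b} \<le> 1"
    using finite_interval[of a b] by (cases "emeasure \<mu> {a<..<b} = 0") simp_all
qed

lemma maximal_fun_strong:
  assumes r: "1 < r" and [measurable]: "f \<in> borel_measurable borel"
  shows "(\<integral>\<^sup>+x. enn_powr (maximal_fun \<mu> f x) r \<partial>\<mu>) \<le> ennreal (FS_const r) * (\<integral>\<^sup>+x. enn_powr (f x) r \<partial>\<mu>)"
proof -
  have "(\<integral>\<^sup>+x. enn_powr (maximal_fun \<mu> f x) r * 1 \<partial>\<mu>)
     \<le> ennreal (FS_const r) * (\<integral>\<^sup>+x. enn_powr (f x) r * maximal_fun \<mu> (\<lambda>_. 1) x \<partial>\<mu>)"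
    unfolding FS_const_def by (rule Fefferman_Stein_weighted[OF r]) measurable
  also have "\<dots> \<le> ennreal (FS_const r) * (\<integral>\<^sup>+x. enn_powr (f x) r * 1 \<partial>\<mu>)"
    by (intro mult_left_mono nn_integral_mono maximal_fun_one_le) simp_all
  finally show ?thesis by simp
qed

lemma vector_valued_Fefferman_Stein:
  assumes r: "1 < r" and [measurable]: "\<And>k. f k \<in> borel_measurable borel" "\<phi> \<in> borel_measurable borel"
  shows "(\<integral>\<^sup>+x. (\<Sum>k. enn_powr (maximal_fun \<mu> (f k) x) r) * \<phi> x \<partial>\<mu>)
     \<le> ennreal (FS_const r) * (\<integral>\<^sup>+x. (\<Sum>k. enn_powr (f k x) r) * maximal_fun \<mu> \<phi> x \<partial>\<mu>)"
proof -
  have "(\<integral>\<^sup>+x. (\<Sum>k. enn_powr (maximal_fun \<mu> (f k) x) r) * \<phi> x \<partial>\<mu>)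
      = (\<Sum>k. \<integral>\<^sup>+x. enn_powr (maximal_fun \<mu> (f k) x) r * \<phi> x \<partial>\<mu>)"
    by (simp only: ennreal_suminf_multc[symmetric]) (rule nn_integral_suminf, measurable)
  also have "\<dots> \<le> (\<Sum>k. ennreal (FS_const r) * (\<integral>\<^sup>+x. enn_powr (f k x) r * maximal_fun \<mu> \<phi> x \<partial>\<mu>))"
    unfolding FS_const_def by (intro suminf_le Fefferman_Stein_weighted[OF r] assms summableI)
  also have "\<dots> = ennreal (FS_const r) * (\<Sum>k. \<integral>\<^sup>+x. enn_powr (f k x) r * maximal_fun \<mu> \<phi> x \<partial>\<mu>)"
    by (rule ennreal_suminf_cmult)
  also have "(\<Sum>k. \<integral>\<^sup>+x. enn_powr (f k x) r * maximal_fun \<mu> \<phi> x \<partial>\<mu>)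
      = (\<integral>\<^sup>+x. (\<Sum>k. enn_powr (f k x) r) * maximal_fun \<mu> \<phi> x \<partial>\<mu>)"
    by (simp only: ennreal_suminf_multc[symmetric]) (rule nn_integral_suminf[symmetric], measurable)
  finally show ?thesis .
qed

lemma vector_valued_diagonal:
  assumes r: "1 < r" and [measurable]: "\<And>k. f k \<in> borel_measurable borel"
  shows "(\<integral>\<^sup>+x. (\<Sum>k. enn_powr (maximal_fun \<mu> (f k) x) r) \<partial>\<mu>)
     \<le> ennreal (FS_const r) * (\<integral>\<^sup>+x. (\<Sum>k. enn_powr (f k x) r) \<partial>\<mu>)"
proof -
  have "(\<integral>\<^sup>+x. (\<Sum>k. enn_powr (maximal_fun \<mu> (f k) x) r) * 1 \<partial>\<mu>)
     \<le> ennreal (FS_const r) * (\<integral>\<^sup>+x. (\<Sum>k. enn_powr (f k x) r) * maximal_fun \<mu> (\<lambda>_. 1) x \<partial>\<mu>)"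
    by (rule vector_valued_Fefferman_Stein[OF r]) measurable
  also have "\<dots> \<le> ennreal (FS_const r) * (\<integral>\<^sup>+x. (\<Sum>k. enn_powr (f k x) r) * 1 \<partial>\<mu>)"
    by (intro mult_left_mono nn_integral_mono maximal_fun_one_le) simp_all
  finally show ?thesis by simp
qed

end

lemma ennreal_absorb_half:
  fixes J c :: ennreal
  assumes "J < \<infinity>" "J \<le> c + ennreal (1 / 2) * J"
  shows "J \<le> 2 * c"
proof (cases J; cases c)
  fix j d assume *: "J = ennreal j" "0 \<le> j" "c = ennreal d" "0 \<le> d"
  have "ennreal (d + 1 / 2 * j) = ennreal d + ennreal (1 / 2 * j)"
    using * by (intro ennreal_plus) auto
  also have "ennreal (1 / 2 * j) = ennreal (1 / 2) * ennreal j"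
    using * by (intro ennreal_mult) auto
  finally have "ennreal j \<le> ennreal (d + 1 / 2 * j)"
    using assms(2) * by (simp only:)
  then have "j \<le> d + 1 / 2 * j" using * by (subst (asm) ennreal_le_iff) auto
  then have "ennreal j \<le> ennreal (2 * d)" by (intro ennreal_leI) simp
  then show ?thesis using * by (simp add: ennreal_mult)
qed (use assms in \<open>auto simp: ennreal_mult_eq_top_iff\<close>)

text \<open>
  Here \<open>q = p / r > 1\<close> and \<open>S = \<Sum> (M\<^sub>\<mu> f\<^sub>k)\<^sup>r\<close>.  Testing against \<open>\<phi> = S^(q-1)\<close> gives
  \<open>\<integral> S\<^sup>q \<le> C \<integral> (\<Sum> f\<^sub>k\<^sup>r) M\<^sub>\<mu> \<phi>\<close>.  By Young's inequality, weighted with a parameter \<open>L\<close>, and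
  the bound of \<open>M\<^sub>\<mu>\<close> on the dual space, the right-hand side is at most \<open>C' \<integral> (\<Sum> f\<^sub>k\<^sup>r)\<^sup>q\<close> plus half of
  the left-hand side; \<open>L\<close> is chosen to make that fraction a half.  Subtraction needs a finite
  left-hand side, hence the truncations \<open>T m\<close> of \<open>S\<close>.
\<close>

lemma (in locally_finite_line) vector_valued_large_exponent:
  assumes r: "1 < r" "1 < q" and [measurable]: "\<And>k. f k \<in> borel_measurable borel"
    and L: "0 < L" "L powr (q / (q - 1)) = 2 * FS_const r * FS_const (q / (q - 1))"
  shows "(\<integral>\<^sup>+x. enn_powr (\<Sum>k. enn_powr (maximal_fun \<mu> (f k) x) r) q \<partial>\<mu>)
     \<le> ennreal (2 * FS_const r * L powr q) * (\<integral>\<^sup>+x. enn_powr (\<Sum>k. enn_powr (f k x) r) q \<partial>\<mu>)"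
proof -
  define q' where "q' = q / (q - 1)"
  have q': "1 < q'" using r(2) by (simp add: q'_def)
  define S where "S x = (\<Sum>k. enn_powr (maximal_fun \<mu> (f k) x) r)" for x
  define s where "s x = (\<Sum>k. enn_powr (f k x) r)" for x
  have [measurable]: "S \<in> borel_measurable borel" "s \<in> borel_measurable borel"
    unfolding S_def s_def by measurable
  note pos = FS_const_pos[OF r(1)] FS_const_pos[OF q']
  define T where "T m x = min (S x) (of_nat m) * indicator {- real m<..<real m} x" for m :: nat and x
  have [measurable]: "T m \<in> borel_measurable borel" for m
    unfolding T_def by measurable
  let ?N = "\<lambda>m. \<integral>\<^sup>+x. enn_powr (T m x) q \<partial>\<mu>" and ?A = "\<integral>\<^sup>+x. enn_powr (s x) q \<partial>\<mu>"
  have T_le: "T m x \<le> S x" for m x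
    by (simp add: T_def indicator_def)
  have bound: "?N m \<le> 2 * (ennreal (FS_const r * L powr q) * ?A)" for m
  proof (rule ennreal_absorb_half)
    let ?\<phi> = "\<lambda>x. enn_powr (T m x) (q - 1)"
    have "?N m \<le> (\<integral>\<^sup>+x. ennreal (real m powr q) * indicator {- real m<..<real m} x \<partial>\<mu>)"
    proof (rule nn_integral_mono)
      fix x
      have "enn_powr (min (S x) (of_nat m)) q \<le> enn_powr (of_nat m) q"
        using r(2) by (intro enn_powr_mono) auto
      also have "enn_powr (of_nat m) q = ennreal (real m powr q)"
        by (simp add: ennreal_of_nat_eq_real_of_nat enn_powr_ennreal_nonneg)
      finally show "enn_powr (T m x) q \<le> ennreal (real m powr q) * indicator {- real m<..<real m} x"
        by (cases "x \<in> {- real m<..<real m}") (simp_all add: T_def)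
    qed
    also have "\<dots> = ennreal (real m powr q) * emeasure \<mu> {- real m<..<real m}"
      by (rule nn_integral_cmult_indicator) (simp add: sets_eq)
    also have "\<dots> < \<infinity>"
      using finite_interval[of "- real m" "real m"] by (simp add: ennreal_mult_less_top)
    finally show "?N m < \<infinity>" .
    have "?N m \<le> (\<integral>\<^sup>+x. S x * ?\<phi> x \<partial>\<mu>)"
    proof (rule nn_integral_mono)
      fix x
      have "enn_powr (T m x) q = T m x * ?\<phi> x"
        using enn_powr_add[of "T m x" 1 "q - 1"] by simp
      also have "\<dots> \<le> S x * ?\<phi> x" by (intro mult_right_mono T_le) simp
      finally show "enn_powr (T m x) q \<le> S x * ?\<phi> x" .
    qed
    also have "\<dots> \<le> ennreal (FS_const r) * (\<integral>\<^sup>+x. s x * maximal_fun \<mu> ?\<phi> x \<partial>\<mu>)"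
      unfolding S_def s_def by (rule vector_valued_Fefferman_Stein[OF r(1)]) measurable
    also have "\<dots> \<le> ennreal (FS_const r) * (\<integral>\<^sup>+x. ennreal (L powr q) * enn_powr (s x) q +
         ennreal ((1 / L) powr q') * enn_powr (maximal_fun \<mu> ?\<phi> x) q' \<partial>\<mu>)"
    proof (intro mult_left_mono nn_integral_mono)
      fix x
      have one: "ennreal L * ennreal (1 / L) = 1"
        using L(1) by (simp flip: ennreal_mult)
      have "s x * maximal_fun \<mu> ?\<phi> x = (ennreal L * ennreal (1 / L)) * (s x * maximal_fun \<mu> ?\<phi> x)"
        by (simp only: one mult_1)
      also have "\<dots> = (ennreal L * s x) * (ennreal (1 / L) * maximal_fun \<mu> ?\<phi> x)"
        by (simp only: mult_ac)
      also have "\<dots> \<le> enn_powr (ennreal L * s x) q + enn_powr (ennreal (1 / L) * maximal_fun \<mu> ?\<phi> x) q'"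
        unfolding q'_def by (rule enn_powr_Young[OF r(2)])
      finally show "s x * maximal_fun \<mu> ?\<phi> x \<le> ennreal (L powr q) * enn_powr (s x) q +
         ennreal ((1 / L) powr q') * enn_powr (maximal_fun \<mu> ?\<phi> x) q'"
        using r(2) q' L(1) by (simp add: enn_powr_cmult)
    qed simp
    also have "\<dots> = ennreal (FS_const r) * (ennreal (L powr q) * ?A +
         ennreal ((1 / L) powr q') * (\<integral>\<^sup>+x. enn_powr (maximal_fun \<mu> ?\<phi> x) q' \<partial>\<mu>))"
      by (simp add: nn_integral_add nn_integral_cmult)
    also have "\<dots> \<le> ennreal (FS_const r) * (ennreal (L powr q) * ?A +
         ennreal ((1 / L) powr q') * (ennreal (FS_const q') * (\<integral>\<^sup>+x. enn_powr (?\<phi> x) q' \<partial>\<mu>)))"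
      by (intro mult_left_mono add_left_mono maximal_fun_strong[OF q']) simp_all
    also have "\<dots> = ennreal (FS_const r * L powr q) * ?A +
         ennreal (FS_const r * ((1 / L) powr q') * FS_const q') * (\<integral>\<^sup>+x. enn_powr (?\<phi> x) q' \<partial>\<mu>)"
      using pos by (simp add: distrib_left ennreal_mult mult.assoc)
    also have "FS_const r * ((1 / L) powr q') * FS_const q' = 1 / 2"
      using pos L r(2) by (simp add: powr_divide q'_def)
    also have "(\<integral>\<^sup>+x. enn_powr (?\<phi> x) q' \<partial>\<mu>) = ?N m"
      using r(2) q' by (simp add: enn_powr_powr q'_def)
    finally show "?N m \<le>
       ennreal (FS_const r * L powr q) * ?A + ennreal (1 / 2) * ?N m" .
  qed
  have inc: "incseq (\<lambda>m::nat. {- real m<..<real m})"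
    by (auto simp: incseq_def)
  have T_sup: "(SUP m. T m x) = S x" for x
    unfolding T_def
  proof (rule SUP_truncations[OF inc])
    obtain m :: nat where "\<bar>x\<bar> < real m" using reals_Archimedean2 by blast
    then show "x \<in> (\<Union>m::nat. {- real m<..<real m})" by (intro UN_I[of m]) auto
  qed
  have "incseq (\<lambda>m x. enn_powr (T m x) q)"
    using incseq_truncations[OF inc] r(2) unfolding T_def
    by (auto simp: incseq_def le_fun_def intro!: enn_powr_mono)
  then have "(\<integral>\<^sup>+x. (SUP m. enn_powr (T m x) q) \<partial>\<mu>) = (SUP m. ?N m)"
    by (rule nn_integral_monotone_convergence_SUP) measurable
  also have "\<dots> \<le> 2 * (ennreal (FS_const r * L powr q) * ?A)"
    by (intro SUP_least bound)
  also have "\<dots> = ennreal (2 * FS_const r * L powr q) * ?A"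
    using pos by (simp add: ennreal_mult mult.assoc)
  also have "(\<integral>\<^sup>+x. (SUP m. enn_powr (T m x) q) \<partial>\<mu>) = (\<integral>\<^sup>+x. enn_powr (S x) q \<partial>\<mu>)"
    using r(2) by (simp add: enn_powr_SUP[symmetric] T_sup)
  finally show ?thesis unfolding S_def s_def .
qed
section \<open>Rubio de Francia majorants and exponents below r\<close>

text \<open>
  If \<open>T\<close> is countably sublinear, the series \<open>w = \<Sum> c\<^sup>k T\<^sup>k g\<close> is shifted by \<open>T\<close>, so that
  \<open>T w \<le> w / c\<close>.  When \<open>c\<close> times the norm of \<open>T\<close> is less than \<open>1\<close>, the series also has finite norm.
\<close>

lemma Rubio_de_Francia_majorant:
  fixes T :: "('a \<Rightarrow> ennreal) \<Rightarrow> 'a \<Rightarrow> ennreal"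
  assumes T_meas: "\<And>g. g \<in> borel_measurable M \<Longrightarrow> T g \<in> borel_measurable M"
    and T_sub: "\<And>c g x. (\<And>k::nat. g k \<in> borel_measurable M) \<Longrightarrow>
        T (\<lambda>y. \<Sum>k. c k * g k y) x \<le> (\<Sum>k. c k * T (g k) x)"
    and c: "0 < c" and g: "g \<in> borel_measurable M"
  defines "w \<equiv> \<lambda>x. \<Sum>k. ennreal (c ^ k) * (T ^^ k) g x"
  shows "w \<in> borel_measurable M" "g x \<le> w x" "T w x \<le> ennreal (1 / c) * w x"
proof -
  have iter [measurable]: "(T ^^ k) g \<in> borel_measurable M" for k
    by (induction k) (use g T_meas in auto)
  show "w \<in> borel_measurable M"
    unfolding w_def by measurable
  show "g x \<le> w x"
    using sum_le_suminf[of "\<lambda>k. ennreal (c ^ k) * (T ^^ k) g x" "{0}"] by (simp add: w_def)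
  have "T w x \<le> (\<Sum>k. ennreal (c ^ k) * T ((T ^^ k) g) x)"
    unfolding w_def by (rule T_sub) (rule iter)
  also have "\<dots> = (\<Sum>k. ennreal (1 / c) * (ennreal (c ^ Suc k) * (T ^^ Suc k) g x))"
  proof (rule suminf_cong)
    fix k
    have "c ^ k = 1 / c * c ^ Suc k" using c by simp
    then have "ennreal (c ^ k) = ennreal (1 / c) * ennreal (c ^ Suc k)"
      using c by (metis ennreal_mult less_imp_le zero_le_power zero_le_divide_1_iff)
    then show "ennreal (c ^ k) * T ((T ^^ k) g) x = ennreal (1 / c) * (ennreal (c ^ Suc k) * (T ^^ Suc k) g x)"
      by (simp add: mult.assoc)
  qed
  also have "\<dots> = ennreal (1 / c) * (\<Sum>k. ennreal (c ^ Suc k) * (T ^^ Suc k) g x)"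
    by (rule ennreal_suminf_cmult)
  also have "\<dots> \<le> ennreal (1 / c) * w x"
  proof (intro mult_left_mono)
    have "(\<lambda>k. ennreal (c ^ k) * (T ^^ k) g x) sums
        ((\<Sum>k. ennreal (c ^ Suc k) * (T ^^ Suc k) g x) + ennreal (c ^ 0) * (T ^^ 0) g x)"
      by (rule sums_Suc[OF summable_sums[OF summableI]])
    then have "w x = (\<Sum>k. ennreal (c ^ Suc k) * (T ^^ Suc k) g x) + ennreal (c ^ 0) * (T ^^ 0) g x"
      unfolding w_def by (rule sums_unique[symmetric])
    then show "(\<Sum>k. ennreal (c ^ Suc k) * (T ^^ Suc k) g x) \<le> w x"
      by simp
  qed simp
  finally show "T w x \<le> ennreal (1 / c) * w x" .
qed

lemma suminf_half_powers: "(\<Sum>k. ennreal ((1 / 2) ^ k) * c) = 2 * c"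
proof -
  have "(\<Sum>k. ennreal ((1 / 2) ^ k)) = ennreal (\<Sum>k. (1 / 2) ^ k)"
    by (intro suminf_ennreal2) auto
  also have "\<dots> = 2" by (simp add: suminf_geometric)
  finally show ?thesis by (simp add: ennreal_suminf_multc)
qed

context locally_finite_line
begin

text \<open>
  With \<open>b\<close> a bound for the operator norm on \<open>L\<^sup>p(\<mu>)\<close>, the series is taken with \<open>c = 1 / (4 b)\<close>.  The
  surplus factor \<open>4^(-k)\<close> replaces the Minkowski inequality: one factor \<open>2^(-k)\<close> bounds the sum by a supremum,
  the other one bounds the \<open>p\<close>-th power of the supremum by a convergent sum of \<open>p\<close>-th powers.
\<close>

lemma A1_majorant_Lp:
  assumes p: "1 < p" and g [measurable]: "g \<in> borel_measurable borel"
  obtains H where "H \<in> borel_measurable borel" "\<And>x. g x \<le> H x"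
    "\<And>x. maximal_fun \<mu> H x \<le> ennreal (4 * FS_const p powr (1 / p)) * H x"
    "(\<integral>\<^sup>+x. enn_powr (H x) p \<partial>\<mu>) \<le> ennreal (2 powr p * 2) * (\<integral>\<^sup>+x. enn_powr (g x) p \<partial>\<mu>)"
proof -
  let ?M = "\<lambda>k. (maximal_fun \<mu> ^^ k) g" and ?A = "\<integral>\<^sup>+x. enn_powr (g x) p \<partial>\<mu>"
  define b where "b = FS_const p powr (1 / p)"
  have b: "0 < b" "b powr p = FS_const p"
    using FS_const_pos[OF p] p by (auto simp: b_def powr_powr)
  define c where "c = 1 / (4 * b)"
  have c: "0 < c" using b by (simp add: c_def)
  define H where "H x = (\<Sum>k. ennreal (c ^ k) * ?M k x)" for x
  note R = Rubio_de_Francia_majorant[where M = borel and T = "maximal_fun \<mu>",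
      OF maximal_fun_measurable maximal_fun_suminf_le[OF sets_eq] c g, folded H_def]
  have iter [measurable]: "?M k \<in> borel_measurable borel" for k
    by (cases k) simp_all
  have norm: "(\<integral>\<^sup>+x. enn_powr (?M k x) p \<partial>\<mu>) \<le> ennreal (FS_const p ^ k) * ?A" for k
  proof (induction k)
    case (Suc k)
    have "(\<integral>\<^sup>+x. enn_powr (?M (Suc k) x) p \<partial>\<mu>)
       \<le> ennreal (FS_const p) * (\<integral>\<^sup>+x. enn_powr (?M k x) p \<partial>\<mu>)"
      using maximal_fun_strong[OF p iter, of k] by simp
    also have "\<dots> \<le> ennreal (FS_const p) * (ennreal (FS_const p ^ k) * ?A)"
      by (intro mult_left_mono Suc) simp
    finally show ?case
      using FS_const_pos[OF p] by (simp add: ennreal_mult mult.assoc)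
  qed simp
  have pointwise: "enn_powr (H x) p \<le> ennreal (2 powr p) * (\<Sum>k. ennreal (((1 / (2 * b)) powr p) ^ k) * enn_powr (?M k x) p)" for x
  proof -
    define u where "u k = ennreal ((1 / (2 * b)) ^ k) * ?M k x" for k
    have c_split: "c ^ k = (1 / 2) ^ k * (1 / (2 * b)) ^ k" for k
      by (simp add: c_def power_mult_distrib[symmetric])
    have "H x = (\<Sum>k. ennreal ((1 / 2) ^ k) * u k)"
      unfolding H_def u_def c_split using b by (simp add: ennreal_mult mult.assoc)
    also have "\<dots> \<le> (\<Sum>k. ennreal ((1 / 2) ^ k) * (SUP k. u k))"
      by (intro suminf_le mult_left_mono SUP_upper) auto
    also have "\<dots> = ennreal 2 * (SUP k. u k)"
      by (simp only: suminf_half_powers) simp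
    finally have "enn_powr (H x) p \<le> enn_powr (ennreal 2 * (SUP k. u k)) p"
      using p by (intro enn_powr_mono) auto
    also have "\<dots> = ennreal (2 powr p) * (SUP k. enn_powr (u k) p)"
      using p by (subst enn_powr_cmult) (auto simp: enn_powr_SUP)
    also have "\<dots> \<le> ennreal (2 powr p) * (\<Sum>k. enn_powr (u k) p)"
    proof (intro mult_left_mono SUP_least)
      fix k show "enn_powr (u k) p \<le> (\<Sum>k. enn_powr (u k) p)"
        using sum_le_suminf[of "\<lambda>k. enn_powr (u k) p" "{k}"] by simp
    qed simp
    also have "(\<lambda>k. enn_powr (u k) p) = (\<lambda>k. ennreal (((1 / (2 * b)) powr p) ^ k) * enn_powr (?M k x) p)"
    proof
      fix k
      have "((1 / (2 * b)) ^ k) powr p = ((1 / (2 * b)) powr p) ^ k"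
        using b by (simp add: powr_realpow[symmetric] powr_powr mult.commute)
      then show "enn_powr (u k) p = ennreal (((1 / (2 * b)) powr p) ^ k) * enn_powr (?M k x) p"
        unfolding u_def using p b by (subst enn_powr_cmult) auto
    qed
    finally show ?thesis .
  qed
  have "(\<integral>\<^sup>+x. enn_powr (H x) p \<partial>\<mu>) \<le> (\<integral>\<^sup>+x. ennreal (2 powr p) * (\<Sum>k. ennreal (((1 / (2 * b)) powr p) ^ k) * enn_powr (?M k x) p) \<partial>\<mu>)"
    by (intro nn_integral_mono pointwise)
  also have "\<dots> = ennreal (2 powr p) * (\<Sum>k. ennreal (((1 / (2 * b)) powr p) ^ k) * (\<integral>\<^sup>+x. enn_powr (?M k x) p \<partial>\<mu>))"
    by (subst nn_integral_cmult, measurable, subst nn_integral_suminf, measurable, subst nn_integral_cmult, measurable)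
  also have "\<dots> \<le> ennreal (2 powr p) * (\<Sum>k. ennreal ((1 / 2) ^ k) * ?A)"
  proof (intro mult_left_mono suminf_le)
    fix k
    have "ennreal (((1 / (2 * b)) powr p) ^ k) * (\<integral>\<^sup>+x. enn_powr (?M k x) p \<partial>\<mu>)
        \<le> ennreal (((1 / (2 * b)) powr p) ^ k) * (ennreal (FS_const p ^ k) * ?A)"
      by (intro mult_left_mono norm) simp
    also have "\<dots> = ennreal (((1 / (2 * b)) powr p * FS_const p) ^ k) * ?A"
      using FS_const_pos[OF p] by (simp add: power_mult_distrib ennreal_mult mult.assoc)
    also have "(1 / (2 * b)) powr p * FS_const p = 1 / 2 powr p"
      using b FS_const_pos[OF p] by (simp add: powr_divide powr_mult)
    also have "ennreal ((1 / 2 powr p) ^ k) * ?A \<le> ennreal ((1 / 2) ^ k) * ?A"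
    proof (intro mult_right_mono ennreal_leI power_mono)
      have "2 powr 1 \<le> (2::real) powr p" using p by (intro powr_mono) auto
      then show "1 / 2 powr p \<le> (1 / 2 :: real)" by (simp add: divide_simps)
    qed simp_all
    finally show "ennreal (((1 / (2 * b)) powr p) ^ k) * (\<integral>\<^sup>+x. enn_powr (?M k x) p \<partial>\<mu>)
      \<le> ennreal ((1 / 2) ^ k) * ?A" .
  qed simp_all
  also have "\<dots> = ennreal (2 powr p * 2) * ?A"
    by (simp only: suminf_half_powers) (simp add: ennreal_mult mult.assoc)
  finally have "(\<integral>\<^sup>+x. enn_powr (H x) p \<partial>\<mu>) \<le> ennreal (2 powr p * 2) * ?A" .
  moreover have "1 / c = 4 * FS_const p powr (1 / p)"
    by (simp add: c_def b_def)
  ultimately show thesis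
    using R by (intro that[of H]) simp_all
qed

text \<open>
  Jensen's inequality for the concave power, up to a factor: if \<open>m\<close> is the average of \<open>H\<close>, then
  \<open>H\<^sup>d \<le> m\<^sup>d (1 + H / m)\<close>, and the bracket has average \<open>2\<close>.  Thus positive powers
  below \<open>1\<close> preserve the \<open>A\<^sub>1\<close> condition.
\<close>

lemma maximal_fun_powr_le:
  assumes d: "0 < d" "d < 1" and [measurable]: "H \<in> borel_measurable borel"
  shows "maximal_fun \<mu> (\<lambda>y. enn_powr (H y) d) x \<le> 2 * enn_powr (maximal_fun \<mu> H x) d"
proof (rule maximal_fun_least)
  fix a b assume x: "x \<in> {a<..<b}"
  let ?\<mu> = "emeasure \<mu> {a<..<b}"
  define A where "A = (\<integral>\<^sup>+y\<in>{a<..<b}. H y \<partial>\<mu>) / ?\<mu>"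
  have int: "(\<integral>\<^sup>+y\<in>{a<..<b}. H y \<partial>\<mu>) = ?\<mu> * A"
    unfolding A_def by (rule interval_average[symmetric]) measurable
  have "(\<integral>\<^sup>+y\<in>{a<..<b}. enn_powr (H y) d \<partial>\<mu>) / ?\<mu> \<le> 2 * enn_powr A d"
  proof (cases A)
    case top
    then show ?thesis by simp
  next
    case (real m)
    consider "m = 0" | "0 < m" using real by linarith
    then show ?thesis
    proof cases
      case 1
      then have "(\<integral>\<^sup>+y\<in>{a<..<b}. H y \<partial>\<mu>) = 0" using int real by simp
      then have "AE y in \<mu>. H y * indicator {a<..<b} y = 0"
        by (subst (asm) nn_integral_0_iff_AE) measurable
      then have "AE y in \<mu>. enn_powr (H y) d * indicator {a<..<b} y = 0"
        by (auto elim!: eventually_mono simp: indicator_def)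
      then have "(\<integral>\<^sup>+y\<in>{a<..<b}. enn_powr (H y) d \<partial>\<mu>) = 0"
        by (subst nn_integral_0_iff_AE) measurable
      then show ?thesis by simp
    next
      case 2
      have pt: "enn_powr (H y) d \<le> ennreal (m powr d) * 1 + ennreal (m powr d / m) * H y" for y
      proof (cases "H y")
        case (real h)
        have "h powr d \<le> m powr d + m powr d / m * h"
        proof (cases "h \<le> m")
          case True
          then have "h powr d \<le> m powr d" using real d by (intro powr_mono2) auto
          moreover have "0 \<le> m powr d / m * h" using real 2 by simp
          ultimately show ?thesis by linarith
        next
          case False
          have "(h / m) powr d \<le> (h / m) powr 1"
            using False 2 d by (intro powr_mono) auto
          then have "h powr d \<le> m powr d / m * h"
            using False 2 by (simp add: powr_divide field_simps)
          then show ?thesis by (simp add: add_increasing)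
        qed
        then show ?thesis
          using real 2 by (simp add: enn_powr_ennreal_nonneg ennreal_mult[symmetric] ennreal_plus[symmetric] ennreal_leI del: ennreal_plus)
      next
        case top
        then show ?thesis using 2 by (simp add: ennreal_mult_top)
      qed
      have "(\<integral>\<^sup>+y\<in>{a<..<b}. enn_powr (H y) d \<partial>\<mu>) \<le>
          (\<integral>\<^sup>+y. ennreal (m powr d) * indicator {a<..<b} y + ennreal (m powr d / m) * (H y * indicator {a<..<b} y) \<partial>\<mu>)"
      proof (rule nn_integral_mono)
        fix y
        show "enn_powr (H y) d * indicator {a<..<b} y \<le>
          ennreal (m powr d) * indicator {a<..<b} y + ennreal (m powr d / m) * (H y * indicator {a<..<b} y)"
          using pt[of y] by (cases "y \<in> {a<..<b}") simp_all
      qed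
      also have "\<dots> = ennreal (m powr d) * ?\<mu> + ennreal (m powr d / m) * (?\<mu> * A)"
        by (subst nn_integral_add) (simp_all add: nn_integral_cmult nn_integral_cmult_indicator sets_eq int)
      also have "\<dots> = ?\<mu> * (ennreal (m powr d) + ennreal (m powr d / m) * A)"
        by (simp add: distrib_left mult_ac)
      also have "ennreal (m powr d / m) * A = ennreal (m powr d)"
        using real 2 by (simp add: ennreal_mult[symmetric])
      also have "ennreal (m powr d) + ennreal (m powr d) = 2 * enn_powr A d"
        using real by (simp add: enn_powr_ennreal_nonneg mult_2)
      finally have "(\<integral>\<^sup>+y\<in>{a<..<b}. enn_powr (H y) d \<partial>\<mu>) / ?\<mu> \<le> (?\<mu> * (2 * enn_powr A d)) / ?\<mu>"
        by (rule divide_right_mono_ennreal)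
      also have "\<dots> \<le> 2 * enn_powr A d"
        using finite_interval[of a b]
        by (cases "?\<mu> = 0") (auto simp: mult_divide_eq_ennreal mult.commute[of ?\<mu>])
      finally show ?thesis .
    qed
  qed
  also have "\<dots> \<le> 2 * enn_powr (maximal_fun \<mu> H x) d"
    unfolding A_def using d by (intro mult_left_mono enn_powr_mono maximal_fun_upper x) auto
  finally show "(\<integral>\<^sup>+y\<in>{a<..<b}. enn_powr (H y) d \<partial>\<mu>) / ?\<mu> \<le> \<dots>" .
qed

text \<open>
  An average of \<open>g v\<close> with respect to \<open>\<mu>\<close> is the average of \<open>v\<close> times the average of \<open>g\<close> with
  respect to \<open>v d\<mu>\<close>.  If \<open>v\<close> is an \<open>A\<^sub>1\<close> weight, this yields \<open>M\<^sub>\<mu> f \<le> K v M\<^sub>\<nu> (f / v)\<close> with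
  \<open>\<nu> = v d\<mu>\<close>, provided that \<open>0 < v < \<infinity>\<close> almost everywhere.
\<close>

lemma maximal_fun_change_of_density:
  assumes [measurable]: "v \<in> borel_measurable borel" "g \<in> borel_measurable borel"
    and nu: "locally_finite_line (density \<mu> v)"
  shows "maximal_fun \<mu> (\<lambda>y. g y * v y) x \<le> maximal_fun \<mu> v x * maximal_fun (density \<mu> v) g x"
proof (rule maximal_fun_least)
  interpret nu: locally_finite_line "density \<mu> v" by (rule nu)
  fix a b assume x: "x \<in> {a<..<b}"
  have em: "emeasure (density \<mu> v) {a<..<b} = (\<integral>\<^sup>+y\<in>{a<..<b}. v y \<partial>\<mu>)"
    by (rule emeasure_density) (auto simp: sets_eq)
  have "(\<integral>\<^sup>+y\<in>{a<..<b}. g y * v y \<partial>\<mu>) = (\<integral>\<^sup>+y\<in>{a<..<b}. g y \<partial>density \<mu> v)"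
    by (subst nn_integral_density) (auto intro!: nn_integral_cong simp: mult_ac)
  also have "\<dots> = emeasure (density \<mu> v) {a<..<b} * ((\<integral>\<^sup>+y\<in>{a<..<b}. g y \<partial>density \<mu> v) / emeasure (density \<mu> v) {a<..<b})"
    by (rule nu.interval_average[symmetric]) measurable
  also have "\<dots> \<le> (\<integral>\<^sup>+y\<in>{a<..<b}. v y \<partial>\<mu>) * maximal_fun (density \<mu> v) g x"
    unfolding em[symmetric] by (intro mult_left_mono maximal_fun_upper x) simp
  finally have "(\<integral>\<^sup>+y\<in>{a<..<b}. g y * v y \<partial>\<mu>) / emeasure \<mu> {a<..<b} \<le>
      (\<integral>\<^sup>+y\<in>{a<..<b}. v y \<partial>\<mu>) * maximal_fun (density \<mu> v) g x / emeasure \<mu> {a<..<b}"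
    by (rule divide_right_mono_ennreal)
  also have "\<dots> = ((\<integral>\<^sup>+y\<in>{a<..<b}. v y \<partial>\<mu>) / emeasure \<mu> {a<..<b}) * maximal_fun (density \<mu> v) g x"
    by (simp add: divide_ennreal_def mult_ac)
  also have "\<dots> \<le> maximal_fun \<mu> v x * maximal_fun (density \<mu> v) g x"
    by (intro mult_right_mono maximal_fun_upper x) simp
  finally show "(\<integral>\<^sup>+y\<in>{a<..<b}. g y * v y \<partial>\<mu>) / emeasure \<mu> {a<..<b} \<le> \<dots>" .
qed

end

text \<open>
  The factors come from the \<open>A\<^sub>1\<close> constant of \<open>H^((r-p)/(r-1))\<close>, from the two terms of Young's inequality,
  and from the \<open>L\<^sup>p\<close> bound of the majorant \<open>H\<close>.
\<close>

definition small_exponent_const :: "real \<Rightarrow> real \<Rightarrow> real" where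
  "small_exponent_const r p =
     (2 * (4 * FS_const p powr (1 / p)) powr ((r - p) / (r - 1))) powr p * (FS_const r + 1) * (2 powr p * 2)"

lemma small_exponent_const_pos: "1 < r \<Longrightarrow> 1 < p \<Longrightarrow> 0 < small_exponent_const r p"
  using FS_const_pos[of p] FS_const_pos[of r] by (simp add: small_exponent_const_def)

context locally_finite_line
begin

lemma maximal_fun_eq_0_AE:
  assumes "maximal_fun \<mu> g x = 0" and [measurable]: "g \<in> borel_measurable borel"
  shows "AE y in \<mu>. g y = 0"
proof -
  have 1: "(\<integral>\<^sup>+y\<in>{x - real (Suc n)<..<x + real (Suc n)}. g y \<partial>\<mu>) = 0" for n
  proof -
    have "x \<in> {x - real (Suc n)<..<x + real (Suc n)}" by simp
    from maximal_fun_upper[OF this, of \<mu> g] interval_average[OF assms(2), of "x - real (Suc n)" "x + real (Suc n)"]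
    show ?thesis unfolding assms(1) by (metis le_zero_eq mult_zero_right)
  qed
  have "AE y in \<mu>. g y * indicator {x - real (Suc n)<..<x + real (Suc n)} y = 0" for n
    using 1[of n] by (subst (asm) nn_integral_0_iff_AE) measurable
  then have "AE y in \<mu>. \<forall>n. g y * indicator {x - real (Suc n)<..<x + real (Suc n)} y = 0"
    unfolding AE_all_countable ..
  then show ?thesis
  proof (rule eventually_mono)
    fix y assume *: "\<forall>n. g y * indicator {x - real (Suc n)<..<x + real (Suc n)} y = 0"
    obtain n where "\<bar>y - x\<bar> < real n" using reals_Archimedean2 by blast
    then have "y \<in> {x - real (Suc n)<..<x + real (Suc n)}" by (auto simp: abs_less_iff)
    with *[rule_format, of n] show "g y = 0" by simp
  qed
qed

lemma maximal_fun_zero: "AE y in \<mu>. g y = 0 \<Longrightarrow> maximal_fun \<mu> g x = 0"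
  using maximal_fun_least[of x \<mu> "\<lambda>_. 0" 0] maximal_fun_cong_AE[of g "\<lambda>_. 0" \<mu> x] by simp

text \<open>
  Let \<open>H\<close> be an \<open>A\<^sub>1\<close> majorant of \<open>(\<Sum> f\<^sub>k\<^sup>r)^(1/r)\<close>, \<open>v = H\<^sup>d\<close> with \<open>d = (r - p) / (r - 1)\<close>, \<open>g\<^sub>k = f\<^sub>k / v\<close>
  and \<open>\<nu> = v d\<mu>\<close>.  By the previous lemmas \<open>M\<^sub>\<mu> f\<^sub>k\<close> is at most a constant times \<open>v M\<^sub>\<nu> g\<^sub>k\<close>.  With
  \<open>G = \<Sum> (M\<^sub>\<nu> g\<^sub>k)\<^sup>r\<close> the left-hand side is therefore controlled by
  \<open>\<integral> v^(p-1) G^(p/r) d\<nu>\<close>, which Young's inequality splits into \<open>\<integral> G d\<nu>\<close>, an instance of the case of equal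
  exponents, and the integral of a power of \<open>v\<close>.  The exponent \<open>d\<close> is the one for which both parts
  reduce to \<open>\<integral> H\<^sup>p d\<mu>\<close>.
\<close>

lemma vector_valued_small_exponent:
  assumes p: "1 < p" "p < r" and f [measurable]: "\<And>k. f k \<in> borel_measurable borel"
  shows "(\<integral>\<^sup>+x. enn_powr (\<Sum>k. enn_powr (maximal_fun \<mu> (f k) x) r) (p / r) \<partial>\<mu>)
     \<le> ennreal (small_exponent_const r p) * (\<integral>\<^sup>+x. enn_powr (\<Sum>k. enn_powr (f k x) r) (p / r) \<partial>\<mu>)"
    (is "?lhs \<le> _ * ?a")
proof -
  have r: "1 < r" using p by simp
  define s where "s x = (\<Sum>k. enn_powr (f k x) r)" for x
  define fs where "fs x = enn_powr (s x) (1 / r)" for x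
  have [measurable]: "s \<in> borel_measurable borel" "fs \<in> borel_measurable borel"
    unfolding s_def fs_def by measurable
  have fs_p: "enn_powr (fs x) p = enn_powr (s x) (p / r)" for x
    using p by (simp add: fs_def enn_powr_powr)
  have fs_r: "enn_powr (fs x) r = s x" for x
    using r by (simp add: fs_def enn_powr_powr)
  define a where "a = (\<integral>\<^sup>+x. enn_powr (fs x) p \<partial>\<mu>)"
  have a_eq: "?a = a" by (simp add: a_def fs_p s_def)
  obtain H where H [measurable]: "H \<in> borel_measurable borel" and H_ge: "\<And>x. fs x \<le> H x"
    and H_A1: "\<And>x. maximal_fun \<mu> H x \<le> ennreal (4 * FS_const p powr (1 / p)) * H x"
    and H_int: "(\<integral>\<^sup>+x. enn_powr (H x) p \<partial>\<mu>) \<le> ennreal (2 powr p * 2) * a"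
    unfolding a_def by (rule A1_majorant_Lp[OF p(1), of fs]) measurable
  define K where "K = 4 * FS_const p powr (1 / p)"
  have K: "0 < K" using FS_const_pos[OF p(1)] by (simp add: K_def)
  define d where "d = (r - p) / (r - 1)"
  have d: "0 < d" "d < 1" using p by (auto simp: d_def)
  define L where "L = 2 * K powr d"
  have L: "0 < L" using K by (simp add: L_def)
  have C: "small_exponent_const r p = L powr p * (FS_const r + 1) * (2 powr p * 2)"
    by (simp add: small_exponent_const_def L_def K_def d_def)
  consider "a = \<infinity>" | x where "H x = 0" | "a < \<infinity>" "\<And>x. H x \<noteq> 0"
    by (auto simp: less_top[symmetric])
  then show ?thesis
  proof cases
    case 1
    then show ?thesis
      using a_eq small_exponent_const_pos[OF r p(1)] by (simp add: ennreal_mult_top)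
  next
    case (2 x)
    then have "AE y in \<mu>. H y = 0"
      using H_A1[of x] by (intro maximal_fun_eq_0_AE[of H x]) auto
    then have "AE y in \<mu>. \<forall>k. f k y = 0"
    proof (rule eventually_mono)
      fix y assume "H y = 0"
      then have "fs y = 0" using H_ge[of y] by simp
      then have "s y = 0" using r by (simp add: fs_def)
      then have "enn_powr (f k y) r = 0" for k
        using sum_le_suminf[of "\<lambda>k. enn_powr (f k y) r" "{k}"] by (simp add: s_def)
      then show "\<forall>k. f k y = 0" by simp
    qed
    then have "maximal_fun \<mu> (f k) x = 0" for k x
      by (intro maximal_fun_zero) auto
    then show ?thesis by simp
  next
    case 3
    define v where "v x = enn_powr (H x) d" for x
    have [measurable]: "v \<in> borel_measurable borel" unfolding v_def by measurable
    have v_A1: "maximal_fun \<mu> v x \<le> ennreal L * v x" for x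
    proof -
      have "maximal_fun \<mu> v x \<le> 2 * enn_powr (maximal_fun \<mu> H x) d"
        unfolding v_def by (rule maximal_fun_powr_le[OF d H])
      also have "\<dots> \<le> 2 * enn_powr (ennreal K * H x) d"
        using d H_A1[of x] by (intro mult_left_mono enn_powr_mono) (auto simp: K_def)
      also have "\<dots> = ennreal L * v x"
        using d K by (simp add: enn_powr_cmult v_def L_def ennreal_mult mult.assoc)
      finally show ?thesis .
    qed
    have Hp_fin: "(\<integral>\<^sup>+x. enn_powr (H x) p \<partial>\<mu>) < \<infinity>"
      using H_int 3(1) by (auto simp: ennreal_mult_less_top intro: order_le_less_trans)
    have v_le: "v y \<le> 1 + enn_powr (H y) p" for y
    proof (cases "H y \<le> 1")
      case True
      then have "v y \<le> enn_powr 1 d" unfolding v_def using d by (intro enn_powr_mono) auto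
      then show ?thesis by (simp add: add_increasing2)
    next
      case False
      have "v y \<le> enn_powr (H y) p"
      proof (cases "H y")
        case (real h)
        then have "1 < h" using False by (simp add: ennreal_le_1 not_le)
        then show ?thesis using real d p unfolding v_def
          by (simp add: enn_powr_ennreal_nonneg ennreal_leI powr_mono)
      qed simp
      then show ?thesis by (simp add: add_increasing)
    qed
    interpret nu: locally_finite_line "density \<mu> v"
    proof
      show "sets (density \<mu> v) = sets borel" by (simp add: sets_eq)
      fix u w
      have "emeasure (density \<mu> v) {u<..<w} = (\<integral>\<^sup>+y\<in>{u<..<w}. v y \<partial>\<mu>)"
        by (rule emeasure_density) (auto simp: sets_eq)
      also have "\<dots> \<le> (\<integral>\<^sup>+y. indicator {u<..<w} y + enn_powr (H y) p \<partial>\<mu>)"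
      proof (rule nn_integral_mono)
        fix y show "v y * indicator {u<..<w} y \<le> indicator {u<..<w} y + enn_powr (H y) p"
          using v_le[of y] by (cases "y \<in> {u<..<w}") simp_all
      qed
      also have "\<dots> = emeasure \<mu> {u<..<w} + (\<integral>\<^sup>+x. enn_powr (H x) p \<partial>\<mu>)"
        by (subst nn_integral_add) (simp_all add: sets_eq)
      also have "\<dots> < \<infinity>" using Hp_fin finite_interval[of u w] by simp
      finally show "emeasure (density \<mu> v) {u<..<w} < \<infinity>" .
    qed
    have Hp_AE: "AE x in \<mu>. H x \<noteq> \<infinity>"
    proof -
      have "AE x in \<mu>. enn_powr (H x) p \<noteq> \<infinity>"
        by (rule nn_integral_PInf_AE) (use Hp_fin in \<open>auto simp: less_top[symmetric]\<close>)
      then show ?thesis by simp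
    qed
    define g where "g k x = f k x / v x" for k x
    have [measurable]: "g k \<in> borel_measurable borel" for k
      unfolding g_def by measurable
    have gv: "g k y * v y = f k y" if "H y \<noteq> \<infinity>" for k y
    proof -
      have "v y \<noteq> 0" "v y \<noteq> top" using that 3(2)[of y] by (auto simp: v_def)
      then show ?thesis unfolding g_def
        by (simp add: ennreal_divide_times top.not_eq_extremum)
    qed
    have Mf: "maximal_fun \<mu> (f k) x \<le> ennreal L * v x * maximal_fun (density \<mu> v) (g k) x" for k x
    proof -
      have "maximal_fun \<mu> (f k) x = maximal_fun \<mu> (\<lambda>y. g k y * v y) x"
        by (rule maximal_fun_cong_AE) (use Hp_AE gv in \<open>auto elim!: eventually_mono\<close>)
      also have "\<dots> \<le> maximal_fun \<mu> v x * maximal_fun (density \<mu> v) (g k) x"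
        by (rule maximal_fun_change_of_density) (measurable, rule nu.locally_finite_line_axioms)
      also have "\<dots> \<le> ennreal L * v x * maximal_fun (density \<mu> v) (g k) x"
        by (intro mult_right_mono v_A1) simp
      finally show ?thesis .
    qed
    define G where "G x = (\<Sum>k. enn_powr (maximal_fun (density \<mu> v) (g k) x) r)" for x
    have [measurable]: "G \<in> borel_measurable borel" unfolding G_def by measurable
    \<comment> \<open>The power of \<open>v\<close> that Young's inequality with exponent \<open>r / p\<close> produces from \<open>v^(p-1)\<close>.\<close>
    define e where "e = (p - 1) * (r / (r - p))"
    have exps: "p / r > 0" "1 < r / p" "r / p / (r / p - 1) = r / (r - p)"
      using p by (auto simp: field_simps)
    have pt: "enn_powr (\<Sum>k. enn_powr (maximal_fun \<mu> (f k) x) r) (p / r) \<le>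
       ennreal (L powr p) * (v x * (G x + enn_powr (v x) e))" for x
    proof -
      have "(\<Sum>k. enn_powr (maximal_fun \<mu> (f k) x) r) \<le> (\<Sum>k. enn_powr (ennreal L * v x) r * enn_powr (maximal_fun (density \<mu> v) (g k) x) r)"
        using r Mf by (intro suminf_le) (auto simp: enn_powr_mult[symmetric] intro!: enn_powr_mono)
      also have "\<dots> = enn_powr (ennreal L * v x) r * G x"
        by (simp add: G_def)
      finally have "enn_powr (\<Sum>k. enn_powr (maximal_fun \<mu> (f k) x) r) (p / r) \<le> enn_powr (enn_powr (ennreal L * v x) r * G x) (p / r)"
        using exps by (intro enn_powr_mono) auto
      also have "\<dots> = enn_powr (ennreal L * v x) p * enn_powr (G x) (p / r)"
        using p exps by (simp add: enn_powr_mult enn_powr_powr)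
      also have "enn_powr (ennreal L * v x) p = ennreal (L powr p) * (v x * enn_powr (v x) (p - 1))"
        using p L enn_powr_add[of "v x" 1 "p - 1"] by (simp add: enn_powr_cmult)
      also have "\<dots> * enn_powr (G x) (p / r) = ennreal (L powr p) * (v x * (enn_powr (G x) (p / r) * enn_powr (v x) (p - 1)))"
        by (simp add: mult_ac)
      also have "\<dots> \<le> ennreal (L powr p) * (v x * (enn_powr (enn_powr (G x) (p / r)) (r / p) + enn_powr (enn_powr (v x) (p - 1)) (r / p / (r / p - 1))))"
        by (intro mult_left_mono enn_powr_Young exps) simp_all
      also have "\<dots> = ennreal (L powr p) * (v x * (G x + enn_powr (v x) e))"
        using p unfolding exps by (simp add: enn_powr_powr e_def)
      finally show ?thesis .
    qed
    have "1 + e = p / d"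
    proof -
      have "1 + e = p * (r - 1) / (r - p)" using p by (simp add: e_def field_simps)
      then show ?thesis by (simp add: d_def)
    qed
    then have exp1: "d * (1 + e) = p" using d by simp
    have v_e: "v x * enn_powr (v x) e = enn_powr (H x) p" for x
    proof -
      have "0 < 1 + e" using \<open>1 + e = p / d\<close> p d by simp
      then show ?thesis
        using enn_powr_add[of "v x" 1 e] exp1 by (simp add: v_def enn_powr_powr)
    qed
    have vg: "v x * (\<Sum>k. enn_powr (g k x) r) \<le> enn_powr (H x) p" if fin: "H x \<noteq> \<infinity>" for x
    proof -
      obtain h where h: "H x = ennreal h" "0 < h"
        using fin 3(2)[of x] by (cases "H x") (auto simp: ennreal_eq_0_iff not_le)
      have v: "v x = ennreal (h powr d)" using h by (simp add: v_def enn_powr_ennreal_nonneg)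
      have "g k x = f k x * ennreal (h powr (- d))" for k
        using h by (simp add: g_def v divide_ennreal_def inverse_ennreal powr_minus)
      then have "enn_powr (g k x) r = enn_powr (f k x) r * ennreal (h powr (- d * r))" for k
        using r h by (simp add: enn_powr_cmult' powr_powr)
      then have "v x * (\<Sum>k. enn_powr (g k x) r) = ennreal (h powr d) * (s x * ennreal (h powr (- d * r)))"
        by (simp add: v s_def)
      also have "\<dots> \<le> ennreal (h powr d) * (ennreal (h powr r) * ennreal (h powr (- d * r)))"
      proof (intro mult_left_mono mult_right_mono)
        have "s x \<le> enn_powr (H x) r"
          unfolding fs_r[symmetric] using r H_ge by (intro enn_powr_mono) auto
        then show "s x \<le> ennreal (h powr r)" using h by (simp add: enn_powr_ennreal_nonneg)
      qed simp_all
      also have "\<dots> = ennreal (h powr (d + (r + (- d * r))))"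
        unfolding powr_add by (simp only: ennreal_mult[symmetric] powr_ge_zero mult_nonneg_nonneg)
      also have "d + (r + (- d * r)) = p"
      proof -
        have "d * (r - 1) = r - p" using r by (simp add: d_def)
        then show ?thesis by (simp add: algebra_simps)
      qed
      also have "ennreal (h powr p) = enn_powr (H x) p" using h by (simp add: enn_powr_ennreal_nonneg)
      finally show ?thesis .
    qed
    let ?Hp = "\<integral>\<^sup>+x. enn_powr (H x) p \<partial>\<mu>"
    have "?lhs \<le> (\<integral>\<^sup>+x. ennreal (L powr p) * (v x * (G x + enn_powr (v x) e)) \<partial>\<mu>)"
      by (intro nn_integral_mono pt)
    also have "\<dots> = ennreal (L powr p) * (\<integral>\<^sup>+x. v x * G x + enn_powr (H x) p \<partial>\<mu>)"
      by (subst nn_integral_cmult) (simp_all add: distrib_left v_e)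
    also have "(\<integral>\<^sup>+x. v x * G x + enn_powr (H x) p \<partial>\<mu>) = (\<integral>\<^sup>+x. v x * G x \<partial>\<mu>) + ?Hp"
      by (rule nn_integral_add) measurable
    also have "(\<integral>\<^sup>+x. v x * G x \<partial>\<mu>) = (\<integral>\<^sup>+x. G x \<partial>density \<mu> v)"
      by (rule nn_integral_density[symmetric]) measurable
    also have "ennreal (L powr p) * ((\<integral>\<^sup>+x. G x \<partial>density \<mu> v) + ?Hp)
        \<le> ennreal (L powr p) * (ennreal (FS_const r) * ?Hp + ?Hp)"
    proof (intro mult_left_mono add_right_mono)
      have "(\<integral>\<^sup>+x. G x \<partial>density \<mu> v) \<le> ennreal (FS_const r) * (\<integral>\<^sup>+x. (\<Sum>k. enn_powr (g k x) r) \<partial>density \<mu> v)"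
        unfolding G_def by (rule nu.vector_valued_diagonal[OF r]) measurable
      also have "(\<integral>\<^sup>+x. (\<Sum>k. enn_powr (g k x) r) \<partial>density \<mu> v) = (\<integral>\<^sup>+x. v x * (\<Sum>k. enn_powr (g k x) r) \<partial>\<mu>)"
        by (rule nn_integral_density) measurable
      also have "\<dots> \<le> ?Hp"
        using Hp_AE by (intro nn_integral_mono_AE) (auto elim!: eventually_mono simp: vg)
      finally show "(\<integral>\<^sup>+x. G x \<partial>density \<mu> v) \<le> ennreal (FS_const r) * ?Hp"
        by (simp add: mult_left_mono)
    qed simp
    also have "\<dots> = ennreal (L powr p * (FS_const r + 1)) * ?Hp"
      using FS_const_pos[OF r] by (simp add: ennreal_mult ennreal_plus distrib_right mult.assoc)
    also have "\<dots> \<le> ennreal (L powr p * (FS_const r + 1)) * (ennreal (2 powr p * 2) * a)"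
      by (intro mult_left_mono H_int) simp
    also have "\<dots> = ennreal (small_exponent_const r p) * a"
      unfolding C using FS_const_pos[OF r] by (simp add: ennreal_mult mult.assoc)
    finally show ?thesis unfolding a_eq .
  qed
qed

end

theorem vector_valued_maximal_line:
  assumes r: "1 < r" and p: "1 < p"
  obtains C :: real where "0 < C"
    "\<And>\<mu> f. locally_finite_line \<mu> \<Longrightarrow> (\<And>k::nat. f k \<in> borel_measurable borel) \<Longrightarrow>
      (\<integral>\<^sup>+x. enn_powr (\<Sum>k. enn_powr (maximal_fun \<mu> (f k) x) r) (p / r) \<partial>\<mu>)
     \<le> ennreal C * (\<integral>\<^sup>+x. enn_powr (\<Sum>k. enn_powr (f k x) r) (p / r) \<partial>\<mu>)"
proof -
  consider "p < r" | "p = r" | "r < p" by linarith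
  then show thesis
  proof cases
    case 1
    show thesis
      using small_exponent_const_pos[OF r p] locally_finite_line.vector_valued_small_exponent[OF _ p 1]
      by (rule that)
  next
    case 2
    show thesis
      by (rule that[OF FS_const_pos[OF r]])
         (use r 2 locally_finite_line.vector_valued_diagonal[OF _ r] in simp)
  next
    case 3
    define q where "q = p / r"
    have q: "1 < q" using 3 r by (simp add: q_def)
    define D where "D = 2 * FS_const r * FS_const (q / (q - 1))"
    have "1 < q / (q - 1)" using q by simp
    then have D: "0 < D" using FS_const_pos[OF r] FS_const_pos[of "q / (q - 1)"] by (simp add: D_def)
    define L where "L = D powr ((q - 1) / q)"
    have L: "0 < L" "L powr (q / (q - 1)) = D"
      using D q by (simp_all add: L_def powr_powr)
    show thesis
    proof (rule that)
      show "0 < 2 * FS_const r * L powr q" using L FS_const_pos[OF r] by simp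
      show "(\<integral>\<^sup>+x. enn_powr (\<Sum>k. enn_powr (maximal_fun \<mu> (f k) x) r) (p / r) \<partial>\<mu>)
         \<le> ennreal (2 * FS_const r * L powr q) * (\<integral>\<^sup>+x. enn_powr (\<Sum>k. enn_powr (f k x) r) (p / r) \<partial>\<mu>)"
        if "locally_finite_line \<mu>" "\<And>k::nat. f k \<in> borel_measurable borel" for \<mu> f
        using locally_finite_line.vector_valued_large_exponent[OF that(1) r q that(2) L(1)] L(2)
        by (simp add: D_def q_def)
    qed
  qed
qed

section \<open>Weights on the line\<close>

lemma lborel_locally_finite: "locally_finite_line lborel"
proof
  fix a b :: real show "emeasure lborel {a<..<b} < \<infinity>"
    by (cases "a \<le> b") simp_all
qed simp

text \<open>
  If \<open>0 < w(I) < \<infinity>\<close> for all bounded intervals \<open>I\<close>, then \<open>w \<ge> w(I) / (K \<bar>I\<bar>)\<close> on \<open>I\<close>, so the Lebesgue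
  average of \<open>f\<close> over \<open>I\<close> is at most \<open>K\<close> times its average with respect to \<open>w dx\<close>, and the unweighted
  theorem for the measure \<open>w dx\<close> applies.  The \<open>A\<^sub>1\<close> condition leaves only two other possibilities: a
  weight that is not locally integrable is infinite everywhere, and one with a zero vanishes almost
  everywhere.
\<close>

theorem vector_valued_maximal_weighted_line:
  assumes r: "1 < r" and p: "1 < p"
  obtains C :: real where "0 < C"
    "\<And>K w f. 0 < K \<Longrightarrow> w \<in> borel_measurable borel \<Longrightarrow>
      (\<And>x. maximal_fun lborel w x \<le> ennreal K * w x) \<Longrightarrow>
      (\<And>k::nat. f k \<in> borel_measurable borel) \<Longrightarrow>
      (\<integral>\<^sup>+x. enn_powr (\<Sum>k. enn_powr (maximal_fun lborel (f k) x) r) (p / r) * w x \<partial>lborel)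
     \<le> ennreal (C * K powr p) * (\<integral>\<^sup>+x. enn_powr (\<Sum>k. enn_powr (f k x) r) (p / r) * w x \<partial>lborel)"
proof -
  interpret L: locally_finite_line lborel by (rule lborel_locally_finite)
  obtain C :: real where C: "0 < C" and main:
    "\<And>\<mu> f. locally_finite_line \<mu> \<Longrightarrow> (\<And>k::nat. f k \<in> borel_measurable borel) \<Longrightarrow>
      (\<integral>\<^sup>+x. enn_powr (\<Sum>k. enn_powr (maximal_fun \<mu> (f k) x) r) (p / r) \<partial>\<mu>)
     \<le> ennreal C * (\<integral>\<^sup>+x. enn_powr (\<Sum>k. enn_powr (f k x) r) (p / r) \<partial>\<mu>)"
    by (fact vector_valued_maximal_line[OF r p])
  have q: "0 < p / r" using r p by simp
  show thesis
  proof (rule that[OF C])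
    fix K :: real and w :: "real \<Rightarrow> ennreal" and f :: "nat \<Rightarrow> real \<Rightarrow> ennreal"
    assume K: "0 < K" and w [measurable]: "w \<in> borel_measurable borel"
      and A1: "\<And>x. maximal_fun lborel w x \<le> ennreal K * w x"
      and f [measurable]: "\<And>k. f k \<in> borel_measurable borel"
    define s where "s x = enn_powr (\<Sum>k. enn_powr (f k x) r) (p / r)" for x
    define S where "S x = enn_powr (\<Sum>k. enn_powr (maximal_fun lborel (f k) x) r) (p / r)" for x
    have [measurable]: "s \<in> borel_measurable borel" "S \<in> borel_measurable borel"
      unfolding s_def S_def by measurable
    consider "\<exists>a b. (\<integral>\<^sup>+y\<in>{a<..<b}. w y \<partial>lborel) = \<infinity>"
      | x where "w x = 0"
      | "\<And>a b. (\<integral>\<^sup>+y\<in>{a<..<b}. w y \<partial>lborel) < \<infinity>" "\<And>x. w x \<noteq> 0"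
      by (auto simp: less_top[symmetric])
    then have "(\<integral>\<^sup>+x. S x * w x \<partial>lborel) \<le> ennreal (C * K powr p) * (\<integral>\<^sup>+x. s x * w x \<partial>lborel)"
    proof cases
      case 1
      then obtain a b where ab: "(\<integral>\<^sup>+y\<in>{a<..<b}. w y \<partial>lborel) = \<infinity>" by blast
      have w_top: "w x = \<infinity>" for x
      proof -
        define a' where "a' = min a x - 1"
        define b' where "b' = max b x + 1"
        have x: "x \<in> {a'<..<b'}" by (auto simp: a'_def b'_def)
        have "{a<..<b} \<subseteq> {a'<..<b'}" by (auto simp: a'_def b'_def)
        then have "(\<integral>\<^sup>+y\<in>{a<..<b}. w y \<partial>lborel) \<le> (\<integral>\<^sup>+y\<in>{a'<..<b'}. w y \<partial>lborel)"
          by (rule nn_set_integral_set_mono)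
        then have "(\<integral>\<^sup>+y\<in>{a'<..<b'}. w y \<partial>lborel) = \<infinity>" using ab by (simp add: top_unique)
        moreover have "emeasure lborel {a'<..<b'} \<noteq> top"
          using L.finite_interval[of a' b'] by simp
        ultimately have "maximal_fun lborel w x = \<infinity>"
          using maximal_fun_upper[OF x, of lborel w] by (simp add: ennreal_top_divide top_unique)
        then show ?thesis using A1[of x] by (simp add: top_unique ennreal_mult_eq_top_iff)
      qed
      show ?thesis
      proof (cases "(\<integral>\<^sup>+x. s x * w x \<partial>lborel) = \<infinity>")
        case True
        then show ?thesis using C K by (simp add: ennreal_mult_top)
      next
        case False
        have "AE x in lborel. s x * w x \<noteq> \<infinity>"
          by (rule nn_integral_PInf_AE) (use False in simp_all)
        then have "AE x in lborel. \<forall>k. f k x = 0"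
        proof (rule eventually_mono)
          fix x assume "s x * w x \<noteq> \<infinity>"
          then have "s x = 0" by (simp add: w_top ennreal_mult_eq_top_iff)
          then have "enn_powr (f k x) r = 0" for k
            using sum_le_suminf[of "\<lambda>k. enn_powr (f k x) r" "{k}"] by (simp add: s_def)
          then show "\<forall>k. f k x = 0" by simp
        qed
        then have "maximal_fun lborel (f k) x = 0" for k x
          by (intro L.maximal_fun_zero) auto
        then show ?thesis by (simp add: S_def)
      qed
    next
      case (2 x)
      then have "AE y in lborel. w y = 0"
        using A1[of x] by (intro L.maximal_fun_eq_0_AE[of w x]) auto
      then have "AE y in lborel. S y * w y = 0" by (auto elim!: eventually_mono)
      then have "(\<integral>\<^sup>+x. S x * w x \<partial>lborel) = 0"
        by (subst nn_integral_0_iff_AE) measurable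
      then show ?thesis by simp
    next
      case 3
      let ?\<mu> = "density lborel w"
      have em: "emeasure ?\<mu> {a<..<b} = (\<integral>\<^sup>+y\<in>{a<..<b}. w y \<partial>lborel)" for a b
        by (rule emeasure_density) auto
      interpret mu: locally_finite_line ?\<mu>
        by standard (simp_all add: em 3(1)[unfolded infinity_ennreal_def])
      have Mf: "maximal_fun lborel (f k) x \<le> ennreal K * maximal_fun ?\<mu> (f k) x" for k x
      proof (rule maximal_fun_least)
        fix a b assume x: "x \<in> {a<..<b}"
        let ?l = "emeasure lborel {a<..<b}" and ?F = "\<integral>\<^sup>+y\<in>{a<..<b}. f k y \<partial>lborel"
        define W where "W = (\<integral>\<^sup>+y\<in>{a<..<b}. w y \<partial>lborel)"
        have W_fin: "W < top" using 3(1) by (simp add: W_def)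
        have W_pos: "W \<noteq> 0"
        proof
          assume "W = 0"
          then have "AE y in lborel. w y * indicator {a<..<b} y = 0"
            unfolding W_def by (subst (asm) nn_integral_0_iff_AE) measurable
          then have "AE y in lborel. y \<notin> {a<..<b}"
            by (rule eventually_mono) (use 3(2) in \<open>auto simp: indicator_def split: if_splits\<close>)
          then have "?l = 0" by (subst (asm) AE_iff_measurable[OF _ refl]) (auto simp: greaterThanLessThan_eq Int_def)
          then show False using x by simp
        qed
        have "?F * (W / ?l) = (\<integral>\<^sup>+y\<in>{a<..<b}. f k y * (W / ?l) \<partial>lborel)"
          by (subst nn_integral_multc[symmetric]) (measurable, simp only: mult.assoc mult.commute[of "W / ?l"])
        also have "\<dots> \<le> (\<integral>\<^sup>+y. ennreal K * (w y * (f k y * indicator {a<..<b} y)) \<partial>lborel)"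
        proof (rule nn_integral_mono)
          fix y
          show "f k y * (W / ?l) * indicator {a<..<b} y \<le> ennreal K * (w y * (f k y * indicator {a<..<b} y))"
          proof (cases "y \<in> {a<..<b}")
            case True
            have "f k y * (W / ?l) \<le> f k y * (ennreal K * w y)"
              using order_trans[OF maximal_fun_upper[OF True] A1] unfolding W_def by (rule mult_left_mono) simp
            then show ?thesis using True by (simp add: mult_ac)
          qed simp
        qed
        also have "\<dots> = ennreal K * (\<integral>\<^sup>+y\<in>{a<..<b}. f k y \<partial>?\<mu>)"
          by (subst nn_integral_cmult, measurable, subst nn_integral_density, measurable)
        finally have "?F * (W / ?l) / W \<le> ennreal K * (\<integral>\<^sup>+y\<in>{a<..<b}. f k y \<partial>?\<mu>) / W"
          by (rule divide_right_mono_ennreal)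
        also have "\<dots> \<le> ennreal K * maximal_fun ?\<mu> (f k) x"
          unfolding ennreal_times_divide[symmetric] W_def em[symmetric]
          by (intro mult_left_mono maximal_fun_upper x) simp
        also have "?F * (W / ?l) / W = ?F / ?l"
        proof -
          have "?F * (W / ?l) / W = ?F / ?l * (W / W)"
            by (simp only: divide_ennreal_def mult_ac)
          also have "W / W = 1" using W_fin W_pos by simp
          finally show ?thesis by simp
        qed
        finally show "?F / ?l \<le> ennreal K * maximal_fun ?\<mu> (f k) x" .
      qed
      have "S x \<le> ennreal (K powr p) * enn_powr (\<Sum>k. enn_powr (maximal_fun ?\<mu> (f k) x) r) (p / r)" for x
      proof -
        have "(\<Sum>k. enn_powr (maximal_fun lborel (f k) x) r) \<le> (\<Sum>k. ennreal (K powr r) * enn_powr (maximal_fun ?\<mu> (f k) x) r)"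
          using r K Mf by (intro suminf_le) (auto simp: enn_powr_cmult[symmetric] intro!: enn_powr_mono)
        also have "\<dots> = ennreal (K powr r) * (\<Sum>k. enn_powr (maximal_fun ?\<mu> (f k) x) r)"
          by simp
        finally have "S x \<le> enn_powr (ennreal (K powr r) * (\<Sum>k. enn_powr (maximal_fun ?\<mu> (f k) x) r)) (p / r)"
          unfolding S_def using q by (intro enn_powr_mono) auto
        also have "\<dots> = ennreal (K powr p) * enn_powr (\<Sum>k. enn_powr (maximal_fun ?\<mu> (f k) x) r) (p / r)"
          using q r by (subst enn_powr_cmult) (auto simp: powr_powr)
        finally show ?thesis .
      qed
      then have "(\<integral>\<^sup>+x. S x \<partial>?\<mu>) \<le> (\<integral>\<^sup>+x. ennreal (K powr p) * enn_powr (\<Sum>k. enn_powr (maximal_fun ?\<mu> (f k) x) r) (p / r) \<partial>?\<mu>)"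
        by (rule nn_integral_mono)
      also have "\<dots> = ennreal (K powr p) * (\<integral>\<^sup>+x. enn_powr (\<Sum>k. enn_powr (maximal_fun ?\<mu> (f k) x) r) (p / r) \<partial>?\<mu>)"
        by (rule nn_integral_cmult) measurable
      also have "\<dots> \<le> ennreal (K powr p) * (ennreal C * (\<integral>\<^sup>+x. s x \<partial>?\<mu>))"
        unfolding s_def by (intro mult_left_mono main mu.locally_finite_line_axioms f) simp
      also have "\<dots> = ennreal (C * K powr p) * (\<integral>\<^sup>+x. s x \<partial>?\<mu>)"
        using C by (simp add: ennreal_mult mult_ac)
      finally show ?thesis
        by (simp add: nn_integral_density mult.commute)
    qed
    then show "(\<integral>\<^sup>+x. enn_powr (\<Sum>k. enn_powr (maximal_fun lborel (f k) x) r) (p / r) * w x \<partial>lborel)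
     \<le> ennreal (C * K powr p) * (\<integral>\<^sup>+x. enn_powr (\<Sum>k. enn_powr (f k x) r) (p / r) * w x \<partial>lborel)"
      unfolding s_def S_def .
  qed
qed

section \<open>Slices in the last variable\<close>

lemma subst_last_eq: "subst_last x y = x + (y - x $ Max UNIV) *\<^sub>R axis (Max UNIV) 1"
  by (auto simp: subst_last_def vec_eq_iff axis_def)

lemma subst_last_subst_last [simp]: "subst_last (subst_last x y) t = subst_last x t"
  by (auto simp: subst_last_def vec_eq_iff)

lemma subst_last_nth_last [simp]: "subst_last x y $ Max UNIV = y"
  by (simp add: subst_last_def)

lemma measurable_subst_last [measurable (raw)]:
  assumes [measurable]: "f \<in> borel_measurable M" "g \<in> borel_measurable M"
  shows "(\<lambda>x. subst_last (f x) (g x)) \<in> borel_measurable M"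
proof -
  have [measurable]: "(\<lambda>x. f x $ Max UNIV) \<in> borel_measurable M"
    unfolding cart_eq_inner_axis by measurable
  show ?thesis unfolding subst_last_eq by measurable
qed

text \<open>
  Tonelli's theorem with the last coordinate split off.  The measure \<open>Z\<close> lives on the hyperplane where the
  last coordinate vanishes; keeping it on the full space treats dimension one like any other.
\<close>

lemma lborel_slices:
  obtains Z :: "(real ^ ('n::{finite,linorder})) measure" where "sets Z = sets borel"
    "\<And>G. G \<in> borel_measurable borel \<Longrightarrow>
      (\<integral>\<^sup>+x. G x \<partial>lborel) = (\<integral>\<^sup>+z. (\<integral>\<^sup>+y. G (subst_last z y) \<partial>lborel) \<partial>Z)"
proof -
  let ?e = "axis (Max UNIV) 1 :: real ^ ('n::{finite,linorder})"
  let ?I = "Basis - {?e}"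
  have e: "?e \<in> Basis" by (simp add: axis_in_Basis_iff)
  interpret product_sigma_finite "\<lambda>_ :: real ^ ('n::{finite,linorder}). lborel :: real measure" ..
  define E where "E z = (\<Sum>b\<in>?I. z b *\<^sub>R b)" for z :: "real ^ ('n::{finite,linorder}) \<Rightarrow> real"
  define Z where "Z = distr (\<Pi>\<^sub>M b\<in>?I. lborel) borel E"
  have E_meas [measurable]: "E \<in> measurable (\<Pi>\<^sub>M b\<in>?I. lborel) borel"
    unfolding E_def by measurable
  have E_last: "E z $ Max UNIV = 0" for z
  proof -
    have "E z $ Max UNIV = (\<Sum>b\<in>?I. z b * (b \<bullet> ?e))"
      by (simp add: E_def cart_eq_inner_axis inner_sum_left)
    also have "\<dots> = 0"
      using e by (intro sum.neutral) (auto simp: inner_Basis)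
    finally show ?thesis .
  qed
  have split: "(\<Sum>b\<in>Basis. (z(?e := y)) b *\<^sub>R b) = subst_last (E z) y" for z y
  proof -
    have "(\<Sum>b\<in>Basis. (z(?e := y)) b *\<^sub>R b) = y *\<^sub>R ?e + (\<Sum>b\<in>?I. (z(?e := y)) b *\<^sub>R b)"
      using e by (subst sum.remove[of _ ?e]) auto
    also have "(\<Sum>b\<in>?I. (z(?e := y)) b *\<^sub>R b) = E z"
      unfolding E_def by (intro sum.cong) auto
    finally show ?thesis by (simp add: subst_last_eq E_last)
  qed
  show thesis
  proof (rule that)
    show "sets Z = sets borel" by (simp add: Z_def)
    fix G :: "real ^ ('n::{finite,linorder}) \<Rightarrow> ennreal" assume [measurable]: "G \<in> borel_measurable borel"
    have "(\<integral>\<^sup>+x. G x \<partial>lborel) = (\<integral>\<^sup>+z. G (\<Sum>b\<in>Basis. z b *\<^sub>R b) \<partial>(\<Pi>\<^sub>M b\<in>Basis. lborel))"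
      by (subst lborel_eq, subst nn_integral_distr) measurable
    also have "Basis = insert ?e ?I" using e by auto
    also have "(\<integral>\<^sup>+z. G (\<Sum>b\<in>insert ?e ?I. z b *\<^sub>R b) \<partial>(\<Pi>\<^sub>M b\<in>insert ?e ?I. lborel))
        = (\<integral>\<^sup>+z. (\<integral>\<^sup>+y. G (\<Sum>b\<in>insert ?e ?I. (z(?e := y)) b *\<^sub>R b) \<partial>lborel) \<partial>(\<Pi>\<^sub>M b\<in>?I. lborel))"
      by (rule product_nn_integral_insert) (auto, measurable)
    also have "insert ?e ?I = Basis" using e by auto
    also have "(\<integral>\<^sup>+z. (\<integral>\<^sup>+y. G (\<Sum>b\<in>Basis. (z(?e := y)) b *\<^sub>R b) \<partial>lborel) \<partial>(\<Pi>\<^sub>M b\<in>?I. lborel))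
        = (\<integral>\<^sup>+z. (\<integral>\<^sup>+y. G (subst_last z y) \<partial>lborel) \<partial>Z)"
      unfolding split Z_def by (subst nn_integral_distr) measurable
    finally show "(\<integral>\<^sup>+x. G x \<partial>lborel) = (\<integral>\<^sup>+z. (\<integral>\<^sup>+y. G (subst_last z y) \<partial>lborel) \<partial>Z)" .
  qed
qed

lemma AE_slices:
  fixes P :: "real ^ ('n::{finite,linorder}) \<Rightarrow> bool"
  assumes "AE x in lborel. P x"
  shows "AE x in lborel. AE y in lborel. P (subst_last x y)"
proof -
  obtain Z :: "(real ^ ('n::{finite,linorder})) measure" where Z [measurable_cong]: "sets Z = sets borel"
    and slice: "\<And>G. G \<in> borel_measurable borel \<Longrightarrow>
      (\<integral>\<^sup>+x. G x \<partial>lborel) = (\<integral>\<^sup>+z. (\<integral>\<^sup>+y. G (subst_last z y) \<partial>lborel) \<partial>Z)"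
    by (fact lborel_slices)
  obtain N where N: "{x. \<not> P x} \<subseteq> N" "N \<in> null_sets lborel"
    using assms by (auto elim!: AE_E simp: null_sets_def)
  have [measurable]: "N \<in> sets borel" using N(2) by auto
  define G where "G x = (\<integral>\<^sup>+y. indicator N (subst_last x y) \<partial>lborel)" for x :: "real ^ ('n::{finite,linorder})"
  have [measurable]: "G \<in> borel_measurable borel"
    unfolding G_def by measurable
  have "(\<integral>\<^sup>+z. G z \<partial>Z) = (\<integral>\<^sup>+x. indicator N x \<partial>lborel)"
    unfolding G_def by (rule slice[symmetric]) measurable
  also have "\<dots> = 0" using N(2) by (simp add: null_sets_def)
  finally have "AE z in Z. G z = 0"
    by (subst (asm) nn_integral_0_iff_AE) measurable
  then have "(\<integral>\<^sup>+z. (\<integral>\<^sup>+y. G (subst_last z y) \<partial>lborel) \<partial>Z) = (\<integral>\<^sup>+z. 0 \<partial>Z)"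
    by (intro nn_integral_cong_AE) (auto elim!: eventually_mono simp: G_def)
  then have "(\<integral>\<^sup>+x. G x \<partial>lborel) = 0"
    by (subst slice) simp_all
  then have "AE x in lborel. G x = 0"
    by (subst (asm) nn_integral_0_iff_AE) measurable
  then show ?thesis
  proof (rule eventually_mono)
    fix x assume "G x = 0"
    then have "AE y in lborel. (indicator N (subst_last x y) :: ennreal) = 0"
      unfolding G_def by (subst (asm) nn_integral_0_iff_AE) measurable
    then show "AE y in lborel. P (subst_last x y)"
      by (rule eventually_mono) (use N(1) in \<open>auto simp: indicator_def split: if_splits\<close>)
  qed
qed

definition maximal_slice ::
    "(real ^ ('n::{finite,linorder}) \<Rightarrow> ennreal) \<Rightarrow> real ^ ('n::{finite,linorder}) \<Rightarrow> ennreal" where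
  "maximal_slice g x = maximal_fun lborel (\<lambda>y. g (subst_last x y)) (x $ Max UNIV)"

lemma maximal_slice_subst_last:
  "maximal_slice g (subst_last z y) = maximal_fun lborel (\<lambda>t. g (subst_last z t)) y"
  by (simp add: maximal_slice_def)

text \<open>
  Intervals with rational endpoints suffice: exhaust \<open>(a, b)\<close> by intervals \<open>A n\<close> containing \<open>x\<close>, and put a
  rational interval between \<open>A n\<close> and \<open>(a, b)\<close>.  Joint measurability in all variables rests on
  this, because the supremum becomes countable.
\<close>

lemma maximal_fun_lborel_rational:
  assumes [measurable]: "f \<in> borel_measurable borel"
  shows "maximal_fun lborel f x = (SUP (a, b) \<in> \<rat> \<times> \<rat>. if x \<in> {a<..<b}
     then (\<integral>\<^sup>+y\<in>{a<..<b}. f y \<partial>lborel) / ennreal (b - a) else 0)" (is "_ = ?R")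
proof (rule antisym)
  show "?R \<le> maximal_fun lborel f x"
  proof (rule SUP_least, safe)
    fix a b :: real
    show "(if x \<in> {a<..<b} then (\<integral>\<^sup>+y\<in>{a<..<b}. f y \<partial>lborel) / ennreal (b - a) else 0) \<le> maximal_fun lborel f x"
      using maximal_fun_upper[of x a b lborel f] by (cases "x \<in> {a<..<b}") simp_all
  qed
  show "maximal_fun lborel f x \<le> ?R"
  proof (rule maximal_fun_least)
    fix a b assume x: "x \<in> {a<..<b}"
    define A where "A n = {a + (x - a) / real (n + 2)<..<b - (b - x) / real (n + 2)}" for n :: nat
    have inc: "incseq A"
      unfolding A_def incseq_def using x
      by (intro allI impI greaterThanLessThan_subseteq_greaterThanLessThan[THEN iffD2])
         (auto intro!: divide_left_mono)
    have UN: "(\<Union>n. A n) = {a<..<b}"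
    proof (intro equalityI subsetI)
      fix y assume "y \<in> (\<Union>n. A n)"
      then obtain n where y: "a + (x - a) / real (n + 2) < y" "y < b - (b - x) / real (n + 2)"
        by (auto simp: A_def)
      moreover have "0 \<le> (x - a) / real (n + 2)" "0 \<le> (b - x) / real (n + 2)" using x by auto
      ultimately show "y \<in> {a<..<b}" by auto
    next
      fix y assume y: "y \<in> {a<..<b}"
      have "(\<lambda>n. c / real (n + 2)) \<longlonglongrightarrow> 0" for c
        by (rule LIMSEQ_ignore_initial_segment[OF lim_const_over_n])
      then have "(\<lambda>n. a + (x - a) / real (n + 2)) \<longlonglongrightarrow> a + 0" "(\<lambda>n. b - (b - x) / real (n + 2)) \<longlonglongrightarrow> b - 0"
        by (intro tendsto_intros; blast)+
      then have "\<forall>\<^sub>F n in sequentially. a + (x - a) / real (n + 2) < y"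
        "\<forall>\<^sub>F n in sequentially. y < b - (b - x) / real (n + 2)"
        using y by (auto dest: order_tendstoD)
      then have "\<forall>\<^sub>F n in sequentially. y \<in> A n" by eventually_elim (auto simp: A_def)
      then show "y \<in> (\<Union>n. A n)" by (auto simp: eventually_sequentially)
    qed
    have em: "emeasure (density lborel f) B = (\<integral>\<^sup>+y\<in>B. f y \<partial>lborel)" if "B \<in> sets borel" for B
      using that by (intro emeasure_density) auto
    have "(SUP n. emeasure (density lborel f) (A n)) = emeasure (density lborel f) (\<Union>n. A n)"
      by (rule SUP_emeasure_incseq[OF _ inc]) (auto simp: A_def)
    then have "(SUP n. (\<integral>\<^sup>+y\<in>A n. f y \<partial>lborel)) = (\<integral>\<^sup>+y\<in>{a<..<b}. f y \<partial>lborel)"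
      unfolding UN by (simp add: em A_def)
    then have "(\<integral>\<^sup>+y\<in>{a<..<b}. f y \<partial>lborel) / ennreal (b - a) = (SUP n. (\<integral>\<^sup>+y\<in>A n. f y \<partial>lborel) / ennreal (b - a))"
      by (simp only: SUP_divide_ennreal[symmetric])
    also have "\<dots> \<le> ?R"
    proof (rule SUP_least)
      fix n :: nat
      have 1: "a < a + (x - a) / real (n + 2)" "b - (b - x) / real (n + 2) < b" using x by auto
      have "(x - a) / real (n + 2) < (x - a) / 1" "(b - x) / real (n + 2) < (b - x) / 1"
        using x by (intro divide_strict_left_mono; simp)+
      then have 2: "a + (x - a) / real (n + 2) < x" "x < b - (b - x) / real (n + 2)" by auto
      obtain a' where a': "a' \<in> \<rat>" "a < a'" "a' < a + (x - a) / real (n + 2)" using Rats_dense_in_real[OF 1(1)] by blast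
      obtain b' where b': "b' \<in> \<rat>" "b - (b - x) / real (n + 2) < b'" "b' < b" using Rats_dense_in_real[OF 1(2)] by blast
      have "(\<integral>\<^sup>+y\<in>A n. f y \<partial>lborel) / ennreal (b - a) \<le> (\<integral>\<^sup>+y\<in>{a'<..<b'}. f y \<partial>lborel) / ennreal (b' - a')"
      proof (rule order_trans[OF divide_right_mono_ennreal])
        show "(\<integral>\<^sup>+y\<in>A n. f y \<partial>lborel) \<le> (\<integral>\<^sup>+y\<in>{a'<..<b'}. f y \<partial>lborel)"
          using a' b' unfolding A_def by (intro nn_set_integral_set_mono) auto
        have "b' - a' \<le> b - a" "0 < b' - a'" using a' b' 2 by simp_all
        then have "inverse (ennreal (b - a)) \<le> inverse (ennreal (b' - a'))"
          by (simp add: inverse_ennreal ennreal_leI le_imp_inverse_le)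
        then show "(\<integral>\<^sup>+y\<in>{a'<..<b'}. f y \<partial>lborel) / ennreal (b - a) \<le> (\<integral>\<^sup>+y\<in>{a'<..<b'}. f y \<partial>lborel) / ennreal (b' - a')"
          unfolding divide_ennreal_def by (rule mult_left_mono) simp
      qed
      also have "\<dots> \<le> ?R"
        by (rule SUP_upper2[of "(a', b')"]) (use a' b' 2 in auto)
      finally show "(\<integral>\<^sup>+y\<in>A n. f y \<partial>lborel) / ennreal (b - a) \<le> ?R" .
    qed
    finally show "(\<integral>\<^sup>+y\<in>{a<..<b}. f y \<partial>lborel) / emeasure lborel {a<..<b} \<le> ?R"
      using x by simp
  qed
qed

lemma maximal_slice_measurable [measurable]:
  assumes [measurable]: "g \<in> borel_measurable borel"
  shows "maximal_slice g \<in> borel_measurable borel"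
proof -
  have "(\<lambda>x. SUP (a, b) \<in> \<rat> \<times> \<rat>. if x $ Max UNIV \<in> {a<..<b}
     then (\<integral>\<^sup>+y\<in>{a<..<b}. g (subst_last x y) \<partial>lborel) / ennreal (b - a) else 0) \<in> borel_measurable borel"
    unfolding case_prod_unfold
    by (rule borel_measurable_SUP) (simp add: countable_rat, measurable)
  moreover have "maximal_slice g x = (SUP (a, b) \<in> \<rat> \<times> \<rat>. if x $ Max UNIV \<in> {a<..<b}
     then (\<integral>\<^sup>+y\<in>{a<..<b}. g (subst_last x y) \<partial>lborel) / ennreal (b - a) else 0)" for x
    unfolding maximal_slice_def by (rule maximal_fun_lborel_rational) measurable
  ultimately show ?thesis by (simp cong: measurable_cong)
qed

text \<open>
  The one-dimensional theorem applies on every line parallel to the last axis with the same constant,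
  so it can be integrated over the lines.
\<close>

theorem vector_valued_maximal_slice_weighted:
  assumes r: "1 < r" and p: "1 < p"
  obtains C :: real where "0 < C"
    "\<And>K w f. 0 < K \<Longrightarrow> w \<in> borel_measurable borel \<Longrightarrow>
      (\<And>x. maximal_slice w x \<le> ennreal K * w x) \<Longrightarrow>
      (\<And>k::nat. f k \<in> borel_measurable borel) \<Longrightarrow>
      (\<integral>\<^sup>+x. enn_powr (\<Sum>k. enn_powr (maximal_slice (f k) x) r) (p / r) * w x \<partial>lborel)
     \<le> ennreal (C * K powr p) * (\<integral>\<^sup>+x. enn_powr (\<Sum>k. enn_powr (f k x) r) (p / r) * w (x :: real ^ ('n::{finite,linorder})) \<partial>lborel)"
proof -
  obtain C :: real where C: "0 < C" and line:
    "\<And>K w f. 0 < K \<Longrightarrow> w \<in> borel_measurable borel \<Longrightarrow>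
      (\<And>x. maximal_fun lborel w x \<le> ennreal K * w x) \<Longrightarrow>
      (\<And>k::nat. f k \<in> borel_measurable borel) \<Longrightarrow>
      (\<integral>\<^sup>+x. enn_powr (\<Sum>k. enn_powr (maximal_fun lborel (f k) x) r) (p / r) * w x \<partial>lborel)
     \<le> ennreal (C * K powr p) * (\<integral>\<^sup>+x. enn_powr (\<Sum>k. enn_powr (f k x) r) (p / r) * w x \<partial>lborel)"
    by (fact vector_valued_maximal_weighted_line[OF r p])
  obtain Z :: "(real ^ ('n::{finite,linorder})) measure" where Z [measurable_cong]: "sets Z = sets borel"
    and slice: "\<And>G. G \<in> borel_measurable borel \<Longrightarrow>
      (\<integral>\<^sup>+x. G x \<partial>lborel) = (\<integral>\<^sup>+z. (\<integral>\<^sup>+y. G (subst_last z y) \<partial>lborel) \<partial>Z)"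
    by (fact lborel_slices)
  show thesis
  proof (rule that[OF C])
    fix K :: real and w :: "real ^ ('n::{finite,linorder}) \<Rightarrow> ennreal" and f :: "nat \<Rightarrow> real ^ ('n::{finite,linorder}) \<Rightarrow> ennreal"
    assume K: "0 < K" and w [measurable]: "w \<in> borel_measurable borel"
      and A1: "\<And>x. maximal_slice w x \<le> ennreal K * w x"
      and f [measurable]: "\<And>k. f k \<in> borel_measurable borel"
    have "(\<integral>\<^sup>+x. enn_powr (\<Sum>k. enn_powr (maximal_slice (f k) x) r) (p / r) * w x \<partial>lborel)
       = (\<integral>\<^sup>+z. (\<integral>\<^sup>+y. enn_powr (\<Sum>k. enn_powr (maximal_fun lborel (\<lambda>t. f k (subst_last z t)) y) r) (p / r) * w (subst_last z y) \<partial>lborel) \<partial>Z)"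
      by (subst slice) (measurable, simp only: maximal_slice_subst_last)
    also have "\<dots> \<le> (\<integral>\<^sup>+z. ennreal (C * K powr p) *
        (\<integral>\<^sup>+y. enn_powr (\<Sum>k. enn_powr (f k (subst_last z y)) r) (p / r) * w (subst_last z y) \<partial>lborel) \<partial>Z)"
    proof (intro nn_integral_mono line K)
      show "maximal_fun lborel (\<lambda>y. w (subst_last z y)) y \<le> ennreal K * w (subst_last z y)" for z y
        using A1[of "subst_last z y"] by (simp add: maximal_slice_subst_last)
    qed measurable
    also have "\<dots> = ennreal (C * K powr p) *
        (\<integral>\<^sup>+z. (\<integral>\<^sup>+y. enn_powr (\<Sum>k. enn_powr (f k (subst_last z y)) r) (p / r) * w (subst_last z y) \<partial>lborel) \<partial>Z)"
      by (rule nn_integral_cmult) measurable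
    also have "\<dots> = ennreal (C * K powr p) * (\<integral>\<^sup>+x. enn_powr (\<Sum>k. enn_powr (f k x) r) (p / r) * w x \<partial>lborel)"
      by (subst slice) (measurable)
    finally show "(\<integral>\<^sup>+x. enn_powr (\<Sum>k. enn_powr (maximal_slice (f k) x) r) (p / r) * w x \<partial>lborel)
     \<le> ennreal (C * K powr p) * (\<integral>\<^sup>+x. enn_powr (\<Sum>k. enn_powr (f k x) r) (p / r) * w x \<partial>lborel)" .
  qed
qed

section \<open>The Lorentz--Luxemburg theorem\<close>

text \<open>
  A Banach function norm is determined by its values at nonnegative functions.  The exhaustion \<open>B\<close> plays
  the role of the balls.
\<close>

locale Banach_function_norm =
  fixes M :: "'a measure" and N :: "('a \<Rightarrow> ennreal) \<Rightarrow> ennreal" and B :: "nat \<Rightarrow> 'a set"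
  assumes norm_mono: "\<And>u v. u \<in> borel_measurable M \<Longrightarrow> v \<in> borel_measurable M \<Longrightarrow>
      (AE x in M. u x \<le> v x) \<Longrightarrow> N u \<le> N v"
    and norm_Fatou: "\<And>F u t. (\<And>m::nat. F m \<in> borel_measurable M) \<Longrightarrow> u \<in> borel_measurable M \<Longrightarrow>
      (AE x in M. incseq (\<lambda>m. F m x) \<and> (\<lambda>m. F m x) \<longlonglongrightarrow> u x) \<Longrightarrow> (\<And>m. N (F m) \<le> t) \<Longrightarrow> N u \<le> t"
    and norm_scale: "\<And>u c. u \<in> borel_measurable M \<Longrightarrow> N u < \<infinity> \<Longrightarrow> 0 \<le> c \<Longrightarrow>
      N (\<lambda>x. ennreal c * u x) = ennreal c * N u"
    and norm_add: "\<And>u v. u \<in> borel_measurable M \<Longrightarrow> v \<in> borel_measurable M \<Longrightarrow> N u < \<infinity> \<Longrightarrow> N v < \<infinity> \<Longrightarrow>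
      N (\<lambda>x. u x + v x) \<le> N u + N v"
    and B_sets: "\<And>n. B n \<in> sets M" and B_inc: "incseq B" and B_UN: "(\<Union>n. B n) = UNIV"
    and B_fin: "\<And>n. emeasure M (B n) < \<infinity>" and B_norm: "\<And>n. N (indicator (B n)) < \<infinity>"
begin

lemmas [measurable] = B_sets

lemma integrable_dominated_by_indicator:
  assumes "f \<in> borel_measurable M" "\<And>x. \<bar>f x\<bar> \<le> c * indicator (B n) x"
  shows "integrable M (f :: 'a \<Rightarrow> real)"
proof (rule integrableI_bounded_set)
  show "AE x in M. x \<in> B n \<longrightarrow> norm (f x) \<le> c"
  proof (intro AE_I2 impI)
    fix x assume "x \<in> B n" then show "norm (f x) \<le> c" using assms(2)[of x] by simp
  qed
  show "AE x in M. x \<notin> B n \<longrightarrow> f x = 0"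
  proof (intro AE_I2 impI)
    fix x assume "x \<notin> B n" then show "f x = 0" using assms(2)[of x] by simp
  qed
qed (use assms B_fin in \<open>auto simp: B_sets\<close>)

lemma norm_convex:
  assumes [measurable]: "u \<in> borel_measurable M" "v \<in> borel_measurable M"
    and "\<And>x. 0 \<le> u x" "\<And>x. 0 \<le> v x" "N (\<lambda>x. ennreal (u x)) \<le> ennreal t" "N (\<lambda>x. ennreal (v x)) \<le> ennreal t"
    and e: "0 \<le> e" "e \<le> 1" and t: "0 \<le> t"
  shows "N (\<lambda>x. ennreal ((1 - e) * u x + e * v x)) \<le> ennreal t"
proof -
  let ?u = "\<lambda>x. ennreal (u x)" and ?v = "\<lambda>x. ennreal (v x)"
  have fin: "N ?u < \<infinity>" "N ?v < \<infinity>" using assms(5,6) by (auto intro: order_le_less_trans)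
  have eq: "N (\<lambda>x. ennreal (1 - e) * ?u x) = ennreal (1 - e) * N ?u" "N (\<lambda>x. ennreal e * ?v x) = ennreal e * N ?v"
    using e fin by (auto intro!: norm_scale)
  have "N (\<lambda>x. ennreal ((1 - e) * u x + e * v x)) = N (\<lambda>x. ennreal (1 - e) * ?u x + ennreal e * ?v x)"
    using e assms(3,4) by (simp add: ennreal_mult ennreal_plus)
  also have "\<dots> \<le> N (\<lambda>x. ennreal (1 - e) * ?u x) + N (\<lambda>x. ennreal e * ?v x)"
    by (rule norm_add) (measurable, use fin in \<open>auto simp: eq ennreal_mult_less_top\<close>)
  also have "\<dots> \<le> ennreal (1 - e) * ennreal t + ennreal e * ennreal t"
    unfolding eq by (intro add_mono mult_left_mono assms(5,6)) simp_all
  also have "\<dots> = ennreal ((1 - e) * t + e * t)"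
    using e t by (simp add: ennreal_mult ennreal_plus)
  finally show ?thesis by (simp add: algebra_simps)
qed

definition admissible :: "('a \<Rightarrow> real) \<Rightarrow> real \<Rightarrow> ('a \<Rightarrow> real) set" where
  "admissible \<phi> t = {u \<in> borel_measurable M. (\<forall>x. 0 \<le> u x \<and> u x \<le> \<phi> x) \<and> N (\<lambda>x. ennreal (u x)) \<le> ennreal t}"

text \<open>
  For bounded \<open>\<phi>\<close> supported in \<open>B n\<close> the projection onto the ball of radius \<open>t\<close> with respect to the
  \<open>L\<^sup>2\<close> distance exists.  By the parallelogram law a minimising sequence whose distances converge fast has
  summable differences, so it converges almost everywhere; the Fatou property keeps the limit in the ball, and dominated
  convergence carries the distance over.  Functions not below \<open>\<phi>\<close> can be ignored because replacing them by
  their minimum with \<open>\<phi>\<close> increases neither the norm nor the distance.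
\<close>

lemma nearest_point:
  assumes [measurable]: "\<phi> \<in> borel_measurable M" and \<phi>: "\<And>x. 0 \<le> \<phi> x" "\<And>x. \<phi> x \<le> c * indicator (B n) x"
    and t: "0 \<le> t"
  obtains u where "u \<in> admissible \<phi> t" "\<And>u'. u' \<in> admissible \<phi> t \<Longrightarrow> (\<integral>x. (\<phi> x - u x)\<^sup>2 \<partial>M) \<le> (\<integral>x. (\<phi> x - u' x)\<^sup>2 \<partial>M)"
proof -
  define D where "D u = (\<integral>x. (\<phi> x - u x)\<^sup>2 \<partial>M)" for u
  define d where "d = Inf (D ` admissible \<phi> t)"
  have sq_bound: "(a - b)\<^sup>2 \<le> c\<^sup>2 * indicator (B n) x" if "0 \<le> a" "a \<le> \<phi> x" "0 \<le> b" "b \<le> \<phi> x" for a b x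
  proof (cases "x \<in> B n")
    case True
    have "\<bar>a - b\<bar> \<le> \<bar>c\<bar>" using that \<phi>(2)[of x] True by auto
    then show ?thesis using True abs_le_square_iff by fastforce
  next
    case False
    then show ?thesis using that \<phi>(1)[of x] \<phi>(2)[of x] by simp
  qed
  have Kd [measurable_dest]: "u \<in> borel_measurable M" if "u \<in> admissible \<phi> t" for u
    using that by (simp add: admissible_def)
  have Kb: "0 \<le> u x" "u x \<le> \<phi> x" if "u \<in> admissible \<phi> t" for u x
    using that by (simp_all add: admissible_def)
  have int: "integrable M (\<lambda>x. (u x - v x)\<^sup>2)"
    if "u \<in> borel_measurable M" "v \<in> borel_measurable M" "\<And>x. 0 \<le> u x" "\<And>x. u x \<le> \<phi> x" "\<And>x. 0 \<le> v x" "\<And>x. v x \<le> \<phi> x" for u v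
  proof (rule integrable_dominated_by_indicator[of _ "c\<^sup>2" n])
    show "(\<lambda>x. (u x - v x)\<^sup>2) \<in> borel_measurable M" using that(1,2) by measurable
    show "\<bar>(u x - v x)\<^sup>2\<bar> \<le> c\<^sup>2 * indicator (B n) x" for x
      using sq_bound[OF that(3-6)] by simp
  qed
  have zero: "(\<lambda>_. 0) \<in> admissible \<phi> t"
    using \<phi>(1) norm_scale[of "indicator (B n)" 0] B_norm[of n] by (simp add: admissible_def)
  have bdd: "bdd_below (D ` admissible \<phi> t)"
    by (intro bdd_belowI[of _ 0]) (auto simp: D_def)
  have d_le: "d \<le> D u" if "u \<in> admissible \<phi> t" for u
    unfolding d_def using that bdd by (intro cInf_lower) auto
  have "\<exists>u\<in>admissible \<phi> t. D u < d + (1 / 8) ^ k" for k :: nat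
  proof -
    have "Inf (D ` admissible \<phi> t) < d + (1 / 8) ^ k" by (simp add: d_def)
    with cInf_lessD[of "D ` admissible \<phi> t"] zero show ?thesis by blast
  qed
  then obtain u where uK: "\<And>k. u k \<in> admissible \<phi> t" and uD: "\<And>k. D (u k) < d + (1 / 8) ^ k"
    by metis
  note u_meas [measurable] = Kd[OF uK]
  have par: "(\<integral>x. (u (Suc k) x - u k x)\<^sup>2 \<partial>M) \<le> 4 * (1 / 8) ^ k" for k
  proof -
    define m where "m x = (1 - 1 / 2) * u k x + 1 / 2 * u (Suc k) x" for x
    have mK: "m \<in> admissible \<phi> t"
    proof -
      have "m \<in> borel_measurable M" unfolding m_def by measurable
      moreover have "0 \<le> m x" "m x \<le> \<phi> x" for x
        using Kb[OF uK, of k x] Kb[OF uK, of "Suc k" x] by (auto simp: m_def)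
      moreover have "N (\<lambda>x. ennreal (m x)) \<le> ennreal t"
        unfolding m_def using uK[of k] uK[of "Suc k"] t
        by (intro norm_convex) (auto simp: admissible_def)
      ultimately show ?thesis by (simp add: admissible_def)
    qed
    have "(\<integral>x. (u (Suc k) x - u k x)\<^sup>2 \<partial>M) = (\<integral>x. 2 * (\<phi> x - u k x)\<^sup>2 + 2 * (\<phi> x - u (Suc k) x)\<^sup>2 - 4 * (\<phi> x - m x)\<^sup>2 \<partial>M)"
      by (intro Bochner_Integration.integral_cong refl) (simp add: m_def power2_eq_square field_simps)
    also have "\<dots> = 2 * D (u k) + 2 * D (u (Suc k)) - 4 * D m"
    proof -
      have "integrable M (\<lambda>x. (\<phi> x - v x)\<^sup>2)" if "v \<in> admissible \<phi> t" for v
        by (rule int[OF assms(1) Kd[OF that] \<phi>(1) order_refl Kb[OF that]])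
      from this[OF uK[of k]] this[OF uK[of "Suc k"]] this[OF mK] show ?thesis
        by (simp add: D_def)
    qed
    also have "\<dots> \<le> 4 * (1 / 8) ^ k"
      using uD[of k] uD[of "Suc k"] d_le[OF mK] zero_le_power[of "1 / 8 :: real" k] by (simp del: zero_le_power)
    finally show ?thesis .
  qed
  have "(\<integral>\<^sup>+x. (\<Sum>k. ennreal \<bar>u (Suc k) x - u k x\<bar>) \<partial>M) = (\<Sum>k. \<integral>\<^sup>+x. ennreal \<bar>u (Suc k) x - u k x\<bar> \<partial>M)"
    by (rule nn_integral_suminf) measurable
  also have "\<dots> \<le> (\<Sum>k. ennreal ((1 / 2) ^ k) * (emeasure M (B n) + 4))"
  proof (intro suminf_le)
    fix k
    let ?\<Delta> = "\<lambda>x. u (Suc k) x - u k x"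
    let ?d = "\<integral>x. (?\<Delta> x)\<^sup>2 \<partial>M"
    \<comment> \<open>In place of the Cauchy--Schwarz inequality: \<open>\<bar>\<Delta>\<bar>\<close> is at most \<open>2^(-k)\<close> or at most \<open>2\<^sup>k \<Delta>\<^sup>2\<close>.\<close>
    have "(\<integral>\<^sup>+x. ennreal \<bar>?\<Delta> x\<bar> \<partial>M) \<le> (\<integral>\<^sup>+x. ennreal ((1 / 2) ^ k) * indicator (B n) x + ennreal (2 ^ k) * ennreal ((?\<Delta> x)\<^sup>2) \<partial>M)"
    proof (rule nn_integral_mono)
      fix x
      have "\<bar>?\<Delta> x\<bar> \<le> (1 / 2) ^ k * indicator (B n) x + 2 ^ k * (?\<Delta> x)\<^sup>2"
      proof (cases "x \<in> B n")
        case True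
        show ?thesis
        proof (cases "\<bar>?\<Delta> x\<bar> \<le> (1 / 2) ^ k")
          case small: True
          moreover have "0 \<le> 2 ^ k * (?\<Delta> x)\<^sup>2" by simp
          ultimately show ?thesis using True by (simp only: indicator_simps mult_1_right)
        next
          case False
          have "1 = 2 ^ k * (1 / 2 :: real) ^ k" by (simp add: power_one_over)
          also have "\<dots> \<le> 2 ^ k * \<bar>?\<Delta> x\<bar>" using False by (intro mult_left_mono) auto
          finally have "1 * \<bar>?\<Delta> x\<bar> \<le> 2 ^ k * \<bar>?\<Delta> x\<bar> * \<bar>?\<Delta> x\<bar>" by (intro mult_right_mono) auto
          then have "\<bar>?\<Delta> x\<bar> \<le> 2 ^ k * (?\<Delta> x)\<^sup>2"
            by (simp add: power2_eq_square mult.assoc)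
          moreover have "0 \<le> (1 / 2 :: real) ^ k" by simp
          ultimately show ?thesis using True by (simp only: indicator_simps mult_1_right)
        qed
      next
        case False
        then have "\<phi> x = 0" using \<phi>[of x] by simp
        then have "?\<Delta> x = 0" using Kb[OF uK, of "Suc k" x] Kb[OF uK, of k x] by simp
        then show ?thesis by simp
      qed
      then have "ennreal \<bar>?\<Delta> x\<bar> \<le> ennreal ((1 / 2) ^ k * indicator (B n) x + 2 ^ k * (?\<Delta> x)\<^sup>2)"
        by (rule ennreal_leI)
      also have "\<dots> = ennreal ((1 / 2) ^ k * indicator (B n) x) + ennreal (2 ^ k * (?\<Delta> x)\<^sup>2)"
        by (rule ennreal_plus) auto
      also have "\<dots> = ennreal ((1 / 2) ^ k) * indicator (B n) x + ennreal (2 ^ k) * ennreal ((?\<Delta> x)\<^sup>2)"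
        by (simp only: ennreal_mult' ennreal_mult'' ennreal_indicator zero_le_power2 zero_le_power zero_le_divide_1_iff zero_le_numeral)
      finally show "ennreal \<bar>?\<Delta> x\<bar> \<le> \<dots>" .
    qed
    also have "\<dots> = ennreal ((1 / 2) ^ k) * emeasure M (B n) + ennreal (2 ^ k) * (\<integral>\<^sup>+x. ennreal ((?\<Delta> x)\<^sup>2) \<partial>M)"
      by (subst nn_integral_add) (simp_all add: nn_integral_cmult nn_integral_cmult_indicator)
    also have "(\<integral>\<^sup>+x. ennreal ((?\<Delta> x)\<^sup>2) \<partial>M) = ennreal ?d"
      using Kb[OF uK] by (intro nn_integral_eq_integral int u_meas) auto
    also have "ennreal (2 ^ k) * ennreal ?d \<le> ennreal ((1 / 2) ^ k) * 4"
    proof -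
      have "2 ^ k * ?d \<le> 2 ^ k * (4 * (1 / 8) ^ k)" by (intro mult_left_mono par) auto
      also have "\<dots> = 4 * (1 / 4) ^ k" by (simp add: power_mult_distrib[symmetric])
      also have "\<dots> \<le> 4 * (1 / 2) ^ k" by (intro mult_left_mono power_mono) auto
      finally have "ennreal (2 ^ k * ?d) \<le> ennreal ((1 / 2) ^ k * 4)"
        by (intro ennreal_leI) (simp add: mult.commute)
      also have "ennreal ((1 / 2) ^ k * 4) = ennreal ((1 / 2) ^ k) * ennreal 4" by (rule ennreal_mult) auto
      also have "ennreal (2 ^ k * ?d) = ennreal (2 ^ k) * ennreal ?d"
        by (rule ennreal_mult) auto
      finally show ?thesis by simp
    qed
    finally show "(\<integral>\<^sup>+x. ennreal \<bar>?\<Delta> x\<bar> \<partial>M) \<le> ennreal ((1 / 2) ^ k) * (emeasure M (B n) + 4)"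
      by (simp add: distrib_left)
  qed auto
  also have "\<dots> = 2 * (emeasure M (B n) + 4)" by (rule suminf_half_powers)
  also have "\<dots> < \<infinity>" using B_fin[of n] by (simp add: ennreal_mult_less_top)
  finally have "AE x in M. (\<Sum>k. ennreal \<bar>u (Suc k) x - u k x\<bar>) \<noteq> \<infinity>"
    by (intro nn_integral_PInf_AE) auto
  then have conv: "AE x in M. convergent (\<lambda>k. u k x)"
  proof (rule eventually_mono)
    fix x assume "(\<Sum>k. ennreal \<bar>u (Suc k) x - u k x\<bar>) \<noteq> \<infinity>"
    then have "summable (\<lambda>k. \<bar>u (Suc k) x - u k x\<bar>)"
      by (intro summable_suminf_not_top) auto
    then have "summable (\<lambda>k. u (Suc k) x - u k x)"
      by (rule summable_rabs_cancel)
    from summable_LIMSEQ[OF this] have "(\<lambda>k. u k x - u 0 x) \<longlonglongrightarrow> (\<Sum>k. u (Suc k) x - u k x)"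
      by (simp only: sum_lessThan_telescope[of "\<lambda>k. u k x"])
    from tendsto_add[OF this tendsto_const[of "u 0 x"]] show "convergent (\<lambda>k. u k x)"
      by (auto simp: convergent_def)
  qed
  define w where "w x = max 0 (min (\<phi> x) (lim (\<lambda>k. u k x)))" for x
  have [measurable]: "w \<in> borel_measurable M" unfolding w_def by measurable
  have wb: "0 \<le> w x" "w x \<le> \<phi> x" for x using \<phi>(1)[of x] by (auto simp: w_def)
  have lim: "AE x in M. (\<lambda>k. u k x) \<longlonglongrightarrow> w x"
    using conv
  proof (rule eventually_mono)
    fix x assume "convergent (\<lambda>k. u k x)"
    then have l: "(\<lambda>k. u k x) \<longlonglongrightarrow> lim (\<lambda>k. u k x)" by (simp add: convergent_LIMSEQ_iff)
    have "0 \<le> lim (\<lambda>k. u k x)" by (rule LIMSEQ_le_const[OF l]) (use Kb(1)[OF uK] in auto)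
    moreover have "lim (\<lambda>k. u k x) \<le> \<phi> x" by (rule LIMSEQ_le_const2[OF l]) (use Kb(2)[OF uK] in auto)
    ultimately have "w x = lim (\<lambda>k. u k x)" by (simp add: w_def)
    with l show "(\<lambda>k. u k x) \<longlonglongrightarrow> w x" by simp
  qed
  let ?L = "\<lambda>m x. INF j\<in>{m..}. ennreal (u j x)"
  have INF_meas [measurable]: "(\<lambda>x. ?L m x) \<in> borel_measurable M" for m
    by (rule borel_measurable_INF) (auto intro: countableI_type)
  have "N (\<lambda>x. ennreal (w x)) \<le> ennreal t"
  proof (rule norm_Fatou[where F = "\<lambda>m x. ?L m x"])
    show "AE x in M. incseq (\<lambda>m. ?L m x) \<and> (\<lambda>m. ?L m x) \<longlonglongrightarrow> ennreal (w x)"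
      using lim
    proof (rule eventually_mono)
      fix x assume "(\<lambda>k. u k x) \<longlonglongrightarrow> w x"
      then have "(\<lambda>k. ennreal (u k x)) \<longlonglongrightarrow> ennreal (w x)" by (rule tendsto_ennrealI)
      then have "liminf (\<lambda>k. ennreal (u k x)) = ennreal (w x)" by (intro lim_imp_Liminf) simp_all
      moreover have inc: "incseq (\<lambda>m. ?L m x)"
        by (auto simp: incseq_def intro!: INF_superset_mono)
      ultimately show "incseq (\<lambda>m. ?L m x) \<and> (\<lambda>m. ?L m x) \<longlonglongrightarrow> ennreal (w x)"
        using LIMSEQ_SUP[OF inc] by (simp add: liminf_SUP_INF)
    qed
    fix m
    have "N (\<lambda>x. ?L m x) \<le> N (\<lambda>x. ennreal (u m x))"
      by (rule norm_mono[OF INF_meas]) (measurable, auto intro: INF_lower)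
    also have "\<dots> \<le> ennreal t" using uK[of m] by (simp add: admissible_def)
    finally show "N (\<lambda>x. ?L m x) \<le> ennreal t" .
  qed measurable
  then have wK: "w \<in> admissible \<phi> t" using wb by (simp add: admissible_def)
  have "(\<lambda>k. D (u k)) \<longlonglongrightarrow> D w"
    unfolding D_def
  proof (rule integral_dominated_convergence[where w = "\<lambda>x. c\<^sup>2 * indicator (B n) x"])
    show "integrable M (\<lambda>x. c\<^sup>2 * indicator (B n) x)"
      by (rule integrable_dominated_by_indicator[of _ "c\<^sup>2" n]) auto
    show "AE x in M. (\<lambda>k. (\<phi> x - u k x)\<^sup>2) \<longlonglongrightarrow> (\<phi> x - w x)\<^sup>2"
      using lim by (rule eventually_mono) (intro tendsto_intros)
    show "AE x in M. norm ((\<phi> x - u k x)\<^sup>2) \<le> c\<^sup>2 * indicator (B n) x" for k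
      using sq_bound[OF \<phi>(1) order_refl Kb[OF uK]] by (intro AE_I2) simp
  qed measurable
  moreover have "(\<lambda>k. D (u k)) \<longlonglongrightarrow> d"
  proof (rule tendsto_sandwich[of "\<lambda>_. d" _ _ "\<lambda>k. d + (1 / 8) ^ k"])
    have "(\<lambda>k. d + (1 / 8) ^ k) \<longlonglongrightarrow> d + 0"
      by (intro tendsto_intros LIMSEQ_power_zero) simp
    then show "(\<lambda>k. d + (1 / 8) ^ k) \<longlonglongrightarrow> d" by simp
    show "\<forall>\<^sub>F k in sequentially. D (u k) \<le> d + (1 / 8) ^ k" using uD by (simp add: less_imp_le)
  qed (use d_le[OF uK] in auto)
  ultimately have "D w = d" by (rule LIMSEQ_unique)
  then show thesis
    using that[OF wK] d_le unfolding D_def by simp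
qed

end

context Banach_function_norm
begin

lemma norm_large_truncation:
  assumes [measurable]: "\<Phi> \<in> borel_measurable M" and t: "ennreal t < N \<Phi>"
  obtains \<phi> n where "\<phi> \<in> borel_measurable M" "\<And>x. 0 \<le> \<phi> x" "\<And>x. \<phi> x \<le> real n * indicator (B n) x"
    "\<And>x. ennreal (\<phi> x) \<le> \<Phi> x" "ennreal t < N (\<lambda>x. ennreal (\<phi> x))"
proof -
  define F where "F n x = min (\<Phi> x) (of_nat n) * indicator (B n) x" for n :: nat and x
  have F_meas [measurable]: "F n \<in> borel_measurable M" for n
    unfolding F_def by measurable
  have conv: "incseq (\<lambda>n. F n x) \<and> (\<lambda>n. F n x) \<longlonglongrightarrow> \<Phi> x" for x
  proof
    show inc: "incseq (\<lambda>n. F n x)"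
      unfolding F_def by (rule incseq_truncations[OF B_inc])
    have "(SUP n. F n x) = \<Phi> x"
      unfolding F_def by (rule SUP_truncations[OF B_inc]) (simp add: B_UN)
    with LIMSEQ_SUP[OF inc] show "(\<lambda>n. F n x) \<longlonglongrightarrow> \<Phi> x" by simp
  qed
  have "\<exists>n. ennreal t < N (F n)"
  proof (rule ccontr)
    assume "\<nexists>n. ennreal t < N (F n)"
    then have "N \<Phi> \<le> ennreal t"
      using conv by (intro norm_Fatou[of F \<Phi>]) (auto simp: not_less)
    with t show False by simp
  qed
  then obtain n where n: "ennreal t < N (F n)" by blast
  have fin: "F n x \<le> of_nat n" for x by (simp add: F_def indicator_def)
  have F_real: "ennreal (enn2real (F n x)) = F n x" for x
    using order_le_less_trans[OF fin[of x] of_nat_less_top] by (intro ennreal_enn2real)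
  show thesis
  proof (rule that)
    show "(\<lambda>x. enn2real (F n x)) \<in> borel_measurable M" by measurable
    show "enn2real (F n x) \<le> real n * indicator (B n) x" for x
    proof (cases "x \<in> B n")
      case True
      have "enn2real (F n x) \<le> enn2real (of_nat n)" using fin[of x] by (intro enn2real_mono) (auto simp: of_nat_less_top)
      then show ?thesis using True by simp
    qed (simp add: F_def)
    show "ennreal (enn2real (F n x)) \<le> \<Phi> x" for x
      unfolding F_real by (simp add: F_def indicator_def)
    show "ennreal t < N (\<lambda>x. ennreal (enn2real (F n x)))" unfolding F_real by (rule n)
  qed simp
qed

text \<open>
  The separating functional is constructed without the Hahn--Banach theorem.  After truncation \<open>\<Phi>\<close> becomes a
  bounded \<open>\<phi>\<close> with norm above \<open>t\<close>.  Let \<open>u\<close> be its \<open>L\<^sup>2\<close>-nearest point in the ball of radius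
  \<open>t\<close>, and \<open>h = \<phi> - u \<ge> 0\<close>.  The variational inequality \<open>\<integral> h v \<le> \<integral> h u\<close> for all \<open>v\<close> in the ball shows that
  \<open>g = t h / c\<close> with \<open>c = \<integral> h u\<close> lies in the dual unit ball, whereas \<open>\<integral> h \<phi> = c + \<integral> h\<^sup>2 > c\<close>.
\<close>

theorem Lorentz_Luxemburg:
  assumes \<Phi> [measurable]: "\<Phi> \<in> borel_measurable M" and t: "0 < t" "ennreal t < N \<Phi>"
  obtains g where "g \<in> borel_measurable M"
    "\<And>v. v \<in> borel_measurable M \<Longrightarrow> N v \<le> 1 \<Longrightarrow> (\<integral>\<^sup>+x. v x * g x \<partial>M) \<le> 1"
    "ennreal t < (\<integral>\<^sup>+x. \<Phi> x * g x \<partial>M)"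
proof -
  obtain \<phi> n where \<phi>_meas [measurable]: "\<phi> \<in> borel_measurable M"
    and \<phi>: "\<And>x. 0 \<le> \<phi> x" "\<And>x. \<phi> x \<le> real n * indicator (B n) x"
    and \<phi>_le: "\<And>x. ennreal (\<phi> x) \<le> \<Phi> x" and N\<phi>: "ennreal t < N (\<lambda>x. ennreal (\<phi> x))"
    by (fact norm_large_truncation[OF \<Phi> t(2)])
  obtain u where uK: "u \<in> admissible \<phi> t"
    and u_min: "\<And>u'. u' \<in> admissible \<phi> t \<Longrightarrow> (\<integral>x. (\<phi> x - u x)\<^sup>2 \<partial>M) \<le> (\<integral>x. (\<phi> x - u' x)\<^sup>2 \<partial>M)"
    by (fact nearest_point[OF \<phi>_meas \<phi> less_imp_le[OF t(1)]])
  have u_meas [measurable]: "u \<in> borel_measurable M" and u: "\<And>x. 0 \<le> u x" "\<And>x. u x \<le> \<phi> x"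
    and Nu: "N (\<lambda>x. ennreal (u x)) \<le> ennreal t"
    using uK by (simp_all add: admissible_def)
  define h where "h x = \<phi> x - u x" for x
  have [measurable]: "h \<in> borel_measurable M" unfolding h_def by measurable
  have h: "0 \<le> h x" "h x \<le> real n * indicator (B n) x" for x
    using u[of x] \<phi>[of x] by (simp_all add: h_def)
  have u_B: "u x \<le> real n * indicator (B n) x" for x
    using u(2)[of x] \<phi>(2)[of x] by simp
  have prod_int: "integrable M (\<lambda>x. a x * b x)"
    if [measurable]: "a \<in> borel_measurable M" "b \<in> borel_measurable M"
      and "\<And>x. \<bar>a x\<bar> \<le> c * indicator (B n) x" "\<And>x. \<bar>b x\<bar> \<le> d * indicator (B n) x" for a b :: "'a \<Rightarrow> real" and c d
  proof (rule integrable_dominated_by_indicator[of _ "c * d" n])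
    fix x
    have "\<bar>a x * b x\<bar> \<le> (c * indicator (B n) x) * (d * indicator (B n) x)"
      unfolding abs_mult using that(3)[of x] that(4)[of x] by (intro mult_mono) auto
    then show "\<bar>a x * b x\<bar> \<le> c * d * indicator (B n) x"
      by (cases "x \<in> B n") simp_all
  qed measurable
  have variational: "(\<integral>x. h x * v x \<partial>M) \<le> (\<integral>x. h x * u x \<partial>M)"
    if v_meas [measurable]: "v \<in> borel_measurable M"
      and v: "\<And>x. 0 \<le> v x" "\<And>x. v x \<le> c * indicator (B n) x" and Nv: "N (\<lambda>x. ennreal (v x)) \<le> ennreal t" for v c
  proof -
    define I where "I = (\<integral>x. h x * (v x - u x) \<partial>M)"
    define Q where "Q = (\<integral>x. (v x - u x)\<^sup>2 \<partial>M)"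
    have vu: "\<bar>v x - u x\<bar> \<le> (c + real n) * indicator (B n) x" for x
      using v(1)[of x] v(2)[of x] u(1)[of x] u_B[of x] by (simp add: distrib_right abs_le_iff)
    have ints: "integrable M (\<lambda>x. (h x)\<^sup>2)" "integrable M (\<lambda>x. h x * (v x - u x))" "integrable M (\<lambda>x. (v x - u x)\<^sup>2)"
      unfolding power2_eq_square
      by (rule prod_int[where c = "real n" and d = "real n"] prod_int[where c = "real n" and d = "c + real n"]
           prod_int[where c = "c + real n" and d = "c + real n"]; use h vu in \<open>simp add: abs_of_nonneg\<close>)+
    \<comment> \<open>Compare \<open>u\<close> with \<open>min \<phi> ((1 - e) u + e v)\<close> and let \<open>e\<close> tend to \<open>0\<close>.\<close>
    have key: "2 * I \<le> e * Q" if e: "0 < e" "e \<le> 1" for e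
    proof -
      define z where "z x = (1 - e) * u x + e * v x" for x
      let ?E = "\<lambda>x. (h x)\<^sup>2 - 2 * e * (h x * (v x - u x)) + e\<^sup>2 * (v x - u x)\<^sup>2"
      define w where "w x = min (\<phi> x) (z x)" for x
      have [measurable]: "z \<in> borel_measurable M" "w \<in> borel_measurable M"
        unfolding w_def z_def by measurable
      have z0: "0 \<le> z x" for x using e u(1)[of x] v(1)[of x] by (simp add: z_def)
      have wK: "w \<in> admissible \<phi> t"
      proof -
        have "N (\<lambda>x. ennreal (w x)) \<le> N (\<lambda>x. ennreal (z x))"
          by (rule norm_mono) (measurable, auto simp: w_def intro!: AE_I2 ennreal_leI)
        also have "\<dots> \<le> ennreal t"
          unfolding z_def using t(1) e by (intro norm_convex u_meas v_meas u(1) v(1) Nu Nv) auto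
        finally show ?thesis using \<phi>(1) z0 by (simp add: admissible_def w_def)
      qed
      have "(\<integral>x. (h x)\<^sup>2 \<partial>M) \<le> (\<integral>x. (\<phi> x - w x)\<^sup>2 \<partial>M)"
        using u_min[OF wK] by (simp add: h_def)
      also have "\<dots> \<le> (\<integral>x. ?E x \<partial>M)"
      proof (rule integral_mono_AE)
        show "integrable M (\<lambda>x. (\<phi> x - w x)\<^sup>2)"
          unfolding power2_eq_square
        proof (rule prod_int[where c = "real n" and d = "real n"])
          show "\<bar>\<phi> x - w x\<bar> \<le> real n * indicator (B n) x" for x
            using \<phi>[of x] z0[of x] by (simp add: w_def min_def abs_of_nonneg)
          then show "\<bar>\<phi> x - w x\<bar> \<le> real n * indicator (B n) x" for x .
        qed measurable
        show "integrable M (\<lambda>x. ?E x)"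
          using ints by (intro Bochner_Integration.integrable_add Bochner_Integration.integrable_diff integrable_mult_right)
        show "AE x in M. (\<phi> x - w x)\<^sup>2 \<le> ?E x"
        proof (rule AE_I2)
          fix x
          have "(\<phi> x - w x)\<^sup>2 \<le> (\<phi> x - z x)\<^sup>2"
            unfolding w_def by (cases "\<phi> x \<le> z x") simp_all
          also have "\<dots> = ?E x"
            by (simp add: h_def z_def power2_eq_square algebra_simps)
          finally show "(\<phi> x - w x)\<^sup>2 \<le> \<dots>" .
        qed
      qed
      also have "\<dots> = (\<integral>x. (h x)\<^sup>2 \<partial>M) - 2 * e * I + e\<^sup>2 * Q"
        using ints by (simp add: I_def Q_def)
      finally have "e * (2 * I) \<le> e * (e * Q)" by (simp add: power2_eq_square algebra_simps)
      then show ?thesis using e(1) by simp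
    qed
    have "I \<le> 0"
    proof (rule ccontr)
      assume "\<not> I \<le> 0"
      then have I: "0 < I" by simp
      have Q: "0 \<le> Q" by (simp add: Q_def)
      define e where "e = min 1 (I / (Q + 1))"
      have "0 < e" "e \<le> 1" using I Q by (auto simp: e_def)
      from key[OF this] have "2 * I \<le> e * Q" .
      also have "\<dots> \<le> I / (Q + 1) * Q" using Q by (intro mult_right_mono) (auto simp: e_def)
      also have "\<dots> \<le> I" using I Q by (simp add: field_simps)
      finally show False using I by simp
    qed
    moreover have "I = (\<integral>x. h x * v x \<partial>M) - (\<integral>x. h x * u x \<partial>M)"
    proof -
      have "integrable M (\<lambda>x. h x * v x)"
        by (rule prod_int[where c = "real n" and d = c]) (use h v in \<open>auto simp: abs_of_nonneg\<close>)
      moreover have "integrable M (\<lambda>x. h x * u x)"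
        by (rule prod_int[where c = "real n" and d = "real n"]) (use h u(1) u_B in \<open>auto simp: abs_of_nonneg\<close>)
      ultimately show ?thesis unfolding I_def by (simp add: right_diff_distrib)
    qed
    ultimately show ?thesis by simp
  qed
  define c where "c = (\<integral>x. h x * u x \<partial>M)"
  have hu_int: "integrable M (\<lambda>x. h x * u x)"
    by (rule prod_int[where c = "real n" and d = "real n"]) (use h u(1) u_B in \<open>auto simp: abs_of_nonneg\<close>)
  have hh_int: "integrable M (\<lambda>x. h x * h x)"
    by (rule prod_int[where c = "real n" and d = "real n"]) (use h in \<open>auto simp: abs_of_nonneg\<close>)
  have not_zero: "\<not> (AE x in M. h x = 0)"
  proof
    assume "AE x in M. h x = 0"
    then have "N (\<lambda>x. ennreal (\<phi> x)) \<le> N (\<lambda>x. ennreal (u x))"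
      by (intro norm_mono) (auto simp: h_def elim!: eventually_mono)
    with N\<phi> Nu show False by simp
  qed
  have h2: "0 < (\<integral>x. h x * h x \<partial>M)"
  proof -
    have "(\<integral>x. h x * h x \<partial>M) \<noteq> 0"
      using not_zero integral_nonneg_eq_0_iff_AE[OF hh_int] by simp
    moreover have "0 \<le> (\<integral>x. h x * h x \<partial>M)" by simp
    ultimately show ?thesis by linarith
  qed
  have c_pos: "0 < c"
  proof -
    obtain b where b: "N (indicator (B n)) = ennreal b" "0 \<le> b"
      using B_norm[of n] by (cases "N (indicator (B n))") auto
    \<comment> \<open>A small multiple of the indicator of \<open>B n\<close> is in the ball, so \<open>c = 0\<close> would force \<open>h = 0\<close>.\<close>
    define e where "e = t / (b + 1)"
    have e: "0 < e" using t(1) b by (simp add: e_def)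
    have eb: "e * b \<le> t" using t(1) b(2) by (simp add: e_def field_simps)
    have "N (\<lambda>x. ennreal (e * indicator (B n) x)) = N (\<lambda>x. ennreal e * indicator (B n) x)"
      using e by (simp add: ennreal_mult ennreal_indicator)
    also have "\<dots> = ennreal e * ennreal b"
      using e B_norm[of n] by (subst norm_scale) (auto simp: b)
    also have "\<dots> \<le> ennreal t" using e b eb by (simp add: ennreal_mult[symmetric] ennreal_leI)
    finally have "(\<integral>x. h x * (e * indicator (B n) x) \<partial>M) \<le> c"
      unfolding c_def using e by (intro variational[where c = e]) auto
    also have "(\<lambda>x. h x * (e * indicator (B n) x)) = (\<lambda>x. e * h x)"
    proof
      fix x show "h x * (e * indicator (B n) x) = e * h x"
        using h[of x] by (cases "x \<in> B n") simp_all
    qed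
    finally have "e * (\<integral>x. h x \<partial>M) \<le> c" by simp
    moreover have "integrable M h"
      by (rule integrable_dominated_by_indicator[of _ "real n" n]) (use h in auto)
    then have "(\<integral>x. h x \<partial>M) \<noteq> 0"
      using not_zero integral_nonneg_eq_0_iff_AE[of M h] h(1) by simp
    then have "0 < (\<integral>x. h x \<partial>M)"
      using h(1) by (simp add: order_less_le integral_nonneg_AE)
    ultimately show ?thesis using e by (meson mult_pos_pos order_less_le_trans)
  qed
  define g where "g x = ennreal (t / c * h x)" for x
  have [measurable]: "g \<in> borel_measurable M" unfolding g_def by measurable
  have g_eq: "g x = ennreal (1 / c) * (ennreal t * ennreal (h x))" for x
    using t(1) c_pos h(1)[of x] by (simp add: g_def ennreal_mult[symmetric])
  have dual: "(\<integral>\<^sup>+x. v x * ennreal (h x) \<partial>M) \<le> ennreal c"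
    if v_meas [measurable]: "v \<in> borel_measurable M" and Nv: "N v \<le> ennreal t" for v
  proof -
    define F where "F m x = min (v x) (of_nat m) * indicator (B n) x" for m :: nat and x
    have [measurable]: "F m \<in> borel_measurable M" for m unfolding F_def by measurable
    have F_top: "F m x < top" for m x
      by (simp add: F_def indicator_def min_less_iff_disj of_nat_less_top)
    have F_real: "ennreal (enn2real (F m x)) = F m x" for m x
      using F_top[of m x] by (simp add: ennreal_enn2real)
    have bound: "(\<integral>\<^sup>+x. F m x * ennreal (h x) \<partial>M) \<le> ennreal c" for m
    proof -
      have b: "enn2real (F m x) \<le> real m * indicator (B n) x" for x
      proof (cases "x \<in> B n")
        case True
        have "enn2real (F m x) \<le> enn2real (of_nat m)"
          by (intro enn2real_mono) (auto simp: F_def indicator_def of_nat_less_top)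
        then show ?thesis using True by simp
      qed (simp add: F_def)
      have "N (\<lambda>x. ennreal (enn2real (F m x))) \<le> N v"
        unfolding F_real by (rule norm_mono) (auto simp: F_def indicator_def)
      with Nv have "(\<integral>x. h x * enn2real (F m x) \<partial>M) \<le> c"
        unfolding c_def by (intro variational[where c = "real m"] b) auto
      moreover have "(\<integral>\<^sup>+x. F m x * ennreal (h x) \<partial>M) = (\<integral>\<^sup>+x. ennreal (h x * enn2real (F m x)) \<partial>M)"
        using h(1) by (intro nn_integral_cong) (simp add: ennreal_mult F_real mult.commute)
      moreover have "\<dots> = ennreal (\<integral>x. h x * enn2real (F m x) \<partial>M)"
      proof (rule nn_integral_eq_integral)
        show "integrable M (\<lambda>x. h x * enn2real (F m x))"
          by (rule prod_int[where c = "real n" and d = "real m"]) (use h b in \<open>auto simp: abs_of_nonneg\<close>)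
      qed (use h(1) in auto)
      ultimately show ?thesis by (simp add: ennreal_leI)
    qed
    have sup: "(SUP m. F m x * ennreal (h x)) = v x * ennreal (h x)" for x
    proof (cases "x \<in> B n")
      case True
      have "(SUP m. F m x) = v x"
        unfolding F_def by (rule SUP_truncations) (use True in auto)
      then show ?thesis by (simp add: SUP_mult_right_ennreal[symmetric])
    next
      case False
      then have "h x = 0" using h[of x] by simp
      then show ?thesis by simp
    qed
    have "incseq (\<lambda>m x. F m x * ennreal (h x))"
      unfolding F_def by (intro incseq_SucI le_funI mult_right_mono min.mono) auto
    then have "(\<integral>\<^sup>+x. (SUP m. F m x * ennreal (h x)) \<partial>M) = (SUP m. (\<integral>\<^sup>+x. F m x * ennreal (h x) \<partial>M))"
      by (rule nn_integral_monotone_convergence_SUP) measurable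
    then show ?thesis unfolding sup using bound by (simp add: SUP_least)
  qed
  show thesis
  proof (rule that)
    show "g \<in> borel_measurable M" by measurable
    fix v assume v [measurable]: "v \<in> borel_measurable M" and Nv: "N v \<le> 1"
    have "N (\<lambda>x. ennreal t * v x) = ennreal t * N v"
      using Nv t(1) by (intro norm_scale v) (auto intro: order_le_less_trans)
    also have "\<dots> \<le> ennreal t * 1" by (rule mult_left_mono[OF Nv]) simp
    finally have "(\<integral>\<^sup>+x. ennreal t * v x * ennreal (h x) \<partial>M) \<le> ennreal c"
      by (intro dual) simp_all
    then have "ennreal (1 / c) * (\<integral>\<^sup>+x. ennreal t * v x * ennreal (h x) \<partial>M) \<le> ennreal (1 / c) * ennreal c"
      by (rule mult_left_mono) simp
    also have "\<dots> = 1" using c_pos by (simp add: ennreal_mult[symmetric])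
    also have "ennreal (1 / c) * (\<integral>\<^sup>+x. ennreal t * v x * ennreal (h x) \<partial>M) = (\<integral>\<^sup>+x. ennreal (1 / c) * (ennreal t * v x * ennreal (h x)) \<partial>M)"
      by (rule nn_integral_cmult[symmetric]) measurable
    also have "\<dots> = (\<integral>\<^sup>+x. v x * g x \<partial>M)"
      by (intro nn_integral_cong) (simp only: g_eq mult_ac)
    finally show "(\<integral>\<^sup>+x. v x * g x \<partial>M) \<le> 1" .
  next
    have "t < t / c * (c + (\<integral>x. h x * h x \<partial>M))"
      using t(1) c_pos h2 by (simp add: field_simps)
    also have "c + (\<integral>x. h x * h x \<partial>M) = (\<integral>x. h x * u x + h x * h x \<partial>M)"
      unfolding c_def by (rule Bochner_Integration.integral_add[symmetric, OF hu_int hh_int])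
    also have "t / c * \<dots> = (\<integral>x. t / c * (h x * u x + h x * h x) \<partial>M)"
      by simp
    finally have "ennreal t < ennreal (\<integral>x. t / c * (h x * u x + h x * h x) \<partial>M)"
      using t(1) by (simp add: ennreal_less_iff)
    also have "\<dots> = (\<integral>\<^sup>+x. ennreal (t / c * (h x * u x + h x * h x)) \<partial>M)"
      by (rule nn_integral_eq_integral[symmetric])
         (use hu_int hh_int t(1) c_pos h(1) u(1) in auto)
    also have "\<dots> = (\<integral>\<^sup>+x. ennreal (\<phi> x) * g x \<partial>M)"
    proof (rule nn_integral_cong)
      fix x
      have eq: "t / c * (h x * u x + h x * h x) = \<phi> x * (t / c * h x)"
        by (simp add: h_def algebra_simps)
      show "ennreal (t / c * (h x * u x + h x * h x)) = ennreal (\<phi> x) * g x"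
        unfolding eq g_def by (rule ennreal_mult'[OF \<phi>(1)])
    qed
    also have "\<dots> \<le> (\<integral>\<^sup>+x. \<Phi> x * g x \<partial>M)"
      by (intro nn_integral_mono mult_right_mono \<phi>_le) simp
    finally show "ennreal t < (\<integral>\<^sup>+x. \<Phi> x * g x \<partial>M)" .
  qed
qed

end

section \<open>Ball Banach function spaces and their associates\<close>

lemma infsum_int_eq_suminf: "(\<Sum>\<^sub>\<infinity>i::int. a i) = (\<Sum>k. a (int_decode k) :: ennreal)"
proof -
  have "(\<Sum>\<^sub>\<infinity>i. a i) = (\<Sum>\<^sub>\<infinity>k. a (int_decode k))"
    using infsum_reindex_bij_betw[OF bij_int_decode, of a] by simp
  also have "\<dots> = (\<Sum>k. a (int_decode k))"
    by (intro sums_unique has_sum_imp_sums has_sum_infsum nonneg_summable_on_complete) simp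
  finally show ?thesis .
qed

lemma e2ennreal_abs_mult_enn2ereal: "e2ennreal \<bar>enn2ereal a * b\<bar> = a * e2ennreal \<bar>b\<bar>"
proof -
  have "\<bar>enn2ereal a * b\<bar> = enn2ereal (a * e2ennreal \<bar>b\<bar>)"
    by (simp add: ereal_abs_mult times_ennreal.rep_eq enn2ereal_e2ennreal)
  then show ?thesis by simp
qed

lemma borel_measurable_completion_AE:
  fixes f g :: "'a \<Rightarrow> ennreal"
  assumes "g \<in> borel_measurable (completion M)" "AE x in completion M. f x = g x"
  shows "f \<in> borel_measurable (completion M)"
proof (rule borel_measurableI_greater)
  fix c
  show "{x \<in> space (completion M). c < f x} \<in> sets (completion M)"
  proof (rule completion.in_sets_AE)
    show "AE x in completion M. (x \<in> {x \<in> space (completion M). c < g x}) = (x \<in> {x \<in> space (completion M). c < f x})"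
      using assms(2) by (rule eventually_mono) auto
    show "{x \<in> space (completion M). c < g x} \<in> sets (completion M)"
      using assms(1) by measurable
  qed auto
qed

definition nonneg_norm :: "('n::finite) fun_norm \<Rightarrow> (real ^ 'n \<Rightarrow> ennreal) \<Rightarrow> ennreal" where
  "nonneg_norm Y u = Y (\<lambda>x. enn2ereal (u x))"

lemma nonneg_norm_abs:
  assumes Y: "ball_banach_function_space Y" and g: "g \<in> borel_measurable lebesgue"
  shows "nonneg_norm Y (\<lambda>x. e2ennreal \<bar>g x\<bar>) = Y g"
proof (rule antisym)
  have mono: "\<And>f g. f \<in> borel_measurable lebesgue \<Longrightarrow> g \<in> borel_measurable lebesgue \<Longrightarrow>
      (AE x in lebesgue. \<bar>g x\<bar> \<le> \<bar>f x\<bar>) \<Longrightarrow> Y g \<le> Y f"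
    using Y by (simp add: ball_banach_function_space_def ball_quasi_banach_function_space_def)
  note [measurable] = g
  have eq: "\<bar>enn2ereal (e2ennreal \<bar>g x\<bar>)\<bar> = \<bar>g x\<bar>" for x
    by (simp add: enn2ereal_e2ennreal)
  have [measurable]: "(\<lambda>x. enn2ereal (e2ennreal \<bar>g x\<bar>)) \<in> borel_measurable lebesgue" by measurable
  show "nonneg_norm Y (\<lambda>x. e2ennreal \<bar>g x\<bar>) \<le> Y g" "Y g \<le> nonneg_norm Y (\<lambda>x. e2ennreal \<bar>g x\<bar>)"
    unfolding nonneg_norm_def by (rule mono; simp add: eq)+
qed

lemma ball_banach_function_space_nonneg_norm:
  fixes Y :: "('n::finite) fun_norm"
  assumes Y: "ball_banach_function_space Y"
  shows "Banach_function_norm lebesgue (nonneg_norm Y) (\<lambda>n. ball 0 (real (Suc n)))"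
proof -
  have qn: "\<And>f c. f \<in> space_of Y \<Longrightarrow> Y (\<lambda>x. ereal c * f x) = ennreal \<bar>c\<bar> * Y f"
    and mono: "\<And>f g. f \<in> borel_measurable lebesgue \<Longrightarrow> g \<in> borel_measurable lebesgue \<Longrightarrow>
      (AE x in lebesgue. \<bar>g x\<bar> \<le> \<bar>f x\<bar>) \<Longrightarrow> Y g \<le> Y f"
    and fatou: "\<And>F f. f \<in> borel_measurable lebesgue \<Longrightarrow> (\<And>m::nat. F m \<in> borel_measurable lebesgue) \<Longrightarrow>
      (AE x in lebesgue. (\<forall>m. 0 \<le> F m x) \<and> incseq (\<lambda>m. F m x) \<and> (\<lambda>m. F m x) \<longlonglongrightarrow> f x) \<Longrightarrow>
      (\<lambda>m. Y (F m)) \<longlonglongrightarrow> Y f"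
    and ball: "\<And>c \<rho>. 0 < \<rho> \<Longrightarrow> indicator (ball c \<rho>) \<in> space_of Y"
    and add: "\<And>f g. f \<in> space_of Y \<Longrightarrow> g \<in> space_of Y \<Longrightarrow> Y (\<lambda>x. f x + g x) \<le> Y f + Y g"
    using Y unfolding ball_banach_function_space_def ball_quasi_banach_function_space_def quasi_normed_space_def
    by blast+
  show ?thesis
  proof
    fix u v :: "real ^ 'n \<Rightarrow> ennreal" and t
    assume [measurable]: "u \<in> borel_measurable lebesgue" "v \<in> borel_measurable lebesgue"
    show "nonneg_norm Y u \<le> nonneg_norm Y v" if "AE x in lebesgue. u x \<le> v x"
      unfolding nonneg_norm_def by (rule mono) (use that in \<open>simp_all add: less_eq_ennreal.rep_eq\<close>)
    show "nonneg_norm Y (\<lambda>x. u x + v x) \<le> nonneg_norm Y u + nonneg_norm Y v"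
      if "nonneg_norm Y u < \<infinity>" "nonneg_norm Y v < \<infinity>"
      using add[of "\<lambda>x. enn2ereal (u x)" "\<lambda>x. enn2ereal (v x)"] that
      by (simp add: nonneg_norm_def space_of_def plus_ennreal.rep_eq)
  next
    fix F u t
    assume F [measurable]: "\<And>m::nat. F m \<in> borel_measurable lebesgue" and u [measurable]: "u \<in> borel_measurable lebesgue"
      and lim: "AE x in lebesgue. incseq (\<lambda>m. F m x) \<and> (\<lambda>m. F m x) \<longlonglongrightarrow> u x"
      and t: "\<And>m. nonneg_norm Y (F m) \<le> t"
    have "(\<lambda>m. Y (\<lambda>x. enn2ereal (F m x))) \<longlonglongrightarrow> Y (\<lambda>x. enn2ereal (u x))"
    proof (rule fatou)
      show "AE x in lebesgue. (\<forall>m. 0 \<le> enn2ereal (F m x)) \<and> incseq (\<lambda>m. enn2ereal (F m x)) \<and> (\<lambda>m. enn2ereal (F m x)) \<longlonglongrightarrow> enn2ereal (u x)"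
        using lim by (rule eventually_mono) (auto simp: incseq_def less_eq_ennreal.rep_eq)
    qed measurable
    then show "nonneg_norm Y u \<le> t"
      unfolding nonneg_norm_def by (rule LIMSEQ_le_const2) (use t in \<open>auto simp: nonneg_norm_def\<close>)
  next
    fix u and c :: real
    assume [measurable]: "u \<in> borel_measurable lebesgue" and "nonneg_norm Y u < \<infinity>" "0 \<le> c"
    then show "nonneg_norm Y (\<lambda>x. ennreal c * u x) = ennreal c * nonneg_norm Y u"
      using qn[of "\<lambda>x. enn2ereal (u x)" c] by (simp add: nonneg_norm_def space_of_def times_ennreal.rep_eq enn2ereal_ennreal)
  next
    fix n :: nat
    show "ball 0 (real (Suc n)) \<in> sets lebesgue" by simp
    show "emeasure lebesgue (ball (0 :: real ^ 'n) (real (Suc n))) < \<infinity>"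
      using emeasure_lborel_ball_finite[of "0 :: real ^ 'n" "real (Suc n)"] by simp
    have "(\<lambda>x :: real ^ 'n. enn2ereal (indicator (ball 0 (real (Suc n))) x)) = indicator (ball 0 (real (Suc n)))"
      by (auto simp: indicator_def fun_eq_iff zero_ennreal.rep_eq one_ennreal.rep_eq)
    then show "nonneg_norm Y (indicator (ball 0 (real (Suc n)))) < \<infinity>"
      using ball[of "real (Suc n)" 0] by (simp add: nonneg_norm_def space_of_def)
  next
    show "incseq (\<lambda>n. ball (0 :: real ^ 'n) (real (Suc n)))"
      by (auto simp: incseq_def)
    show "(\<Union>n. ball (0 :: real ^ 'n) (real (Suc n))) = UNIV"
    proof (intro set_eqI iffI UNIV_I)
      fix x :: "real ^ 'n"
      obtain n :: nat where "norm x < real n" using reals_Archimedean2 by blast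
      then have "x \<in> ball 0 (real (Suc n))" by simp
      then show "x \<in> (\<Union>n. ball 0 (real (Suc n)))" by blast
    qed
  qed
qed

lemma associate_norm_nonneg:
  "associate_norm Y (\<lambda>x. enn2ereal (w x)) =
     (SUP g \<in> {g \<in> space_of Y. Y g = 1}. \<integral>\<^sup>+x. w x * e2ennreal \<bar>g x\<bar> \<partial>lebesgue)"
  by (simp add: associate_norm_def e2ennreal_abs_mult_enn2ereal)

lemma associate_norm_le_1:
  assumes Y: "ball_banach_function_space Y"
    and dual: "\<And>v. v \<in> borel_measurable lebesgue \<Longrightarrow> nonneg_norm Y v \<le> 1 \<Longrightarrow> (\<integral>\<^sup>+x. v x * w x \<partial>lebesgue) \<le> 1"
  shows "associate_norm Y (\<lambda>x. enn2ereal (w x)) \<le> 1"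
  unfolding associate_norm_nonneg
proof (rule SUP_least)
  fix g assume "g \<in> {g \<in> space_of Y. Y g = 1}"
  then have g [measurable]: "g \<in> borel_measurable lebesgue" and "Y g = 1" by (auto simp: space_of_def)
  then have "nonneg_norm Y (\<lambda>x. e2ennreal \<bar>g x\<bar>) \<le> 1"
    using nonneg_norm_abs[OF Y g] by simp
  from dual[OF _ this] show "(\<integral>\<^sup>+x. w x * e2ennreal \<bar>g x\<bar> \<partial>lebesgue) \<le> 1"
    by (simp add: mult.commute)
qed

lemma associate_norm_Holder:
  assumes Y: "ball_banach_function_space Y" and u [measurable]: "u \<in> borel_measurable lebesgue"
    and fin: "nonneg_norm Y u < \<infinity>" and w [measurable]: "w \<in> borel_measurable lebesgue"
  shows "(\<integral>\<^sup>+x. u x * w x \<partial>lebesgue) \<le> nonneg_norm Y u * associate_norm Y (\<lambda>x. enn2ereal (w x))"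
proof -
  interpret Banach_function_norm lebesgue "nonneg_norm Y" "\<lambda>n. ball 0 (real (Suc n))"
    by (rule ball_banach_function_space_nonneg_norm[OF Y])
  obtain a where a: "nonneg_norm Y u = ennreal a" "0 \<le> a"
    using fin by (cases "nonneg_norm Y u") auto
  show ?thesis
  proof (cases "a = 0")
    case True
    have "\<forall>f\<in>borel_measurable lebesgue. Y f = 0 \<longrightarrow> (AE x in lebesgue. f x = 0)"
      using Y by (simp add: ball_banach_function_space_def ball_quasi_banach_function_space_def)
    then have "AE x in lebesgue. enn2ereal (u x) = 0"
      using True a(1) by (simp add: nonneg_norm_def)
    then have "AE x in lebesgue. u x * w x = 0"
      by (rule eventually_mono) (metis enn2ereal_inject mult_zero_left zero_ennreal.rep_eq)
    then have "(\<integral>\<^sup>+x. u x * w x \<partial>lebesgue) = 0"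
      by (subst nn_integral_0_iff_AE) measurable
    then show ?thesis by simp
  next
    case False
    then have a0: "0 < a" using a by simp
    define v where "v x = ennreal (1 / a) * u x" for x
    have v_meas [measurable]: "v \<in> borel_measurable lebesgue" unfolding v_def by measurable
    have "nonneg_norm Y v = ennreal (1 / a) * ennreal a"
      unfolding v_def using a0 fin by (subst norm_scale) (auto simp: a(1))
    also have "\<dots> = 1" using a0 by (simp add: ennreal_mult[symmetric])
    finally have "(\<lambda>x. enn2ereal (v x)) \<in> {g \<in> space_of Y. Y g = 1}"
      by (simp add: space_of_def nonneg_norm_def)
    then have "(\<integral>\<^sup>+x. w x * e2ennreal \<bar>enn2ereal (v x)\<bar> \<partial>lebesgue) \<le> associate_norm Y (\<lambda>x. enn2ereal (w x))"
      unfolding associate_norm_nonneg by (rule SUP_upper)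
    then have "(\<integral>\<^sup>+x. v x * w x \<partial>lebesgue) \<le> associate_norm Y (\<lambda>x. enn2ereal (w x))"
      by (simp add: mult.commute)
    then have "ennreal a * (\<integral>\<^sup>+x. v x * w x \<partial>lebesgue) \<le> nonneg_norm Y u * associate_norm Y (\<lambda>x. enn2ereal (w x))"
      unfolding a(1) by (rule mult_left_mono) simp
    also have "ennreal a * (\<integral>\<^sup>+x. v x * w x \<partial>lebesgue) = (\<integral>\<^sup>+x. ennreal a * (v x * w x) \<partial>lebesgue)"
      by (rule nn_integral_cmult[symmetric]) measurable
    also have "\<dots> = (\<integral>\<^sup>+x. u x * w x \<partial>lebesgue)"
    proof (rule nn_integral_cong)
      fix x
      have "ennreal a * (v x * w x) = (ennreal a * ennreal (1 / a)) * (u x * w x)"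
        by (simp add: v_def mult.assoc)
      also have "ennreal a * ennreal (1 / a) = 1" using a0 by (simp add: ennreal_mult[symmetric])
      finally show "ennreal a * (v x * w x) = u x * w x" by simp
    qed
    finally show ?thesis .
  qed
qed

lemma associate_norm_suminf_le:
  assumes g [measurable]: "\<And>k. g k \<in> borel_measurable lebesgue"
  shows "associate_norm Y (\<lambda>x. enn2ereal (\<Sum>k. c k * g k x)) \<le>
     (\<Sum>k. c k * associate_norm Y (\<lambda>x. enn2ereal (g k x)))"
  unfolding associate_norm_nonneg[of Y "\<lambda>x. \<Sum>k. c k * g k x"]
proof (rule SUP_least)
  fix h assume h: "h \<in> {g \<in> space_of Y. Y g = 1}"
  then have [measurable]: "h \<in> borel_measurable lebesgue" by (simp add: space_of_def)
  have "(\<integral>\<^sup>+x. (\<Sum>k. c k * g k x) * e2ennreal \<bar>h x\<bar> \<partial>lebesgue) = (\<integral>\<^sup>+x. (\<Sum>k. c k * (g k x * e2ennreal \<bar>h x\<bar>)) \<partial>lebesgue)"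
    by (simp only: ennreal_suminf_multc[symmetric] mult.assoc)
  also have "\<dots> = (\<Sum>k. c k * (\<integral>\<^sup>+x. g k x * e2ennreal \<bar>h x\<bar> \<partial>lebesgue))"
    by (subst nn_integral_suminf, measurable, subst nn_integral_cmult, measurable)
  also have "\<dots> \<le> (\<Sum>k. c k * associate_norm Y (\<lambda>x. enn2ereal (g k x)))"
    unfolding associate_norm_nonneg using h by (intro suminf_le mult_left_mono SUP_upper) auto
  finally show "(\<integral>\<^sup>+x. (\<Sum>k. c k * g k x) * e2ennreal \<bar>h x\<bar> \<partial>lebesgue) \<le> \<dots>" .
qed

section \<open>Extrapolation\<close>

lemma maximal_last_eq:
  "maximal_last f x = enn2ereal (maximal_fun lborel (\<lambda>y. e2ennreal \<bar>f (subst_last x y)\<bar>) (x $ Max UNIV))"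
  by (simp add: maximal_last_def maximal_fun_def nn_integral_completion)

lemma maximal_last_enn2ereal: "maximal_last (\<lambda>x. enn2ereal (g x)) x = enn2ereal (maximal_slice g x)"
  by (simp add: maximal_last_eq maximal_slice_def)

text \<open>
  The iteration of Rubio de Francia in the associate space, where countable sublinearity of the norm is
  immediate from its definition as a supremum of integrals.
\<close>

lemma A1_majorant_associate:
  fixes Y :: "('n::{finite,linorder}) fun_norm"
  assumes bnd: "bounded_on maximal_last (associate_norm Y)"
  obtains K :: real where "0 < K"
    "\<And>g. g \<in> borel_measurable borel \<Longrightarrow> associate_norm Y (\<lambda>x. enn2ereal (g x)) \<le> 1 \<Longrightarrow>
      \<exists>w\<in>borel_measurable borel. (\<forall>x. g x \<le> w x) \<and> (\<forall>x. maximal_slice w x \<le> ennreal K * w x) \<and>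
        associate_norm Y (\<lambda>x. enn2ereal (w x)) \<le> 2"
proof -
  obtain C :: real where C: "0 < C"
    and op: "\<And>f. f \<in> space_of (associate_norm Y) \<Longrightarrow> maximal_last f \<in> space_of (associate_norm Y) \<and>
      associate_norm Y (maximal_last f) \<le> ennreal C * associate_norm Y f"
    using bnd unfolding bounded_on_def by blast
  let ?A = "\<lambda>w :: real ^ ('n::{finite,linorder}) \<Rightarrow> ennreal. associate_norm Y (\<lambda>x. enn2ereal (w x))"
  have step: "?A (maximal_slice g) \<le> ennreal C * ?A g" if [measurable]: "g \<in> borel_measurable borel" and "?A g < \<infinity>" for g
  proof -
    have "(\<lambda>x. enn2ereal (g x)) \<in> space_of (associate_norm Y)"
      using that(2) by (simp add: space_of_def measurable_completion)
    with op[of "\<lambda>x. enn2ereal (g x)"] show ?thesis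
      by (simp add: maximal_last_enn2ereal[abs_def])
  qed
  define c where "c = 1 / (2 * C)"
  have c: "0 < c" using C by (simp add: c_def)
  show thesis
  proof (rule that)
    show "0 < 1 / c" using c by simp
    fix g :: "real ^ ('n::{finite,linorder}) \<Rightarrow> ennreal"
    assume g [measurable]: "g \<in> borel_measurable borel" and Ag: "?A g \<le> 1"
    define w where "w x = (\<Sum>k. ennreal (c ^ k) * (maximal_slice ^^ k) g x)" for x
    have T_sub: "maximal_slice (\<lambda>y. \<Sum>k. b k * h k y) x \<le> (\<Sum>k. b k * maximal_slice (h k) x)"
      if [measurable]: "\<And>k::nat. h k \<in> borel_measurable borel" for b h and x :: "real ^ ('n::{finite,linorder})"
      unfolding maximal_slice_def by (rule maximal_fun_suminf_le) measurable
    note R = Rubio_de_Francia_majorant[where M = borel and T = maximal_slice,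
        OF maximal_slice_measurable T_sub c g, folded w_def]
    have iter [measurable]: "(maximal_slice ^^ k) g \<in> borel_measurable borel" for k
      by (induction k) simp_all
    have A_iter: "?A ((maximal_slice ^^ k) g) \<le> ennreal (C ^ k)" for k
    proof (induction k)
      case 0
      then show ?case using Ag by simp
    next
      case (Suc k)
      have "?A ((maximal_slice ^^ k) g) < \<infinity>"
        using order_le_less_trans[OF Suc] by simp
      from step[OF iter this]
      have "?A ((maximal_slice ^^ Suc k) g) \<le> ennreal C * ?A ((maximal_slice ^^ k) g)"
        by simp
      also have "\<dots> \<le> ennreal C * ennreal (C ^ k)" by (rule mult_left_mono[OF Suc]) simp
      finally show ?case using C by (simp add: ennreal_mult)
    qed
    have "?A w \<le> (\<Sum>k. ennreal (c ^ k) * ?A ((maximal_slice ^^ k) g))"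
      unfolding w_def by (rule associate_norm_suminf_le) (simp add: measurable_completion)
    also have "\<dots> \<le> (\<Sum>k. ennreal ((1 / 2) ^ k) * 1)"
    proof (intro suminf_le)
      fix k
      have "ennreal (c ^ k) * ?A ((maximal_slice ^^ k) g) \<le> ennreal (c ^ k) * ennreal (C ^ k)"
        by (rule mult_left_mono[OF A_iter]) simp
      also have "\<dots> = ennreal ((c * C) ^ k)"
        using C c by (simp add: ennreal_mult power_mult_distrib)
      also have "c * C = 1 / 2" using C by (simp add: c_def)
      finally show "ennreal (c ^ k) * ?A ((maximal_slice ^^ k) g) \<le> ennreal ((1 / 2) ^ k) * 1" by simp
    qed simp_all
    also have "\<dots> = 2" by (simp only: suminf_half_powers) simp
    finally have "?A w \<le> 2" .
    then show "\<exists>w\<in>borel_measurable borel. (\<forall>x. g x \<le> w x) \<and> (\<forall>x. maximal_slice w x \<le> ennreal (1 / c) * w x) \<and> ?A w \<le> 2"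
      by (intro bexI[of _ w] conjI allI R)
  qed
qed

text \<open>
  Suppose the norm of the left-hand function \<open>P\<close> exceeds \<open>t > D \<parallel>Q\<parallel>\<close>.  A dual function \<open>g\<close> with
  \<open>\<integral> P g > t\<close> is replaced by an \<open>A\<^sub>1\<close> majorant \<open>w\<close> with norm at most \<open>2\<close> in the associate space; the
  weighted inequality and the Hoelder inequality then give \<open>t < D \<parallel>Q\<parallel>\<close>.
\<close>

theorem vector_valued_maximal_slice_Banach:
  fixes Y :: "('n::{finite,linorder}) fun_norm"
  assumes r: "1 < r" and p: "1 < p" and Y: "ball_banach_function_space Y"
    and bnd: "bounded_on maximal_last (associate_norm Y)"
  obtains C :: real where "0 < C"
    "\<And>f. (\<And>k::nat. f k \<in> borel_measurable borel) \<Longrightarrow>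
      nonneg_norm Y (\<lambda>x. enn_powr (\<Sum>k. enn_powr (maximal_slice (f k) x) r) (p / r)) \<le>
        ennreal C * nonneg_norm Y (\<lambda>x. enn_powr (\<Sum>k. enn_powr (f k x) r) (p / r))"
proof -
  interpret Banach_function_norm lebesgue "nonneg_norm Y" "\<lambda>n. ball 0 (real (Suc n))"
    by (rule ball_banach_function_space_nonneg_norm[OF Y])
  obtain K :: real where K: "0 < K" and major:
    "\<And>g. g \<in> borel_measurable borel \<Longrightarrow> associate_norm Y (\<lambda>x. enn2ereal (g x)) \<le> 1 \<Longrightarrow>
      \<exists>w\<in>borel_measurable borel. (\<forall>x. g x \<le> w x) \<and> (\<forall>x. maximal_slice w x \<le> ennreal K * w x) \<and>
        associate_norm Y (\<lambda>x. enn2ereal (w x)) \<le> 2"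
    by (fact A1_majorant_associate[OF bnd])
  obtain C :: real where C: "0 < C" and weighted:
    "\<And>K w f. 0 < K \<Longrightarrow> w \<in> borel_measurable borel \<Longrightarrow>
      (\<And>x. maximal_slice w x \<le> ennreal K * w x) \<Longrightarrow>
      (\<And>k::nat. f k \<in> borel_measurable borel) \<Longrightarrow>
      (\<integral>\<^sup>+x. enn_powr (\<Sum>k. enn_powr (maximal_slice (f k) x) r) (p / r) * w x \<partial>lborel)
     \<le> ennreal (C * K powr p) * (\<integral>\<^sup>+x. enn_powr (\<Sum>k. enn_powr (f k x) r) (p / r) * w (x :: real ^ ('n::{finite,linorder})) \<partial>lborel)"
    by (fact vector_valued_maximal_slice_weighted[OF r p])
  define D where "D = C * K powr p * 2"
  have D: "0 < D" using C K by (simp add: D_def)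
  show thesis
  proof (rule that[OF D])
    fix f :: "nat \<Rightarrow> real ^ ('n::{finite,linorder}) \<Rightarrow> ennreal"
    assume f [measurable]: "\<And>k. f k \<in> borel_measurable borel"
    define P where "P x = enn_powr (\<Sum>k. enn_powr (maximal_slice (f k) x) r) (p / r)" for x
    define Q where "Q x = enn_powr (\<Sum>k. enn_powr (f k x) r) (p / r)" for x
    have P_meas [measurable]: "P \<in> borel_measurable borel" and Q_meas [measurable]: "Q \<in> borel_measurable borel"
      unfolding P_def Q_def by measurable
    have "nonneg_norm Y P \<le> ennreal D * nonneg_norm Y Q"
    proof (rule ccontr)
      assume "\<not> nonneg_norm Y P \<le> ennreal D * nonneg_norm Y Q"
      then obtain z where z: "ennreal D * nonneg_norm Y Q < z" "z < nonneg_norm Y P"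
        using dense by (auto simp: not_le)
      then obtain t where t: "z = ennreal t" "0 \<le> t"
        by (cases z) (auto simp: top_unique)
      have "0 < t"
      proof -
        have "0 < z" using z(1) by (rule order_le_less_trans[rotated]) simp
        then show ?thesis using t by simp
      qed
      have Q_fin: "nonneg_norm Y Q < \<infinity>"
      proof (rule ccontr)
        assume "\<not> nonneg_norm Y Q < \<infinity>"
        then have "ennreal D * nonneg_norm Y Q = \<infinity>" using D by (simp add: ennreal_mult_top less_top[symmetric])
        with z(1) show False by simp
      qed
      have P_leb: "P \<in> borel_measurable lebesgue"
        by (simp add: measurable_completion)
      obtain g where g: "g \<in> borel_measurable lebesgue"
        and dual: "\<And>v. v \<in> borel_measurable lebesgue \<Longrightarrow> nonneg_norm Y v \<le> 1 \<Longrightarrow> (\<integral>\<^sup>+x. v x * g x \<partial>lebesgue) \<le> 1"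
        and large: "ennreal t < (\<integral>\<^sup>+x. P x * g x \<partial>lebesgue)"
        by (fact Lorentz_Luxemburg[OF P_leb \<open>0 < t\<close> z(2)[unfolded t(1)]])
      obtain g' where g' [measurable]: "g' \<in> borel_measurable borel" and gg': "AE x in lborel. g x = g' x"
        using completion_ex_borel_measurable[OF g] by auto
      have gg'_leb: "AE x in lebesgue. g x = g' x" using gg' by (rule AE_completion)
      have swap: "(\<integral>\<^sup>+x. v x * g x \<partial>lebesgue) = (\<integral>\<^sup>+x. v x * g' x \<partial>lebesgue)" for v
        using gg'_leb by (intro nn_integral_cong_AE) (auto elim!: eventually_mono)
      have "associate_norm Y (\<lambda>x. enn2ereal (g' x)) \<le> 1"
        by (rule associate_norm_le_1[OF Y]) (use dual swap in simp)
      then obtain w where w [measurable]: "w \<in> borel_measurable borel" and gw: "\<And>x. g' x \<le> w x"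
        and A1: "\<And>x. maximal_slice w x \<le> ennreal K * w x" and Aw: "associate_norm Y (\<lambda>x. enn2ereal (w x)) \<le> 2"
        using major[OF g'] by auto
      have "ennreal t < (\<integral>\<^sup>+x. P x * g' x \<partial>lebesgue)" using large swap by simp
      also have "\<dots> \<le> (\<integral>\<^sup>+x. P x * w x \<partial>lborel)"
        unfolding nn_integral_completion by (intro nn_integral_mono mult_left_mono gw) simp
      also have "\<dots> \<le> ennreal (C * K powr p) * (\<integral>\<^sup>+x. Q x * w x \<partial>lborel)"
        unfolding P_def Q_def by (rule weighted[OF K w A1 f])
      also have "(\<integral>\<^sup>+x. Q x * w x \<partial>lborel) = (\<integral>\<^sup>+x. Q x * w x \<partial>lebesgue)"
        by (simp add: nn_integral_completion)
      also have "\<dots> \<le> nonneg_norm Y Q * associate_norm Y (\<lambda>x. enn2ereal (w x))"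
        by (rule associate_norm_Holder[OF Y _ Q_fin]) (simp_all add: measurable_completion)
      also have "\<dots> \<le> nonneg_norm Y Q * 2"
        by (rule mult_left_mono[OF Aw]) simp
      also have "ennreal (C * K powr p) * (nonneg_norm Y Q * 2) = ennreal D * nonneg_norm Y Q"
        using C by (simp add: D_def ennreal_mult mult_ac)
      finally have "ennreal t < ennreal D * nonneg_norm Y Q"
        by (simp add: mult_left_mono)
      with z(1) t(1) show False by simp
    qed
    then show "nonneg_norm Y (\<lambda>x. enn_powr (\<Sum>k. enn_powr (maximal_slice (f k) x) r) (p / r)) \<le>
        ennreal D * nonneg_norm Y (\<lambda>x. enn_powr (\<Sum>k. enn_powr (f k x) r) (p / r))"
      unfolding P_def Q_def .
  qed
qed

text \<open>
  The inner power \<open>1 / p\<close> of the convexification undoes the outer power \<open>p\<close> of the mixed expression.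
\<close>

lemma convexification_lr_sum:
  assumes r: "0 < r" and p: "0 < p"
  shows "nonneg_norm (convexification X (1 / p)) (\<lambda>x. enn_powr (\<Sum>k. abs_powr (F (int_decode k) x) r) (p / r))
    = enn_powr (X (lr_sum r F)) p"
proof -
  have "enn_powr (enn_powr s (p / r)) (1 / p) = enn_powr s (1 / r)" for s
    using p by (simp add: enn_powr_powr)
  then show ?thesis
    using p by (simp add: nonneg_norm_def convexification_def abs_powr_def[of "enn2ereal _"] lr_sum_def[abs_def] infsum_int_eq_suminf)
qed

text \<open>
  What remains is bookkeeping: each \<open>f\<^sub>i\<close> is replaced by a Borel function that agrees with \<open>\<bar>f\<^sub>i\<bar>\<close> almost
  everywhere, hence almost everywhere on almost every line parallel to the last axis.  So the maximal functions
  agree almost everywhere as well, which also shows that they are measurable, as required for the lattice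
  property of the norm.
\<close>

theorem lemma2p28:
  fixes X :: "('n::{finite,linorder}) fun_norm" and r p :: real
  assumes "ball_quasi_banach_function_space X"
    and "1 < r" and "1 < p"
    and "ball_banach_function_space (convexification X (1 / p))"
    and "bounded_on maximal_last (associate_norm (convexification X (1 / p)))"
  shows "\<exists>C::real. C > 0 \<and>
           (\<forall>f :: int \<Rightarrow> real ^ ('n::{finite,linorder}) \<Rightarrow> ereal.
              (\<forall>i. f i \<in> borel_measurable lebesgue) \<longrightarrow>
              X (lr_sum r (\<lambda>i. maximal_last (f i))) \<le> ennreal C * X (lr_sum r f))"
proof -
  let ?Y = "convexification X (1 / p)"
  note r = assms(2) and p = assms(3)
  interpret Banach_function_norm lebesgue "nonneg_norm ?Y" "\<lambda>n. ball 0 (real (Suc n))"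
    by (rule ball_banach_function_space_nonneg_norm[OF assms(4)])
  obtain C :: real where C: "0 < C" and main:
    "\<And>f. (\<And>k::nat. f k \<in> borel_measurable borel) \<Longrightarrow>
      nonneg_norm ?Y (\<lambda>x. enn_powr (\<Sum>k. enn_powr (maximal_slice (f k) x) r) (p / r)) \<le>
        ennreal C * nonneg_norm ?Y (\<lambda>x. enn_powr (\<Sum>k. enn_powr (f k x) r) (p / r))"
    by (fact vector_valued_maximal_slice_Banach[OF r p assms(4,5)])
  have norm_cong: "nonneg_norm ?Y u = nonneg_norm ?Y v"
    if v: "v \<in> borel_measurable borel" and ae: "AE x in lborel. u x = v x" for u v
  proof -
    have v': "v \<in> borel_measurable lebesgue" using v by (simp add: measurable_completion)
    have ae': "AE x in lebesgue. u x = v x" using ae by (rule AE_completion)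
    have u': "u \<in> borel_measurable lebesgue" using v' ae' by (rule borel_measurable_completion_AE)
    show ?thesis
      by (intro antisym norm_mono u' v') (use ae' in \<open>auto elim!: eventually_mono\<close>)
  qed
  show ?thesis
  proof (intro exI[of _ "C powr (1 / p)"] conjI allI impI)
    show "0 < C powr (1 / p)" using C by simp
    fix f :: "int \<Rightarrow> real ^ ('n::{finite,linorder}) \<Rightarrow> ereal"
    assume f: "\<forall>i. f i \<in> borel_measurable lebesgue"
    have ex: "\<exists>\<psi>\<in>borel_measurable lborel. AE x in lborel. e2ennreal \<bar>f (int_decode k) x\<bar> = \<psi> x" for k
    proof (rule completion_ex_borel_measurable)
      have [measurable]: "f (int_decode k) \<in> borel_measurable lebesgue" using f by simp
      show "(\<lambda>x. e2ennreal \<bar>f (int_decode k) x\<bar>) \<in> borel_measurable lebesgue" by measurable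
    qed
    have "\<forall>k. \<exists>\<psi>. \<psi> \<in> borel_measurable lborel \<and> (AE x in lborel. e2ennreal \<bar>f (int_decode k) x\<bar> = \<psi> x)"
      using ex unfolding Bex_def by (rule allI)
    from choice[OF this] obtain \<psi> where \<psi>_all:
      "\<forall>k. \<psi> k \<in> borel_measurable lborel \<and> (AE x in lborel. e2ennreal \<bar>f (int_decode k) x\<bar> = \<psi> k x)" ..
    then have \<psi> [measurable]: "\<psi> k \<in> borel_measurable borel" for k by simp
    have ae: "AE x in lborel. \<forall>k. e2ennreal \<bar>f (int_decode k) x\<bar> = \<psi> k x"
      unfolding AE_all_countable using \<psi>_all by simp
    have ae_max: "AE x in lborel. \<forall>k. maximal_last (f (int_decode k)) x = enn2ereal (maximal_slice (\<psi> k) x)"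
      using AE_slices[OF ae]
    proof (rule eventually_mono)
      fix x assume *: "AE y in lborel. \<forall>k. e2ennreal \<bar>f (int_decode k) (subst_last x y)\<bar> = \<psi> k (subst_last x y)"
      show "\<forall>k. maximal_last (f (int_decode k)) x = enn2ereal (maximal_slice (\<psi> k) x)"
        unfolding maximal_last_eq maximal_slice_def
        by (intro allI arg_cong[of _ _ enn2ereal] maximal_fun_cong_AE) (use * in \<open>auto elim!: eventually_mono\<close>)
    qed
    have "enn_powr (X (lr_sum r (\<lambda>i. maximal_last (f i)))) p =
        nonneg_norm ?Y (\<lambda>x. enn_powr (\<Sum>k. abs_powr (maximal_last (f (int_decode k)) x) r) (p / r))"
      using r p by (subst convexification_lr_sum[symmetric]) simp_all
    also have "\<dots> = nonneg_norm ?Y (\<lambda>x. enn_powr (\<Sum>k. enn_powr (maximal_slice (\<psi> k) x) r) (p / r))"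
    proof (rule norm_cong)
      show "AE x in lborel. enn_powr (\<Sum>k. abs_powr (maximal_last (f (int_decode k)) x) r) (p / r)
         = enn_powr (\<Sum>k. enn_powr (maximal_slice (\<psi> k) x) r) (p / r)"
        using ae_max by (rule eventually_mono) (simp add: abs_powr_def)
    qed measurable
    also have "\<dots> \<le> ennreal C * nonneg_norm ?Y (\<lambda>x. enn_powr (\<Sum>k. enn_powr (\<psi> k x) r) (p / r))"
      by (rule main[OF \<psi>])
    also have "nonneg_norm ?Y (\<lambda>x. enn_powr (\<Sum>k. enn_powr (\<psi> k x) r) (p / r)) =
        nonneg_norm ?Y (\<lambda>x. enn_powr (\<Sum>k. abs_powr (f (int_decode k) x) r) (p / r))"
    proof (rule norm_cong[symmetric])
      show "AE x in lborel. enn_powr (\<Sum>k. abs_powr (f (int_decode k) x) r) (p / r)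
         = enn_powr (\<Sum>k. enn_powr (\<psi> k x) r) (p / r)"
        using ae by (rule eventually_mono) (simp add: abs_powr_def)
    qed measurable
    also have "\<dots> = enn_powr (X (lr_sum r f)) p"
      using r p by (subst convexification_lr_sum) simp_all
    finally have "X (lr_sum r (\<lambda>i. maximal_last (f i))) \<le> enn_powr (ennreal C * enn_powr (X (lr_sum r f)) p) (1 / p)"
      using p by (subst (asm) enn_powr_le_iff) auto
    also have "\<dots> = ennreal (C powr (1 / p)) * X (lr_sum r f)"
      using p C by (simp add: enn_powr_cmult enn_powr_powr)
    finally show "X (lr_sum r (\<lambda>i. maximal_last (f i))) \<le> ennreal (C powr (1 / p)) * X (lr_sum r f)" .
  qed
qed
end
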